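(* Let $L_z\ge 1$ be an integer. Compactify the X-cube model in the $\hat z$ direction with compactification radius $L_z$, and fix eigenvalues $\{s_i\}$ of all the string operators wrapping the $\hat z$ direction (which become local logical operators of the compactified model). Then, for each such choice of eigenvalues, the resulting symmetry breaking sector is local-unitary equivalent to $L_z-1$ copies of the 2D toric code, i.e. $n_{L_z}^{\{s_i\}}=L_z-1$.
   Context: **X-cube model.** Qubits live on the cubic lattice with three qubits per site $v\in\mathbb Z^3$; the first, second and third qubit of $v$ correspond to the edges from $v$ to $v+e_x$, $v+e_y$, $v+e_z$ respectively ($e_x,e_y,e_z$ the unit lattice vectors). The stabilizer generators are: - for every elementary cube, the product of Pauli $X$ over its 12 edges; - for every vertex $v$ and each of the three coordinate planes ($xy$, $yz$, $zx$), the product of Pauli $Z$ over the four edges incident to $v$ that lie in the plane through $v$ parallel to the given coordinate plane. All generators commute and the Hamiltonian is $\sum(1-h)$ over generators $h$. **Compactification.** The model compactified in the $\hat z$ direction with radius $L_z$ is the same set of generators with the $z$ coordinate periodic with period $L_z$ (Pauli factors that coincide after this identification are multiplied), regarded as a 2D stabilizer model with $3L_z$ qubits per site (all qubits in a $\hat z$ column are grouped onto one site), with $L_z$ fixed and $L_x,L_y\to\infty$. **Fixing local logical operators.** The string operators wrapping the $\hat z$ direction are, for all $(a,b)$: the product over $z$ of Pauli $X$ on the third qubit of $(a,b,z)$; the product over $z$ of Pauli $Z$ on the first qubit of $(a,b,z)$; the product over $z$ of Pauli $Z$ on the second qubit of $(a,b,z)$. They commute with all generators and with each other and become local operators in the compactified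 2D model. Fixing their eigenvalues to a consistent assignment of signs $\{s_i\}$ means adding them, with those signs, to the stabilizer group. The result is a sector of the compactified model, called a symmetry breaking sector. **Number of toric codes.** By a known structure theorem, a translation-invariant (up to signs) 2D topological CSS stabilizer Hamiltonian is equivalent, by a Clifford local unitary circuit, after coarse-graining and tensoring with qubits in a trivial product state, to a finite number of copies of the 2D toric code and a trivial product state. This number is denoted $n_{L_z}^{\{s_i\}}$. *)

theory Defs
  imports Complex_Main "HOL-Algebra.Generated_Groups" "HOL-Library.Product_Plus"
begin

section \<open>Pauli operators\<close>

text \<open>The triple \<open>(c, a, b)\<close> stands for the Pauli operator
  \<open>c * (product of X over a) * (product of Z over b)\<close>, in this order.\<close>

type_synonym 'q pauli = "complex \<times> 'q set \<times> 'q set"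

text \<open>Finitely supported Pauli operators on the set \<open>Q\<close> of qubits, with phases. The sign in the
  product comes from moving Z over b past X over a'.\<close>

definition pauli_group :: "'q set \<Rightarrow> 'q pauli monoid" where
  "pauli_group Q =
    \<lparr>carrier = {(c, a, b). c \<in> {1, -1, \<i>, -\<i>} \<and> finite a \<and> a \<subseteq> Q \<and> finite b \<and> b \<subseteq> Q},
     mult = (\<lambda>(c, a, b) (c', a', b').
       (c * c' * (-1) ^ card (b \<inter> a'), sym_diff a a', sym_diff b b')),
     one = (1, {}, {})\<rparr>"

definition X_op :: "'q set \<Rightarrow> 'q pauli" where
  "X_op A = (1, A, {})"

definition Z_op :: "'q set \<Rightarrow> 'q pauli" where
  "Z_op A = (1, {}, A)"

fun scale_pauli :: "complex \<Rightarrow> 'q pauli \<Rightarrow> 'q pauli" where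
  "scale_pauli k (c, a, b) = (k * c, a, b)"

fun pauli_support :: "'q pauli \<Rightarrow> 'q set" where
  "pauli_support (c, a, b) = a \<union> b"

fun relabel_pauli :: "('q \<Rightarrow> 'r) \<Rightarrow> 'q pauli \<Rightarrow> 'r pauli" where
  "relabel_pauli f (c, a, b) = (c, f ` a, f ` b)"

section \<open>Operators on finitely many qubits and Clifford gates\<close>

text \<open>The Hilbert space of a finite set \<open>A\<close> of qubits has the computational basis \<open>Pow A\<close>, a subset
  \<open>t\<close> of \<open>A\<close> standing for the basis vector whose qubits in state 1 are those in \<open>t\<close>. Operators are
  matrices indexed by \<open>Pow A\<close> (row first); entries outside \<open>Pow A\<close> are irrelevant.\<close>

type_synonym 'q operator = "'q set \<Rightarrow> 'q set \<Rightarrow> complex"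

fun pauli_matrix :: "'q pauli \<Rightarrow> 'q operator" where
  "pauli_matrix (c, a, b) s t = (if s = sym_diff t a then c * (-1) ^ card (b \<inter> t) else 0)"

definition unitary_on :: "'q set \<Rightarrow> 'q operator \<Rightarrow> bool" where
  "unitary_on A U \<longleftrightarrow> (\<forall>s\<in>Pow A. \<forall>t\<in>Pow A.
     (\<Sum>u\<in>Pow A. U s u * cnj (U t u)) = of_bool (s = t) \<and>
     (\<Sum>u\<in>Pow A. cnj (U u s) * U u t) = of_bool (s = t))"

text \<open>\<open>conjugates_to A U p p'\<close>: the operator identity \<open>U p U\<^sup>\<dagger> = p'\<close> on the qubits \<open>A\<close>.\<close>

definition conjugates_to :: "'q set \<Rightarrow> 'q operator \<Rightarrow> 'q pauli \<Rightarrow> 'q pauli \<Rightarrow> bool" where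
  "conjugates_to A U p p' \<longleftrightarrow> (\<forall>s\<in>Pow A. \<forall>t\<in>Pow A.
     (\<Sum>u\<in>Pow A. \<Sum>v\<in>Pow A. U s u * pauli_matrix p u v * cnj (U t v)) = pauli_matrix p' s t)"

definition clifford_gate :: "'q set \<Rightarrow> 'q operator \<Rightarrow> bool" where
  "clifford_gate A U \<longleftrightarrow> finite A \<and> unitary_on A U \<and>
     (\<forall>p\<in>carrier (pauli_group A). \<exists>p'\<in>carrier (pauli_group A). conjugates_to A U p p')"

section \<open>Stabilizer models on the square lattice and local unitary circuits\<close>

type_synonym plane_qubit = "(int \<times> int) \<times> nat"

definition plane_qubits :: "nat \<Rightarrow> plane_qubit set" where
  "plane_qubits N = UNIV \<times> {..<N}"

abbreviation plane_paulis :: "nat \<Rightarrow> plane_qubit pauli monoid" where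
  "plane_paulis N \<equiv> pauli_group (plane_qubits N)"

text \<open>A model is recorded by its number of qubits per site and its signed stabilizer group.\<close>

record stabilizer_model =
  qubits_per_site :: nat
  stabilizers :: "plane_qubit pauli set"

definition within_range :: "int \<Rightarrow> plane_qubit set \<Rightarrow> bool" where
  "within_range r A \<longleftrightarrow> (\<forall>q\<in>A. \<forall>q'\<in>A.
     \<bar>fst (fst q) - fst (fst q')\<bar> \<le> r \<and> \<bar>snd (fst q) - snd (fst q')\<bar> \<le> r)"

text \<open>A layer is a (usually infinite) family of Clifford gates with disjoint supports of uniformly
  bounded diameter. It is represented by its conjugation action \<open>\<phi>\<close> on the finitely supported Pauli
  operators: the group homomorphism that acts on the Pauli operators on the support of a gate as
  conjugation by this gate and that fixes the Pauli operators disjoint from all gates. Such Pauli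
  operators generate the group, so the gates determine \<open>\<phi>\<close> on it.\<close>

definition clifford_layer :: "nat \<Rightarrow> (plane_qubit pauli \<Rightarrow> plane_qubit pauli) \<Rightarrow> bool" where
  "clifford_layer N \<phi> \<longleftrightarrow> (\<exists>G r.
     (\<forall>(A, U)\<in>G. A \<subseteq> plane_qubits N \<and> within_range r A \<and> clifford_gate A U) \<and>
     pairwise (\<lambda>g h. disjnt (fst g) (fst h)) G \<and>
     \<phi> \<in> hom (plane_paulis N) (plane_paulis N) \<and>
     (\<forall>(A, U)\<in>G. \<forall>p\<in>carrier (pauli_group A).
        \<phi> p \<in> carrier (pauli_group A) \<and> conjugates_to A U p (\<phi> p)) \<and>
     (\<forall>p\<in>carrier (plane_paulis N). disjnt (pauli_support p) (\<Union>(fst ` G)) \<longrightarrow> \<phi> p = p))"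

inductive clifford_circuit :: "nat \<Rightarrow> (plane_qubit pauli \<Rightarrow> plane_qubit pauli) \<Rightarrow> bool"
  for N where
  empty_circuit: "clifford_circuit N id"
| add_layer: "clifford_circuit N \<phi> \<Longrightarrow> clifford_layer N \<psi> \<Longrightarrow> clifford_circuit N (\<psi> \<circ> \<phi>)"

definition lu_equivalent :: "stabilizer_model \<Rightarrow> stabilizer_model \<Rightarrow> bool" where
  "lu_equivalent M M' \<longleftrightarrow> qubits_per_site M = qubits_per_site M' \<and>
     (\<exists>\<phi>. clifford_circuit (qubits_per_site M) \<phi> \<and> \<phi> ` stabilizers M = stabilizers M')"

text \<open>Coarse-graining merges each \<open>kx \<times> ky\<close> block of sites into one site.\<close>

definition coarse_label :: "nat \<Rightarrow> nat \<Rightarrow> nat \<Rightarrow> plane_qubit \<Rightarrow> plane_qubit" where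
  "coarse_label kx ky N = (\<lambda>((x, y), j).
     ((x div int kx, y div int ky),
      j + N * (nat (x mod int kx) + kx * nat (y mod int ky))))"

definition coarse_grain :: "nat \<Rightarrow> nat \<Rightarrow> stabilizer_model \<Rightarrow> stabilizer_model" where
  "coarse_grain kx ky M =
    \<lparr>qubits_per_site = kx * ky * qubits_per_site M,
     stabilizers = relabel_pauli (coarse_label kx ky (qubits_per_site M)) ` stabilizers M\<rparr>"

text \<open>Tensoring with \<open>m\<close> additional qubits per site in the state stabilized by all their Z.\<close>

definition add_product_state :: "nat \<Rightarrow> stabilizer_model \<Rightarrow> stabilizer_model" where
  "add_product_state m M = (let N = qubits_per_site M in
    \<lparr>qubits_per_site = N + m,
     stabilizers = generate (plane_paulis (N + m))
       (stabilizers M \<union> {Z_op {(v, j)} |v j. N \<le> j \<and> j < N + m})\<rparr>)"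

section \<open>Copies of the toric code\<close>

text \<open>In copy \<open>c\<close>, the edges from \<open>(x, y)\<close> to \<open>(x + 1, y)\<close> and to \<open>(x, y + 1)\<close> are the qubits
  \<open>2 * c\<close> and \<open>2 * c + 1\<close> of the site \<open>(x, y)\<close>.\<close>

definition toric_star :: "nat \<Rightarrow> int \<Rightarrow> int \<Rightarrow> plane_qubit set" where
  "toric_star c x y =
     {((x, y), 2 * c), ((x - 1, y), 2 * c), ((x, y), 2 * c + 1), ((x, y - 1), 2 * c + 1)}"

definition toric_plaquette :: "nat \<Rightarrow> int \<Rightarrow> int \<Rightarrow> plane_qubit set" where
  "toric_plaquette c x y =
     {((x, y), 2 * c), ((x, y + 1), 2 * c), ((x, y), 2 * c + 1), ((x + 1, y), 2 * c + 1)}"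

definition toric_codes :: "nat \<Rightarrow> stabilizer_model" where
  "toric_codes n =
    \<lparr>qubits_per_site = 2 * n,
     stabilizers = generate (plane_paulis (2 * n))
       ({X_op (toric_star c x y) |c x y. c < n} \<union> {Z_op (toric_plaquette c x y) |c x y. c < n})\<rparr>"

definition equivalent_to_toric_codes :: "stabilizer_model \<Rightarrow> nat \<Rightarrow> bool" where
  "equivalent_to_toric_codes M n \<longleftrightarrow> (\<exists>kx ky m m'. kx \<ge> 1 \<and> ky \<ge> 1 \<and>
     lu_equivalent (add_product_state m (coarse_grain kx ky M))
       (add_product_state m' (toric_codes n)))"

definition toric_code_number :: "stabilizer_model \<Rightarrow> nat" where
  "toric_code_number M = (THE n. equivalent_to_toric_codes M n)"

section \<open>The X-cube model and its compactification\<close>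

text \<open>The qubits \<open>(v, 0)\<close>, \<open>(v, 1)\<close>, \<open>(v, 2)\<close> are the edges from \<open>v\<close> in the directions x, y, z.\<close>

type_synonym cubic_qubit = "(int \<times> int \<times> int) \<times> nat"

definition unit_vector :: "nat \<Rightarrow> int \<times> int \<times> int" where
  "unit_vector i = (of_bool (i = 0), of_bool (i = 1), of_bool (i = 2))"

definition cube_edges :: "int \<times> int \<times> int \<Rightarrow> cubic_qubit set" where
  "cube_edges = (\<lambda>(x, y, z).
     {((x, y + d, z + d'), 0) |d d'. d \<in> {0, 1} \<and> d' \<in> {0, 1}} \<union>
     {((x + d, y, z + d'), 1) |d d'. d \<in> {0, 1} \<and> d' \<in> {0, 1}} \<union>
     {((x + d, y + d', z), 2) |d d'. d \<in> {0, 1} \<and> d' \<in> {0, 1}})"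

text \<open>The edges at \<open>v\<close> in the coordinate plane spanned by the directions \<open>i\<close> and \<open>j\<close>.\<close>

definition planar_star :: "nat \<Rightarrow> nat \<Rightarrow> int \<times> int \<times> int \<Rightarrow> cubic_qubit set" where
  "planar_star i j v = {(v, i), (v - unit_vector i, i), (v, j), (v - unit_vector j, j)}"

definition xcube_generators :: "cubic_qubit pauli set" where
  "xcube_generators =
     {X_op (cube_edges v) |v. True} \<union>
     {Z_op (planar_star i j v) |i j v. (i, j) \<in> {(0, 1), (1, 2), (2, 0)}}"

definition column_label :: "nat \<Rightarrow> cubic_qubit \<Rightarrow> plane_qubit" where
  "column_label L = (\<lambda>((x, y, z), i). ((x, y), 3 * nat (z mod int L) + i))"

text \<open>Multiplying the Pauli factors that coincide after the identification leaves those of odd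
  multiplicity. (No phase arises, since this is only applied to operators of pure X or pure Z
  type.)\<close>

definition fold_qubits :: "nat \<Rightarrow> cubic_qubit set \<Rightarrow> plane_qubit set" where
  "fold_qubits L A = {u. odd (card {q \<in> A. column_label L q = u})}"

fun fold_pauli :: "nat \<Rightarrow> cubic_qubit pauli \<Rightarrow> plane_qubit pauli" where
  "fold_pauli L (c, a, b) = (c, fold_qubits L a, fold_qubits L b)"

definition compactified_xcube :: "nat \<Rightarrow> stabilizer_model" where
  "compactified_xcube L =
    \<lparr>qubits_per_site = 3 * L,
     stabilizers = generate (plane_paulis (3 * L)) (fold_pauli L ` xcube_generators)\<rparr>"

text \<open>The strings wrapping the z direction over \<open>(a, b)\<close>, indexed by the qubit \<open>i < 3\<close> on which
  they act: X for the third qubit, Z for the first and the second one.\<close>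

definition wrapping_string :: "nat \<Rightarrow> nat \<Rightarrow> int \<times> int \<Rightarrow> plane_qubit pauli" where
  "wrapping_string L i = (\<lambda>(a, b).
     let W = {((a, b, z), i) |z. 0 \<le> z \<and> z < int L}
     in fold_pauli L (if i = 2 then X_op W else Z_op W))"

text \<open>Fixing the eigenvalue of the string \<open>W\<close> with index \<open>i\<close> over \<open>v\<close> to the sign \<open>s i v\<close> adds the
  stabilizer \<open>s i v * W\<close>.\<close>

definition symmetry_breaking_sector ::
    "nat \<Rightarrow> (nat \<Rightarrow> int \<times> int \<Rightarrow> complex) \<Rightarrow> stabilizer_model" where
  "symmetry_breaking_sector L s =
    \<lparr>qubits_per_site = 3 * L,
     stabilizers = generate (plane_paulis (3 * L))
       (stabilizers (compactified_xcube L) \<union>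
        {scale_pauli (s i v) (wrapping_string L i v) |i v. i < 3})\<rparr>"

text \<open>A sign assignment is consistent if the resulting stabilizer group does not contain -1.\<close>

definition consistent_signs :: "nat \<Rightarrow> (nat \<Rightarrow> int \<times> int \<Rightarrow> complex) \<Rightarrow> bool" where
  "consistent_signs L s \<longleftrightarrow> (\<forall>i<3. \<forall>v. s i v \<in> {1, -1}) \<and>
     (-1, {}, {}) \<notin> stabilizers (symmetry_breaking_sector L s)"

end

(*
Existence.  On-site controlled-not gates turn the wrapping strings into single-qubit operators and
split the rest of each column into L - 1 three-qubit codes with the X generator
(1 + Y) a + (1 + X) b + (1 + X)(1 + Y) c and the Z generators (1 + 1/X) a + c and (1 + 1/Y) b + c,
written as polynomials in the translations X and Y. Controlled-not gates implementing a -> a + (1 + X) c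
decouple c, and a and b form a toric code with X and Z exchanged, which Hadamard gates repair. The
signs end up on decoupled qubits only, because a stabilizer group without -1 is determined by signed
generators of its phase-free part, and Pauli gates remove them there.

Uniqueness.  The stabilizers supported outside a large disk, modulo products of local stabilizers
outside a disk, form a vector space of dimension 2 n over the field with two elements for n toric
codes: they are the closed strings around the disk. A circuit preserves this dimension because it is
local in both directions, and so do coarse-graining and adding product states.
*)
theory Submission
  imports Defs
begin

section \<open>Finite sets as vectors over the field with two elements\<close>

text \<open>On the infinite plane there is no ground-state degeneracy to count, and the circuits
  need not be translation invariant, so the invariant must live in the large-scale geometry of the
  stabilizer group: its radii and diameters are existentially quantified, because every circuit and
  every coarse-graining changes them. Phases are dropped for it, which makes an operator a finite
  set of X and Z factors, added over the field with two elements. In the toric code a stabilizer is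
  the boundary of a unique finite region of cells, and its charge vector tells for which kinds of
  cells the region contains the origin. Dimensions are compared by the pigeonhole principle on the
  \<open>2 ^ k\<close> charge vectors, so no quotient space is formed. No inverse circuit is built
  either: a homomorphism that fixes phases preserves commutation signs, and this alone bounds the
  spread of its inverse. For existence the difficulty is the arbitrary family of signs. The signed
  single-qubit and toric generators are shown to lie in the transformed group exactly, while the
  converse inclusion is checked without phases only.\<close>

definition xor :: "'a set \<Rightarrow> 'a set \<Rightarrow> 'a set" (infixl \<open>\<triangle>\<close> 65) where
  "A \<triangle> B = sym_diff A B"

lemma in_xor [simp]: "x \<in> A \<triangle> B \<longleftrightarrow> (x \<in> A) \<noteq> (x \<in> B)"
  by (auto simp: xor_def)

lemma xor_commute: "A \<triangle> B = B \<triangle> A"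
  and xor_assoc: "A \<triangle> B \<triangle> C = A \<triangle> (B \<triangle> C)"
  and xor_left_commute: "A \<triangle> (B \<triangle> C) = B \<triangle> (A \<triangle> C)"
  by auto

lemmas xor_ac = xor_commute xor_assoc xor_left_commute

lemma xor_empty [simp]: "A \<triangle> {} = A" "{} \<triangle> A = A"
  and xor_self [simp]: "A \<triangle> A = {}" "A \<triangle> (A \<triangle> B) = B"
  by auto

lemma xor_eq_empty_iff [simp]: "A \<triangle> B = {} \<longleftrightarrow> A = B"
  by (auto simp: set_eq_iff)

lemma finite_xor [intro, simp]: "finite A \<Longrightarrow> finite B \<Longrightarrow> finite (A \<triangle> B)"
  by (simp add: xor_def)

lemma xor_subset: "A \<subseteq> C \<Longrightarrow> B \<subseteq> C \<Longrightarrow> A \<triangle> B \<subseteq> C"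
  by (auto simp: xor_def)

lemma insert_eq_xor: "x \<notin> A \<Longrightarrow> insert x A = {x} \<triangle> A"
  by auto

lemma image_xor: "inj_on f C \<Longrightarrow> A \<subseteq> C \<Longrightarrow> B \<subseteq> C \<Longrightarrow> f ` (A \<triangle> B) = f ` A \<triangle> f ` B"
  by (simp add: xor_def image_Un) (subst (1 2) inj_on_image_set_diff[of f C]; blast)

definition xor_sum :: "('a \<Rightarrow> 'b set) \<Rightarrow> 'a set \<Rightarrow> 'b set" where
  "xor_sum = comm_monoid_set.F (\<triangle>) {}"

interpretation xor_sum: comm_monoid_set "(\<triangle>)" "{}"
  rewrites "comm_monoid_set.F (\<triangle>) {} = xor_sum"
proof -
  show "comm_monoid_set (\<triangle>) ({} :: 'a set)"
    by standard (auto simp: xor_ac)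
qed (simp add: xor_sum_def)

lemma in_xor_sum: "finite A \<Longrightarrow> u \<in> xor_sum f A \<longleftrightarrow> odd (card {q \<in> A. u \<in> f q})"
proof (induction A rule: finite_induct)
  case (insert x F)
  have "{q \<in> insert x F. u \<in> f q} =
      (if u \<in> f x then insert x {q \<in> F. u \<in> f q} else {q \<in> F. u \<in> f q})"
    by auto
  with insert show ?case by auto
qed simp

lemma finite_xor_sum: "(\<And>q. q \<in> A \<Longrightarrow> finite (f q)) \<Longrightarrow> finite (xor_sum f A)"
  by (induction A rule: infinite_finite_induct) auto

lemma xor_sum_subset: "(\<And>q. q \<in> A \<Longrightarrow> f q \<subseteq> C) \<Longrightarrow> xor_sum f A \<subseteq> C"
  by (induction A rule: infinite_finite_induct) (auto simp: xor_subset)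

lemma xor_sum_singletons: "finite A \<Longrightarrow> xor_sum (\<lambda>q. {q}) A = A"
  by (induction A rule: finite_induct) (simp_all flip: insert_eq_xor)

text \<open>Terms over the common part of \<open>A\<close> and \<open>B\<close> occur in both sums
  and cancel.\<close>

lemma xor_sum_xor:
  assumes "finite A" "finite B"
  shows "xor_sum f (A \<triangle> B) = xor_sum f A \<triangle> xor_sum f B"
proof -
  have "xor_sum f A = xor_sum f (A - B) \<triangle> xor_sum f (A \<inter> B)"
    if "finite A" for A B :: "'a set"
    using xor_sum.Int_Diff[OF that, of f B] by (simp add: xor_commute)
  from this[OF assms(1), of B] this[OF assms(2), of A]
  have "xor_sum f A \<triangle> xor_sum f B = xor_sum f (A - B) \<triangle> xor_sum f (B - A)"
    by (simp add: xor_ac Int_commute)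
  also have "\<dots> = xor_sum f ((A - B) \<union> (B - A))"
    by (rule xor_sum.union_disjoint[symmetric]) (use assms in auto)
  finally show ?thesis by (simp add: xor_def)
qed

text \<open>Additivity of \<open>h\<close> is asked for finite summands only, because the instance
  of interest, \<open>h = xor_sum g\<close>, is additive only on finite sets.\<close>

lemma xor_sum_hom:
  assumes "h {} = {}" "\<And>q a. finite a \<Longrightarrow> q \<in> A \<Longrightarrow> h (f q \<triangle> a) = h (f q) \<triangle> h a"
    "\<And>q. q \<in> A \<Longrightarrow> finite (f q)"
  shows "h (xor_sum f A) = xor_sum (\<lambda>q. h (f q)) A"
  using assms(2,3)
proof (induction A rule: infinite_finite_induct)
  case (insert x F)
  then show ?case by (auto simp: finite_xor_sum)
qed (use assms(1) in auto)

lemma xor_sum_xor_sum: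
  assumes "\<And>q. q \<in> A \<Longrightarrow> finite (f q)"
  shows "xor_sum g (xor_sum f A) = xor_sum (\<lambda>q. xor_sum g (f q)) A"
  using assms by (intro xor_sum_hom) (auto simp: xor_sum_xor)

section \<open>Spans over the field with two elements\<close>

inductive_set xor_span :: "'a set set \<Rightarrow> 'a set set" for A where
  empty: "{} \<in> xor_span A"
| step: "a \<in> A \<Longrightarrow> b \<in> xor_span A \<Longrightarrow> a \<triangle> b \<in> xor_span A"

lemma xor_span_base: "a \<in> A \<Longrightarrow> a \<in> xor_span A"
  using xor_span.step[OF _ xor_span.empty] by fastforce

lemma xor_span_xor: "a \<in> xor_span A \<Longrightarrow> b \<in> xor_span A \<Longrightarrow> a \<triangle> b \<in> xor_span A"
  by (induction rule: xor_span.induct) (auto simp: xor_assoc intro: xor_span.step)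

lemma xor_sum_in_span: "(\<And>q. q \<in> T \<Longrightarrow> f q \<in> xor_span A) \<Longrightarrow> xor_sum f T \<in> xor_span A"
  by (induction T rule: infinite_finite_induct) (auto intro: xor_span_xor xor_span.empty)

lemma xor_span_least:
  assumes "{} \<in> B" "A \<subseteq> B" "\<And>a b. a \<in> B \<Longrightarrow> b \<in> B \<Longrightarrow> a \<triangle> b \<in> B"
  shows "xor_span A \<subseteq> B"
proof
  fix x assume "x \<in> xor_span A"
  then show "x \<in> B" by induction (use assms in auto)
qed

lemma xor_span_subset: "A \<subseteq> xor_span B \<Longrightarrow> xor_span A \<subseteq> xor_span B"
  by (rule xor_span_least) (auto intro: xor_span.empty xor_span_xor)

lemma xor_span_mono: "A \<subseteq> B \<Longrightarrow> xor_span A \<subseteq> xor_span B"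
  by (rule xor_span_subset) (auto intro: xor_span_base)

text \<open>Repeated generators cancel, so a member of the span is given by the finite set of
  indices used an odd number of times. For the toric code this set is the region whose boundary is
  the stabilizer.\<close>

lemma xor_span_image:
  "xor_span (G ` J) = {xor_sum G T |T. finite T \<and> T \<subseteq> J}"
proof
  show "xor_span (G ` J) \<subseteq> {xor_sum G T |T. finite T \<and> T \<subseteq> J}"
  proof (rule xor_span_least)
    show "{} \<in> {xor_sum G T |T. finite T \<and> T \<subseteq> J}"
      using xor_sum.empty[of G] by blast
    show "G ` J \<subseteq> {xor_sum G T |T. finite T \<and> T \<subseteq> J}"
    proof
      fix a assume "a \<in> G ` J"
      then obtain j where "j \<in> J" "a = G j" by auto
      then show "a \<in> {xor_sum G T |T. finite T \<and> T \<subseteq> J}"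
        by (intro CollectI exI[of _ "{j}"]) auto
    qed
    fix a b assume "a \<in> {xor_sum G T |T. finite T \<and> T \<subseteq> J}"
      "b \<in> {xor_sum G T |T. finite T \<and> T \<subseteq> J}"
    then obtain T T' where *: "finite T" "T \<subseteq> J" "a = xor_sum G T"
        "finite T'" "T' \<subseteq> J" "b = xor_sum G T'" by blast
    then show "a \<triangle> b \<in> {xor_sum G T |T. finite T \<and> T \<subseteq> J}"
      by (intro CollectI exI[of _ "T \<triangle> T'"]) (auto simp: xor_sum_xor)
  qed
  show "{xor_sum G T |T. finite T \<and> T \<subseteq> J} \<subseteq> xor_span (G ` J)"
    by (blast intro: xor_sum_in_span xor_span_base)
qed

section \<open>The Pauli group\<close>

text \<open>The commutation sign of Z over \<open>b\<close> and X over \<open>a\<close>: the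
  bilinear pairing of finite sets, written multiplicatively.\<close>

definition parity :: "'a set \<Rightarrow> 'a set \<Rightarrow> complex" where
  "parity b a = (-1) ^ card (b \<inter> a)"

lemma parity_commute: "parity b a = parity a b"
  by (simp add: parity_def Int_commute)

lemma parity_values: "parity b a \<in> {1, -1}"
  by (simp add: parity_def) (metis neg_one_even_power neg_one_odd_power)

lemma parity_empty [simp]: "parity {} a = 1" "parity b {} = 1"
  by (auto simp: parity_def)

lemma parity_disjnt: "disjnt b a \<Longrightarrow> parity b a = 1"
  by (simp add: parity_def disjnt_def)

lemma parity_singleton [simp]: "parity {q} a = (if q \<in> a then -1 else 1)"
  "parity b {q} = (if q \<in> b then -1 else 1)"
  by (auto simp: parity_def)

lemma parity_square [simp]: "parity b a * parity b a = 1" "parity b a * (parity b a * c) = c"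
  using parity_values[of b a] by auto

lemma parity_insert:
  "finite b \<Longrightarrow> q \<notin> b \<Longrightarrow> parity (insert q b) a = (if q \<in> a then -1 else 1) * parity b a"
  by (simp add: parity_def)

lemma parity_eq_prod: "finite b \<Longrightarrow> parity b a = (\<Prod>q\<in>b. if q \<in> a then -1 else 1)"
  by (induction b rule: finite_induct) (auto simp: parity_insert)

text \<open>Elements of both \<open>b\<close> and \<open>b'\<close> contribute the square of a
  sign.\<close>

lemma parity_xor_left:
  assumes "finite b" "finite b'"
  shows "parity (b \<triangle> b') a = parity b a * parity b' a"
proof -
  let ?f = "\<lambda>q. if q \<in> a then -1 else (1 :: complex)"
  have "prod ?f b = prod ?f (b \<inter> c) * prod ?f (b - c)" if "finite b" for b c
    using prod.Int_Diff[OF that, of ?f c] .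
  from this[OF assms(1), of b'] this[OF assms(2), of b]
  have "prod ?f b * prod ?f b' =
      (prod ?f (b \<inter> b') * prod ?f (b \<inter> b')) * (prod ?f (b - b') * prod ?f (b' - b))"
    by (simp add: Int_commute)
  also have "prod ?f (b \<inter> b') * prod ?f (b \<inter> b') = 1"
    using assms by (simp flip: parity_eq_prod)
  also have "prod ?f (b - b') * prod ?f (b' - b) = prod ?f ((b - b') \<union> (b' - b))"
    by (rule prod.union_disjoint[symmetric]) (use assms in auto)
  finally show ?thesis
    using assms by (simp add: parity_eq_prod) (simp add: xor_def)
qed

lemma parity_xor_right: "finite b \<Longrightarrow> finite b' \<Longrightarrow> parity a (b \<triangle> b') = parity a b * parity a b'"
  using parity_xor_left[of b b' a] by (simp add: parity_commute)

abbreviation phases :: "complex set" where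
  "phases \<equiv> {1, -1, \<i>, -\<i>}"

lemma phases_mult: "c \<in> phases \<Longrightarrow> c' \<in> phases \<Longrightarrow> c * c' \<in> phases"
  by auto

lemma phases_parity: "c \<in> phases \<Longrightarrow> c * parity b a \<in> phases"
  using parity_values[of b a] by auto

lemma carrier_pauli_group: "(c, a, b) \<in> carrier (pauli_group Q) \<longleftrightarrow>
    c \<in> phases \<and> finite a \<and> a \<subseteq> Q \<and> finite b \<and> b \<subseteq> Q"
  by (simp add: pauli_group_def)

lemma mult_pauli_group: "(c, a, b) \<otimes>\<^bsub>pauli_group Q\<^esub> (c', a', b') =
    (c * c' * parity b a', a \<triangle> a', b \<triangle> b')"
  by (simp add: pauli_group_def xor_def parity_def)

lemma one_pauli_group: "\<one>\<^bsub>pauli_group Q\<^esub> = (1, {}, {})"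
  by (simp add: pauli_group_def)

lemmas pauli_group_simps = carrier_pauli_group mult_pauli_group one_pauli_group

lemma group_pauli_group: "group (pauli_group Q)"
proof (rule groupI)
  fix x y assume "x \<in> carrier (pauli_group Q)" "y \<in> carrier (pauli_group Q)"
  then show "x \<otimes>\<^bsub>pauli_group Q\<^esub> y \<in> carrier (pauli_group Q)"
    by (cases x; cases y)
      (simp add: pauli_group_simps phases_mult phases_parity xor_subset del: insert_iff)
next
  fix x y z assume "x \<in> carrier (pauli_group Q)" "y \<in> carrier (pauli_group Q)"
    "z \<in> carrier (pauli_group Q)"
  then show "x \<otimes>\<^bsub>pauli_group Q\<^esub> y \<otimes>\<^bsub>pauli_group Q\<^esub> z =
      x \<otimes>\<^bsub>pauli_group Q\<^esub> (y \<otimes>\<^bsub>pauli_group Q\<^esub> z)"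
    by (cases x; cases y; cases z)
      (simp add: pauli_group_simps xor_ac parity_xor_left parity_xor_right del: insert_iff)
next
  fix x assume x: "x \<in> carrier (pauli_group Q)"
  obtain c a b where [simp]: "x = (c, a, b)" by (cases x)
  have "cnj c \<in> phases" "cnj c * c = 1"
    using x by (auto simp: pauli_group_simps)
  \<comment> \<open>The square of \<open>(c, a, b)\<close> is \<open>c * c * parity b a\<close>
    times the unit, which dictates the phase of the inverse.\<close>
  then show "\<exists>y\<in>carrier (pauli_group Q). y \<otimes>\<^bsub>pauli_group Q\<^esub> x = \<one>\<^bsub>pauli_group Q\<^esub>"
    using x
    by (intro bexI[of _ "(cnj c * parity b a, a, b)"])
      (simp_all add: pauli_group_simps phases_parity ac_simps del: insert_iff)
qed (auto simp: pauli_group_simps)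

lemma X_op_carrier [simp]: "X_op a \<in> carrier (pauli_group Q) \<longleftrightarrow> finite a \<and> a \<subseteq> Q"
  and Z_op_carrier [simp]: "Z_op a \<in> carrier (pauli_group Q) \<longleftrightarrow> finite a \<and> a \<subseteq> Q"
  by (auto simp: X_op_def Z_op_def pauli_group_simps)

lemma scale_pauli_carrier:
  "k \<in> {1, -1} \<Longrightarrow> p \<in> carrier (pauli_group Q) \<Longrightarrow> scale_pauli k p \<in> carrier (pauli_group Q)"
  by (cases p) (auto simp: pauli_group_simps)

text \<open>The operator without its phase, as a vector: the X part on the left, the Z part on the
  right.\<close>

fun pauli_vector :: "'q pauli \<Rightarrow> ('q + 'q) set" where
  "pauli_vector (c, a, b) = a <+> b"

lemma xor_Plus: "(a <+> b) \<triangle> (a' <+> b') = (a \<triangle> a') <+> (b \<triangle> b')"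
  by (auto simp: set_eq_iff Plus_def image_iff)

lemma pauli_vector_mult [simp]:
  "pauli_vector (p \<otimes>\<^bsub>pauli_group Q\<^esub> p') = pauli_vector p \<triangle> pauli_vector p'"
  by (cases p; cases p') (simp add: mult_pauli_group xor_Plus)

lemma pauli_vector_one [simp]: "pauli_vector \<one>\<^bsub>pauli_group Q\<^esub> = {}"
  by (simp add: one_pauli_group)

lemma pauli_vector_inv [simp]:
  assumes "p \<in> carrier (pauli_group Q)"
  shows "pauli_vector (inv\<^bsub>pauli_group Q\<^esub> p) = pauli_vector p"
proof -
  interpret group "pauli_group Q" by (rule group_pauli_group)
  have "pauli_vector (inv\<^bsub>pauli_group Q\<^esub> p \<otimes>\<^bsub>pauli_group Q\<^esub> p) = {}"
    using assms by (simp del: pauli_vector_mult)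
  then show ?thesis by simp
qed

lemma pauli_vector_scale [simp]: "pauli_vector (scale_pauli k p) = pauli_vector p"
  by (cases p) simp

text \<open>Modulo phases every operator is its own inverse, so group generation becomes linear
  span.\<close>

lemma pauli_vector_generate:
  assumes "A \<subseteq> carrier (pauli_group Q)"
  shows "pauli_vector ` generate (pauli_group Q) A = xor_span (pauli_vector ` A)"
proof (intro subset_antisym subsetI)
  fix x assume "x \<in> pauli_vector ` generate (pauli_group Q) A"
  then obtain p where p: "p \<in> generate (pauli_group Q) A" and [simp]: "x = pauli_vector p" by blast
  from p have "pauli_vector p \<in> xor_span (pauli_vector ` A)"
  proof induction
    case (inv h)
    then show ?case
      using assms by (simp add: subsetD xor_span_base)
  qed (simp_all add: xor_span_base xor_span.empty xor_span_xor)
  then show "x \<in> xor_span (pauli_vector ` A)" by simp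
next
  fix x assume "x \<in> xor_span (pauli_vector ` A)"
  then show "x \<in> pauli_vector ` generate (pauli_group Q) A"
  proof induction
    case empty
    show ?case by (rule image_eqI[OF _ generate.one]) simp
  next
    case (step a b)
    then obtain p p' where *: "p \<in> A" "a = pauli_vector p" "p' \<in> generate (pauli_group Q) A"
      "b = pauli_vector p'" by blast
    then show ?case
      by (intro image_eqI[of _ _ "p \<otimes>\<^bsub>pauli_group Q\<^esub> p'"])
        (auto intro: generate.eng generate.incl)
  qed
qed

lemma generate_in_carrier_pauli:
  "A \<subseteq> carrier (pauli_group Q) \<Longrightarrow> generate (pauli_group Q) A \<subseteq> carrier (pauli_group Q)"
  using group.generate_incl[OF group_pauli_group] .

text \<open>Sectors and added product states are both defined by nested uses of
  \<open>generate\<close>; this flattens them.\<close>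

lemma (in group) generate_Un_generate:
  assumes "A \<subseteq> carrier G" "B \<subseteq> carrier G"
  shows "generate G (generate G A \<union> B) = generate G (A \<union> B)"
proof
  have "generate G A \<subseteq> generate G (A \<union> B)" by (rule mono_generate) auto
  then have "generate G A \<union> B \<subseteq> generate G (A \<union> B)" by (auto intro: generate.incl)
  then show "generate G (generate G A \<union> B) \<subseteq> generate G (A \<union> B)"
    using generate_subgroup_incl[OF _ generate_is_subgroup[of "A \<union> B"]] assms by auto
  show "generate G (A \<union> B) \<subseteq> generate G (generate G A \<union> B)"
    by (rule mono_generate) (auto intro: generate.incl)
qed

lemma (in group) generate_subgroup: "subgroup H G \<Longrightarrow> generate G H = H"
  using generate_subgroup_incl[of H H] by (auto intro: generate.incl)

lemma pauli_hom_generate: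
  assumes "\<phi> \<in> hom (pauli_group Q) (pauli_group Q')" "A \<subseteq> carrier (pauli_group Q)"
  shows "\<phi> ` generate (pauli_group Q) A = generate (pauli_group Q') (\<phi> ` A)"
proof -
  interpret group_hom "pauli_group Q" "pauli_group Q'" \<phi>
    using assms(1) by (simp add: group_hom_def group_hom_axioms_def group_pauli_group)
  show ?thesis by (rule generate_img[OF assms(2), symmetric])
qed

section \<open>Charges of a stabilizer space\<close>

type_synonym plane_vector = "(plane_qubit + plane_qubit) set"

abbreviation site :: "plane_qubit + plane_qubit \<Rightarrow> int \<times> int" where
  "site \<equiv> case_sum fst fst"

text \<open>Distances are measured in the maximum norm about the origin, so the disks are
  squares.\<close>

definition far :: "int \<Rightarrow> plane_vector \<Rightarrow> bool" where
  "far R a \<longleftrightarrow> (\<forall>p\<in>a. R < \<bar>fst (site p)\<bar> \<or> R < \<bar>snd (site p)\<bar>)"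

definition narrow :: "int \<Rightarrow> plane_vector \<Rightarrow> bool" where
  "narrow D a \<longleftrightarrow> (\<forall>p\<in>a. \<forall>p'\<in>a.
     \<bar>fst (site p) - fst (site p')\<bar> \<le> D \<and> \<bar>snd (site p) - snd (site p')\<bar> \<le> D)"

lemma far_mono: "far R a \<Longrightarrow> b \<subseteq> a \<Longrightarrow> R' \<le> R \<Longrightarrow> far R' b"
  by (fastforce simp: far_def)

lemma narrow_mono: "narrow D a \<Longrightarrow> b \<subseteq> a \<Longrightarrow> D \<le> D' \<Longrightarrow> narrow D' b"
  unfolding narrow_def by (meson order_trans subsetD)

lemma far_xor: "far R a \<Longrightarrow> far R b \<Longrightarrow> far R (a \<triangle> b)"
  by (auto simp: far_def)

text \<open>A stabilizer supported outside a large disk is, up to products of local stabilizers outside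
  of a smaller disk, a product of closed string operators around the disk. The vector \<open>W a\<close> records
  which of the \<open>k\<close> independent strings occur, equivalently which charges in the disk are detected.\<close>

locale charge_map =
  fixes V :: "plane_vector set" and k :: nat and d :: int and W :: "plane_vector \<Rightarrow> nat set"
  assumes charge_subset: "a \<in> V \<Longrightarrow> W a \<subseteq> {..<k}"
    and charge_xor: "a \<in> V \<Longrightarrow> b \<in> V \<Longrightarrow> W (a \<triangle> b) = W a \<triangle> W b"
    and ex_charge: "w \<subseteq> {..<k} \<Longrightarrow> \<exists>a\<in>V. far R a \<and> W a = w"
    and chargeless: "\<exists>R'. \<forall>a\<in>V. far R' a \<longrightarrow> W a = {} \<longrightarrow>
      a \<in> xor_span {b \<in> V. narrow d b \<and> far R b}"
    and narrow_chargeless: "\<exists>R. \<forall>a\<in>V. narrow D a \<longrightarrow> far R a \<longrightarrow> W a = {}"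

definition has_charges :: "plane_vector set \<Rightarrow> nat \<Rightarrow> bool" where
  "has_charges V k \<longleftrightarrow> (\<exists>d W. charge_map V k d W)"

text \<open>If \<open>k' < k\<close>, the pigeonhole principle yields two far stabilizers that agree
  in \<open>W'\<close> but not in \<open>W\<close>. Their sum has no charge for \<open>W'\<close>,
  hence is a sum of narrow far stabilizers, on each of which \<open>W\<close> vanishes, a
  contradiction.\<close>

lemma has_charges_le:
  assumes "has_charges V k" "has_charges V k'"
    and V: "{} \<in> V" "\<And>a b. a \<in> V \<Longrightarrow> b \<in> V \<Longrightarrow> a \<triangle> b \<in> V"
  shows "k \<le> k'"
proof (rule ccontr)
  assume "\<not> k \<le> k'"
  from assms(1) obtain d0 W where "charge_map V k d0 W" unfolding has_charges_def by blast
  then interpret W: charge_map V k d0 W .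
  from assms(2) obtain d W' where "charge_map V k' d W'" unfolding has_charges_def by blast
  then interpret W': charge_map V k' d W' .
  \<comment> \<open>The order of choices matters: \<open>d\<close> is the diameter belonging to
    \<open>W'\<close>; \<open>R\<close> makes \<open>W\<close> vanish on stabilizers of that
    diameter; only then is \<open>R'\<close> chosen so that \<open>W'\<close> decomposes into pieces
    beyond \<open>R\<close>.\<close>
  from W.narrow_chargeless[of d] obtain R where R: "\<And>a. a \<in> V \<Longrightarrow> narrow d a \<Longrightarrow> far R a \<Longrightarrow> W a = {}" by blast
  from W'.chargeless[of R] obtain R' where
    R': "\<And>a. a \<in> V \<Longrightarrow> far R' a \<Longrightarrow> W' a = {} \<Longrightarrow> a \<in> xor_span {b \<in> V. narrow d b \<and> far R b}"
    by blast
  from W.ex_charge[of _ R'] obtain l where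
    l: "\<And>w. w \<subseteq> {..<k} \<Longrightarrow> l w \<in> V \<and> far R' (l w) \<and> W (l w) = w"
    by metis
  have "(2 :: nat) ^ k' < 2 ^ k" using \<open>\<not> k \<le> k'\<close> by simp
  then have "card (Pow {..<k'}) < card (Pow {..<k})" by (simp add: card_Pow)
  moreover have "(\<lambda>w. W' (l w)) ` Pow {..<k} \<subseteq> Pow {..<k'}"
    using l W'.charge_subset by blast
  ultimately have "\<not> inj_on (\<lambda>w. W' (l w)) (Pow {..<k})"
    by (metis card_inj_on_le finite_Pow_iff finite_lessThan not_less)
  then obtain w w' where w: "w \<subseteq> {..<k}" "w' \<subseteq> {..<k}" "w \<noteq> w'" "W' (l w) = W' (l w')"
    by (auto simp: inj_on_def)
  let ?a = "l w \<triangle> l w'"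
  have "?a \<in> V" "far R' ?a" "W' ?a = {}"
    using l[OF w(1)] l[OF w(2)] w(4) by (auto intro: V far_xor simp: W'.charge_xor)
  then have "?a \<in> xor_span {b \<in> V. narrow d b \<and> far R b}" by (rule R')
  also have "xor_span {b \<in> V. narrow d b \<and> far R b} \<subseteq> {b \<in> V. W b = {}}"
  proof (rule xor_span_least)
    show "{} \<in> {b \<in> V. W b = {}}" using W.charge_xor[of "{}" "{}"] V by simp
  qed (use R W.charge_xor V in auto)
  finally have "W (l w) = W (l w')"
    using W.charge_xor l[OF w(1)] l[OF w(2)] by auto
  then show False using l[OF w(1)] l[OF w(2)] w(3) by simp
qed

text \<open>A relation and not a function: the pairs arise from operators whose phases are
  forgotten, so no representative has to be chosen, and the axioms are symmetric under converse. By
  additivity \<open>r_empty\<close> makes the relation one-to-one in both directions.\<close>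

locale coarse_iso =
  fixes V V' :: "plane_vector set" and r :: "(plane_vector \<times> plane_vector) set"
  assumes r_in: "(a, b) \<in> r \<Longrightarrow> a \<in> V" "(a, b) \<in> r \<Longrightarrow> b \<in> V'"
    and r_total: "a \<in> V \<Longrightarrow> \<exists>b. (a, b) \<in> r" "b \<in> V' \<Longrightarrow> \<exists>a. (a, b) \<in> r"
    and r_xor: "(a, b) \<in> r \<Longrightarrow> (a', b') \<in> r \<Longrightarrow> (a \<triangle> a', b \<triangle> b') \<in> r"
    and r_empty: "(a, b) \<in> r \<Longrightarrow> a = {} \<longleftrightarrow> b = {}"
    and r_far: "\<exists>R'. \<forall>a b. (a, b) \<in> r \<longrightarrow> far R' a \<longrightarrow> far R b"
      "\<exists>R'. \<forall>a b. (a, b) \<in> r \<longrightarrow> far R' b \<longrightarrow> far R a"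
    and r_narrow: "\<exists>D'. \<forall>a b. (a, b) \<in> r \<longrightarrow> narrow D a \<longrightarrow> narrow D' b"
      "\<exists>D'. \<forall>a b. (a, b) \<in> r \<longrightarrow> narrow D b \<longrightarrow> narrow D' a"

lemma coarse_iso_converse: "coarse_iso V V' r \<Longrightarrow> coarse_iso V' V (r\<inverse>)"
proof -
  assume "coarse_iso V V' r"
  then interpret coarse_iso V V' r .
  show ?thesis
  proof
    show "\<exists>R'. \<forall>a b. (a, b) \<in> r\<inverse> \<longrightarrow> far R' a \<longrightarrow> far R b" for R
      using r_far(2)[of R] by auto
    show "\<exists>R'. \<forall>a b. (a, b) \<in> r\<inverse> \<longrightarrow> far R' b \<longrightarrow> far R a" for R
      using r_far(1)[of R] by auto
    show "\<exists>D'. \<forall>a b. (a, b) \<in> r\<inverse> \<longrightarrow> narrow D a \<longrightarrow> narrow D' b" for D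
      using r_narrow(2)[of D] by auto
    show "\<exists>D'. \<forall>a b. (a, b) \<in> r\<inverse> \<longrightarrow> narrow D b \<longrightarrow> narrow D' a" for D
      using r_narrow(1)[of D] by auto
  qed (simp_all add: r_in r_total r_xor r_empty)
qed

text \<open>The charges are pulled back along the inverse \<open>\<psi>\<close>, and each radius or
  diameter is replaced by the one that \<open>r_far\<close> or \<open>r_narrow\<close>
  supplies.\<close>

lemma has_charges_coarse_iso:
  assumes "has_charges V k" "coarse_iso V V' r"
  shows "has_charges V' k"
proof -
  from assms(1) obtain d W where "charge_map V k d W" unfolding has_charges_def by blast
  then interpret charge_map V k d W .
  interpret coarse_iso V V' r by fact
  have inj: "a = a'" if "(a, b) \<in> r" "(a', b) \<in> r" for a a' b
    using r_empty[OF r_xor[OF that]] by simp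
  have inj': "b = b'" if "(a, b) \<in> r" "(a, b') \<in> r" for a b b'
    using r_empty[OF r_xor[OF that]] by simp
  from r_total(2) obtain \<psi> where \<psi>: "\<And>b. b \<in> V' \<Longrightarrow> (\<psi> b, b) \<in> r" by metis
  have \<psi>V: "\<psi> b \<in> V" if "b \<in> V'" for b using r_in(1)[OF \<psi>[OF that]] .
  have \<psi>r: "\<psi> b = a" "b \<in> V'" "a \<in> V" if "(a, b) \<in> r" for a b
    using inj[OF \<psi> that] r_in that by auto
  have \<psi>_xor: "\<psi> (a \<triangle> b) = \<psi> a \<triangle> \<psi> b" if "a \<in> V'" "b \<in> V'" for a b
    using r_xor[OF \<psi>[OF that(1)] \<psi>[OF that(2)]] by (rule \<psi>r)
  obtain D' where D': "\<And>a b. (a, b) \<in> r \<Longrightarrow> narrow d a \<Longrightarrow> narrow D' b"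
    using r_narrow(1)[of d] by blast
  have surj: "\<exists>b\<in>V'. far R b \<and> W (\<psi> b) = w" if w: "w \<subseteq> {..<k}" for R w
  proof -
    obtain R' where R': "\<And>a b. (a, b) \<in> r \<Longrightarrow> far R' a \<Longrightarrow> far R b" using r_far(1)[of R] by blast
    obtain a where "a \<in> V" "far R' a" "W a = w" using ex_charge[OF w] by blast
    moreover obtain b where "(a, b) \<in> r" using r_total(1) \<open>a \<in> V\<close> by blast
    ultimately show ?thesis using R' \<psi>r by blast
  qed
  have ker: "\<exists>R'. \<forall>b\<in>V'. far R' b \<longrightarrow> W (\<psi> b) = {} \<longrightarrow>
      b \<in> xor_span {b \<in> V'. narrow D' b \<and> far R b}" for R
  proof -
    obtain R1 where R1: "\<And>a b. (a, b) \<in> r \<Longrightarrow> far R1 a \<Longrightarrow> far R b" using r_far(1)[of R] by blast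
    obtain R2 where R2: "\<And>a. a \<in> V \<Longrightarrow> far R2 a \<Longrightarrow> W a = {} \<Longrightarrow>
        a \<in> xor_span {b \<in> V. narrow d b \<and> far R1 b}"
      using chargeless[of R1] by blast
    obtain R3 where R3: "\<And>a b. (a, b) \<in> r \<Longrightarrow> far R3 b \<Longrightarrow> far R2 a" using r_far(2)[of R2] by blast
    \<comment> \<open>A decomposition of \<open>a\<close> is carried over one summand at a time: the
      partner \<open>c'\<close> of the summand \<open>c\<close> is split off from
      \<open>b\<close>.\<close>
    have *: "b \<in> xor_span {b \<in> V'. narrow D' b \<and> far R b}"
      if "a \<in> xor_span {b \<in> V. narrow d b \<and> far R1 b}" "(a, b) \<in> r" for a b
      using that
    proof (induction arbitrary: b)
      case empty
      then show ?case using r_empty[of "{}" b] by (auto intro: xor_span.empty)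
    next
      case (step c a)
      from step(1) obtain c' where c': "(c, c') \<in> r" using r_total(1) by blast
      then have "c' \<in> {b \<in> V'. narrow D' b \<and> far R b}"
        using step(1) D' R1 \<psi>r(2) by blast
      moreover have "(a, c' \<triangle> b) \<in> r" using r_xor[OF c' step(4)] by simp
      then have "c' \<triangle> b \<in> xor_span {b \<in> V'. narrow D' b \<and> far R b}" by (rule step(3))
      ultimately have "c' \<triangle> (c' \<triangle> b) \<in> xor_span {b \<in> V'. narrow D' b \<and> far R b}"
        by (rule xor_span.step)
      then show ?case by simp
    qed
    show ?thesis
      by (intro exI[of _ R3] ballI impI, rule *) (use R2 R3 \<psi> \<psi>V in blast)+
  qed
  have small: "\<exists>R. \<forall>b\<in>V'. narrow D b \<longrightarrow> far R b \<longrightarrow> W (\<psi> b) = {}" for D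
  proof -
    obtain D1 where D1: "\<And>a b. (a, b) \<in> r \<Longrightarrow> narrow D b \<Longrightarrow> narrow D1 a"
      using r_narrow(2)[of D] by blast
    obtain R1 where R1: "\<And>a. a \<in> V \<Longrightarrow> narrow D1 a \<Longrightarrow> far R1 a \<Longrightarrow> W a = {}"
      using narrow_chargeless[of D1] by blast
    obtain R2 where R2: "\<And>a b. (a, b) \<in> r \<Longrightarrow> far R2 b \<Longrightarrow> far R1 a" using r_far(2)[of R1] by blast
    show ?thesis using D1 R1 R2 \<psi> \<psi>V by blast
  qed
  have "charge_map V' k D' (\<lambda>b. W (\<psi> b))"
    by unfold_locales (use charge_subset charge_xor \<psi>V \<psi>_xor surj ker small in simp_all)
  then show ?thesis unfolding has_charges_def by blast
qed

text \<open>The set \<open>C\<close> stands for the Z factors of added product qubits. A stabilizer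
  splits into its part off \<open>C\<close>, which keeps the charge, and finitely many singletons,
  which are as local as possible.\<close>

lemma has_charges_add_singletons:
  assumes "has_charges V k" and V: "{} \<in> V" "\<And>a b. a \<in> V \<Longrightarrow> b \<in> V \<Longrightarrow> a \<triangle> b \<in> V"
    and disjoint: "\<And>a. a \<in> V \<Longrightarrow> a \<inter> C = {}"
  shows "has_charges (xor_span (V \<union> (\<lambda>p. {p}) ` C)) k"
proof -
  let ?V' = "xor_span (V \<union> (\<lambda>p. {p}) ` C)"
  from assms(1) obtain d W where "charge_map V k d W" unfolding has_charges_def by blast
  then interpret charge_map V k d W .
  have sub: "?V' \<subseteq> {a. a - C \<in> V \<and> finite (a \<inter> C)}"
  proof (rule xor_span_least)
    show "V \<union> (\<lambda>p. {p}) ` C \<subseteq> {a. a - C \<in> V \<and> finite (a \<inter> C)}"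
    proof
      fix a assume "a \<in> V \<union> (\<lambda>p. {p}) ` C"
      then show "a \<in> {a. a - C \<in> V \<and> finite (a \<inter> C)}"
        using disjoint[of a] V by (auto simp: Diff_triv)
    qed
    fix a b assume *: "a \<in> {a. a - C \<in> V \<and> finite (a \<inter> C)}" "b \<in> {a. a - C \<in> V \<and> finite (a \<inter> C)}"
    moreover have "(a \<triangle> b) - C = (a - C) \<triangle> (b - C)" "(a \<triangle> b) \<inter> C = (a \<inter> C) \<triangle> (b \<inter> C)" by auto
    ultimately show "a \<triangle> b \<in> {a. a - C \<in> V \<and> finite (a \<inter> C)}" by (simp add: V)
  qed (use V in auto)
  have V': "a \<in> ?V'" if "a \<in> V" for a using that by (auto intro: xor_span_base)
  \<comment> \<open>Singletons have diameter 0, and nothing is known about the sign of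
    \<open>d\<close>; hence \<open>max 0 d\<close>.\<close>
  have ker: "\<exists>R'. \<forall>b\<in>?V'. far R' b \<longrightarrow> W (b - C) = {} \<longrightarrow>
      b \<in> xor_span {b \<in> ?V'. narrow (max 0 d) b \<and> far R b}" for R
  proof -
    obtain R2 where R2: "\<And>a. a \<in> V \<Longrightarrow> far R2 a \<Longrightarrow> W a = {} \<Longrightarrow>
        a \<in> xor_span {b \<in> V. narrow d b \<and> far R b}"
      using chargeless[of R] by blast
    show ?thesis
    \<comment> \<open>The bound \<open>R2\<close> serves the part off \<open>C\<close>, and
      \<open>R\<close> keeps the singletons far.\<close>
    proof (intro exI[of _ "max R R2"] ballI impI)
      fix b assume b: "b \<in> ?V'" "far (max R R2) b" "W (b - C) = {}"
      have "b - C \<in> xor_span {b \<in> V. narrow d b \<and> far R b}"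
        using b sub by (intro R2) (auto elim: far_mono)
      moreover have "xor_span {b \<in> V. narrow d b \<and> far R b} \<subseteq>
          xor_span {b \<in> ?V'. narrow (max 0 d) b \<and> far R b}"
        by (rule xor_span_mono) (auto intro: V' elim: narrow_mono)
      moreover have "xor_sum (\<lambda>p. {p}) (b \<inter> C) \<in>
          xor_span {b \<in> ?V'. narrow (max 0 d) b \<and> far R b}"
      proof (rule xor_sum_in_span, rule xor_span_base, intro CollectI conjI)
        fix p assume p: "p \<in> b \<inter> C"
        have "{p} \<in> V \<union> (\<lambda>p. {p}) ` C" using p by blast
        then show "{p} \<in> ?V'" by (rule xor_span_base)
        show "narrow (max 0 d) {p}" by (simp add: narrow_def)
        show "far R {p}" using b p far_mono[of "max R R2" b "{p}" R] by auto
      qed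
      moreover have "b = (b - C) \<triangle> xor_sum (\<lambda>p. {p}) (b \<inter> C)"
        using b sub by (subst xor_sum_singletons) auto
      ultimately show "b \<in> xor_span {b \<in> ?V'. narrow (max 0 d) b \<and> far R b}"
        using xor_span_xor by (metis (no_types, lifting) subsetD)
    qed
  qed
  have "charge_map ?V' k (max 0 d) (\<lambda>b. W (b - C))"
  proof
    show "W (a - C) \<subseteq> {..<k}" if "a \<in> ?V'" for a
      using sub that charge_subset by blast
    show "W (a \<triangle> b - C) = W (a - C) \<triangle> W (b - C)" if "a \<in> ?V'" "b \<in> ?V'" for a b
    proof -
      have "(a \<triangle> b) - C = (a - C) \<triangle> (b - C)" by auto
      then show ?thesis using charge_xor[of "a - C" "b - C"] that sub by auto
    qed
    show "\<exists>a\<in>?V'. far R a \<and> W (a - C) = w" if "w \<subseteq> {..<k}" for R w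
      using ex_charge[OF that, of R] V' disjoint by (metis Diff_triv)
    show "\<exists>R. \<forall>a\<in>?V'. narrow D a \<longrightarrow> far R a \<longrightarrow> W (a - C) = {}" for D
    proof -
      obtain R1 where R1: "\<And>a. a \<in> V \<Longrightarrow> narrow D a \<Longrightarrow> far R1 a \<Longrightarrow> W a = {}"
        using narrow_chargeless[of D] by blast
      have "W (a - C) = {}" if "a \<in> ?V'" "narrow D a" "far R1 a" for a
        using that sub by (intro R1) (auto elim: far_mono narrow_mono)
      then show ?thesis by blast
    qed
  qed (rule ker)
  then show ?thesis unfolding has_charges_def by blast
qed

section \<open>The charges of the toric code\<close>

text \<open>Both kinds of generators of the toric codes are treated simultaneously: the generator \<open>(j, v)\<close>
  is a star of the copy \<open>j div 2\<close> if \<open>j\<close> is even, otherwise a plaquette. The generators in the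
  directions \<open>toric_dir\<close> and \<open>toric_dir'\<close> from \<open>v\<close> share the qubits \<open>toric_edge j v\<close> and
  \<open>toric_edge' j v\<close> with it.\<close>

definition toric_edge :: "nat \<Rightarrow> int \<times> int \<Rightarrow> plane_qubit + plane_qubit" where
  "toric_edge j v = (if even j then Inl else Inr) (v, 2 * (j div 2))"

definition toric_edge' :: "nat \<Rightarrow> int \<times> int \<Rightarrow> plane_qubit + plane_qubit" where
  "toric_edge' j v = (if even j then Inl else Inr) (v, 2 * (j div 2) + 1)"

text \<open>The minus signs for odd \<open>j\<close> come from duality: the edges based at the site
  of a plaquette are its lower and left sides, shared with the plaquettes below and to the
  left.\<close>

definition toric_dir :: "nat \<Rightarrow> int \<times> int" where
  "toric_dir j = (if even j then (1, 0) else (0, -1))"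

definition toric_dir' :: "nat \<Rightarrow> int \<times> int" where
  "toric_dir' j = (if even j then (0, 1) else (-1, 0))"

definition toric_generator :: "nat \<times> int \<times> int \<Rightarrow> plane_vector" where
  "toric_generator = (\<lambda>(j, v). {toric_edge j v, toric_edge j (v - toric_dir j),
     toric_edge' j v, toric_edge' j (v - toric_dir' j)})"

lemma toric_edge_inj [simp]:
  "toric_edge j v = toric_edge j' v' \<longleftrightarrow> j = j' \<and> v = v'"
  "toric_edge' j v = toric_edge' j' v' \<longleftrightarrow> j = j' \<and> v = v'"
  "toric_edge j v \<noteq> toric_edge' j' v'" "toric_edge' j v \<noteq> toric_edge j' v'"
  by (auto simp: toric_edge_def toric_edge'_def split: if_splits) presburger+

lemma site_toric_edge [simp]: "site (toric_edge j v) = v" "site (toric_edge' j v) = v"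
  by (auto simp: toric_edge_def toric_edge'_def)

lemma toric_dir_nonzero: "toric_dir j \<noteq> 0" "toric_dir' j \<noteq> 0"
  by (auto simp: toric_dir_def toric_dir'_def zero_prod_def)

text \<open>An edge belongs to exactly two generators of its kind and survives in the sum iff
  exactly one of them is in \<open>T\<close>. Thus the sum is the boundary of the region
  \<open>T\<close>.\<close>

lemma toric_edge_in_boundary:
  assumes "finite T"
  shows "toric_edge j v \<in> xor_sum toric_generator T \<longleftrightarrow>
    ((j, v) \<in> T) \<noteq> ((j, v + toric_dir j) \<in> T)"
  using assms
proof (induction T rule: finite_induct)
  case (insert x T)
  obtain j' v' where x: "x = (j', v')" by (cases x) auto
  have "toric_edge j v \<in> toric_generator x \<longleftrightarrow> (x = (j, v)) \<noteq> (x = (j, v + toric_dir j))"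
    using toric_dir_nonzero[of j] by (auto simp: toric_generator_def x)
  then show ?case using insert by auto
qed simp

lemma toric_edge'_in_boundary:
  assumes "finite T"
  shows "toric_edge' j v \<in> xor_sum toric_generator T \<longleftrightarrow>
    ((j, v) \<in> T) \<noteq> ((j, v + toric_dir' j) \<in> T)"
  using assms
proof (induction T rule: finite_induct)
  case (insert x T)
  obtain j' v' where x: "x = (j', v')" by (cases x) auto
  have "toric_edge' j v \<in> toric_generator x \<longleftrightarrow> (x = (j, v)) \<noteq> (x = (j, v + toric_dir' j))"
    using toric_dir_nonzero[of j] by (auto simp: toric_generator_def x)
  then show ?case using insert by auto
qed simp

lemma boundary_edgeE:
  assumes "p \<in> xor_sum toric_generator T"
  obtains j v where "p = toric_edge j v" | j v where "p = toric_edge' j v"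
proof -
  have "xor_sum toric_generator T \<subseteq> {toric_edge j v |j v. True} \<union> {toric_edge' j v |j v. True}"
    by (rule xor_sum_subset) (auto simp: toric_generator_def)
  then show ?thesis using assms that by blast
qed

text \<open>The multiples of \<open>toric_dir j\<close>, a straight line through the origin.\<close>

definition line :: "nat \<Rightarrow> int \<Rightarrow> int \<times> int" where
  "line j t = (if even j then (t, 0) else (0, -t))"

lemma line_add: "line j t + toric_dir j = line j (t + 1)"
  by (simp add: line_def toric_dir_def)

lemma crossing_right:
  assumes "P (0 :: nat)" "finite {m. P m}"
  shows "\<exists>m. P m \<and> \<not> P (Suc m)"
proof (rule ccontr)
  assume "\<not> ?thesis"
  then have "P m" for m by (induction m) (use assms(1) in auto)
  then show False using assms(2) by simp
qed

text \<open>A line through a generator in the finite set \<open>T\<close> leaves \<open>T\<close> in both directions.\<close>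

lemma boundary_both_sides:
  assumes "finite T" "(j, 0) \<in> T"
  shows "\<exists>t\<ge>0. toric_edge j (line j t) \<in> xor_sum toric_generator T"
    and "\<exists>t<0. toric_edge j (line j t) \<in> xor_sum toric_generator T"
proof -
  have inj: "inj (\<lambda>m. (j, line j (int m)))" "inj (\<lambda>m. (j, line j (- int m)))"
    by (auto simp: inj_def line_def split: if_splits)
  have zero: "line j 0 = 0" by (simp add: line_def zero_prod_def)
  have fin: "finite {m. (j, line j (int m)) \<in> T}" "finite {m. (j, line j (- int m)) \<in> T}"
    using finite_vimageI[OF assms(1) inj(1)] finite_vimageI[OF assms(1) inj(2)]
    by (simp_all add: vimage_def)
  from crossing_right[OF _ fin(1)] obtain m where
    "(j, line j (int m)) \<in> T" "(j, line j (int (Suc m))) \<notin> T"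
    using assms(2) by (auto simp: zero)
  then show "\<exists>t\<ge>0. toric_edge j (line j t) \<in> xor_sum toric_generator T"
    by (intro exI[of _ "int m"])
      (simp add: toric_edge_in_boundary[OF assms(1)] line_add add.commute[of 1])
  from crossing_right[OF _ fin(2)] obtain m where
    "(j, line j (- int m)) \<in> T" "(j, line j (- int (Suc m))) \<notin> T"
    using assms(2) by (auto simp: zero)
  then show "\<exists>t<0. toric_edge j (line j t) \<in> xor_sum toric_generator T"
    by (intro exI[of _ "- int (Suc m)"])
      (auto simp: toric_edge_in_boundary[OF assms(1)] line_add)
qed

text \<open>A finite region without boundary is closed under translation by
  \<open>toric_dir j\<close>, hence empty. So the generators on the infinite plane satisfy no
  relation, and a stabilizer determines its region.\<close>

lemma inj_boundary:
  assumes "finite T" "finite T'" "xor_sum toric_generator T = xor_sum toric_generator T'"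
  shows "T = T'"
proof (rule ccontr)
  let ?U = "T \<triangle> T'"
  assume "T \<noteq> T'"
  then obtain j v where "(j, v) \<in> ?U" by (metis ex_in_conv old.prod.exhaust xor_eq_empty_iff)
  have "finite ?U" using assms by simp
  have "xor_sum toric_generator ?U = {}" using assms by (simp add: xor_sum_xor)
  then have step: "(j, w) \<in> ?U \<Longrightarrow> (j, w + toric_dir j) \<in> ?U" for w
    using toric_edge_in_boundary[OF \<open>finite ?U\<close>, of j w] by simp
  have "(j, v + line j (int m)) \<in> ?U" for m
  proof (induction m)
    case 0
    then show ?case using \<open>(j, v) \<in> ?U\<close> by (simp add: line_def flip: zero_prod_def)
  next
    case (Suc m)
    from step[OF this] show ?case by (simp only: add.assoc line_add) (simp add: add.commute)
  qed
  then have "range (\<lambda>m. (j, v + line j (int m))) \<subseteq> ?U" by blast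
  moreover have "inj (\<lambda>m. (j, v + line j (int m)))"
    by (auto simp: inj_def line_def split: if_splits)
  ultimately show False
    using \<open>finite ?U\<close> by (meson finite_subset infinite_UNIV_nat finite_image_iff)
qed

text \<open>Neighbouring cells in the box share an edge that is not in the boundary, so membership
  spreads from the origin along a row and then along a column.\<close>

lemma box_constant:
  assumes "finite T" "far R (xor_sum toric_generator T)" "\<bar>x\<bar> \<le> R" "\<bar>y\<bar> \<le> R"
  shows "(j, (x, y)) \<in> T \<longleftrightarrow> (j, 0) \<in> T"
proof -
  have *: "((j, v) \<in> T) = ((j, v + toric_dir j) \<in> T)" "((j, v) \<in> T) = ((j, v + toric_dir' j) \<in> T)"
    if "\<bar>fst v\<bar> \<le> R" "\<bar>snd v\<bar> \<le> R" for v
    using assms(2) that toric_edge_in_boundary[OF assms(1), of j v]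
      toric_edge'_in_boundary[OF assms(1), of j v]
    by (fastforce simp: far_def)+
  \<comment> \<open>For odd \<open>j\<close> the directions point to the left and downwards, so the
    step is read off at the other endpoint.\<close>
  have hor: "((j, (x, y)) \<in> T) = ((j, (x + 1, y)) \<in> T)"
    if "\<bar>x\<bar> \<le> R" "\<bar>x + 1\<bar> \<le> R" "\<bar>y\<bar> \<le> R" for x y
    using that *[of "(x, y)"] *[of "(x + 1, y)"]
    by (cases "even j") (auto simp: toric_dir_def toric_dir'_def)
  have ver: "((j, (x, y)) \<in> T) = ((j, (x, y + 1)) \<in> T)"
    if "\<bar>x\<bar> \<le> R" "\<bar>y + 1\<bar> \<le> R" "\<bar>y\<bar> \<le> R" for x y
    using that *[of "(x, y)"] *[of "(x, y + 1)"]
    by (cases "even j") (auto simp: toric_dir_def toric_dir'_def)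
  have row: "((j, (x, 0)) \<in> T) = ((j, 0) \<in> T)" if "\<bar>x\<bar> \<le> R" for x
    using that
  proof (induction x rule: int_induct[where k = 0])
    case (step1 i) then show ?case using hor[of i 0] by auto
  next
    case (step2 i) then show ?case using hor[of "i - 1" 0] by auto
  qed (simp add: zero_prod_def)
  show ?thesis
    using assms(4)
  proof (induction y rule: int_induct[where k = 0])
    case (step1 i) then show ?case using ver[of x i] assms(3) by auto
  next
    case (step2 i) then show ?case using ver[of x "i - 1"] assms(3) by auto
  qed (use row assms(3) in simp)
qed

text \<open>\<open>W\<close> records the kinds \<open>j\<close> for which the region contains the
  origin. Large boxes realise all values. If the boundary is far and the origin is outside, the
  region avoids a whole box, so its own generators are the local pieces. A narrow far boundary
  cannot enclose the origin.\<close>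

lemma has_charges_toric:
  "has_charges (xor_span (toric_generator ` ({..<k} \<times> UNIV))) k"
proof -
  let ?V = "xor_span (toric_generator ` ({..<k} \<times> UNIV))"
  let ?D = "xor_sum toric_generator"
  have V: "?V = {?D T |T. finite T \<and> T \<subseteq> {..<k} \<times> UNIV}" by (rule xor_span_image)
  define S where "S a = (THE T. finite T \<and> ?D T = a)" for a
  have S: "S (?D T) = T" if "finite T" for T
    unfolding S_def by (rule the_equality) (use that inj_boundary in auto)
  define W where "W a = {j. (j, 0) \<in> S a}" for a
  have W: "W (?D T) = {j. (j, 0) \<in> T}" if "finite T" for T
    using S[OF that] by (simp add: W_def)
  have "charge_map ?V k 1 W"
  proof
    show "W a \<subseteq> {..<k}" if "a \<in> ?V" for a
      using that unfolding V by (auto simp: W)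
    show "W (a \<triangle> b) = W a \<triangle> W b" if ab: "a \<in> ?V" "b \<in> ?V" for a b
    proof -
      obtain T T' where *: "a = ?D T" "b = ?D T'" "finite T" "finite T'"
        using ab unfolding V by blast
      then have "a \<triangle> b = ?D (T \<triangle> T')" by (simp add: xor_sum_xor)
      then show ?thesis using * by (auto simp: W)
    qed
    show "\<exists>a\<in>?V. far R a \<and> W a = w" if w: "w \<subseteq> {..<k}" for R w
    proof -
      \<comment> \<open>The margin 1 puts both generators at an edge within distance
        \<open>R\<close> into the box, so that edge is not in the boundary; the absolute value keeps
        the origin in the box for negative \<open>R\<close>.\<close>
      define B where "B = {- \<bar>R\<bar> - 1..\<bar>R\<bar> + 1} \<times> {- \<bar>R\<bar> - 1..\<bar>R\<bar> + 1}"
      have fin: "finite (w \<times> B)" using w by (auto simp: B_def intro: finite_subset)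
      have B: "v \<in> B \<and> v + toric_dir j \<in> B \<and> v + toric_dir' j \<in> B"
        if "\<not> R < \<bar>fst v\<bar>" "\<not> R < \<bar>snd v\<bar>" for v j
        using that by (cases v) (auto simp: B_def toric_dir_def toric_dir'_def)
      have "far R (?D (w \<times> B))"
        unfolding far_def
      proof
        fix p assume p: "p \<in> ?D (w \<times> B)"
        then show "R < \<bar>fst (site p)\<bar> \<or> R < \<bar>snd (site p)\<bar>"
        proof (cases rule: boundary_edgeE)
          case (1 j v)
          then show ?thesis
            using p B[of v j] by (auto simp: toric_edge_in_boundary[OF fin])
        next
          case (2 j v)
          then show ?thesis
            using p B[of v j] by (auto simp: toric_edge'_in_boundary[OF fin])
        qed
      qed
      moreover have "W (?D (w \<times> B)) = w"
        using W[OF fin] by (auto simp: B_def zero_prod_def)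
      ultimately show ?thesis
        using fin w unfolding V by (intro bexI[of _ "?D (w \<times> B)"] CollectI exI[of _ "w \<times> B"]) auto
    qed
    show "\<exists>R'. \<forall>a\<in>?V. far R' a \<longrightarrow> W a = {} \<longrightarrow> a \<in> xor_span {b \<in> ?V. narrow 1 b \<and> far R b}" for R
    \<comment> \<open>A generator reaches one site beyond its base point.\<close>
    proof (intro exI[of _ "R + 1"] ballI impI)
      fix a assume a: "a \<in> ?V" "far (R + 1) a" "W a = {}"
      from a(1) obtain T where T: "a = ?D T" "finite T" "T \<subseteq> {..<k} \<times> UNIV" unfolding V by blast
      have out: "R + 1 < \<bar>x\<bar> \<or> R + 1 < \<bar>y\<bar>" if "(j, (x, y)) \<in> T" for j x y
        using box_constant[OF T(2), of "R + 1" x y j] that a(2,3) W[OF T(2)] T(1) by force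
      show "a \<in> xor_span {b \<in> ?V. narrow 1 b \<and> far R b}"
        unfolding T(1)
      proof (rule xor_sum_in_span, rule xor_span_base, intro CollectI conjI)
        fix q assume "q \<in> T"
        obtain j x y where q: "q = (j, (x, y))" by (cases q) auto
        show "toric_generator q \<in> ?V" using \<open>q \<in> T\<close> T(3) by (intro xor_span_base) blast
        show "narrow 1 (toric_generator q)"
          by (auto simp: q narrow_def toric_generator_def toric_dir_def toric_dir'_def)
        show "far R (toric_generator q)"
          using out[of j x y] \<open>q \<in> T\<close>
          by (auto simp: q far_def toric_generator_def toric_dir_def toric_dir'_def)
      qed
    qed
    show "\<exists>R. \<forall>a\<in>?V. narrow D a \<longrightarrow> far R a \<longrightarrow> W a = {}" for D
    \<comment> \<open>A region around the origin has boundary edges on both sides of it. Both being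
      farther than \<open>max 0 D\<close> from the origin, they are more than \<open>D\<close>
      apart.\<close>
    proof (intro exI[of _ "max 0 D"] ballI impI)
      fix a assume a: "a \<in> ?V" "narrow D a" "far (max 0 D) a"
      from a(1) obtain T where T: "a = ?D T" "finite T" unfolding V by blast
      have False if "j \<in> W a" for j
      proof -
        have j: "(j, 0) \<in> T" using that T W by simp
        obtain t where t: "t \<ge> 0" "toric_edge j (line j t) \<in> a"
          using boundary_both_sides(1)[OF T(2) j] T(1) by blast
        obtain t' where t': "t' < 0" "toric_edge j (line j t') \<in> a"
          using boundary_both_sides(2)[OF T(2) j] T(1) by blast
        have "max 0 D < \<bar>t\<bar>" "max 0 D < \<bar>t'\<bar>" "\<bar>t - t'\<bar> \<le> D"
          using a(2,3) t(2) t'(2) unfolding far_def narrow_def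
          by (fastforce simp: line_def split: if_splits)+
        then show False using t(1) t'(1) by linarith
      qed
      then show "W a = {}" by blast
    qed
  qed
  then show ?thesis unfolding has_charges_def by blast
qed

section \<open>Locality of circuits\<close>

definition near :: "int \<Rightarrow> plane_qubit set \<Rightarrow> plane_qubit set \<Rightarrow> bool" where
  "near r A B \<longleftrightarrow> (\<forall>q\<in>A. \<exists>q'\<in>B.
     \<bar>fst (fst q) - fst (fst q')\<bar> \<le> r \<and> \<bar>snd (fst q) - snd (fst q')\<bar> \<le> r)"

lemma near_trans: "near r A B \<Longrightarrow> near r' B C \<Longrightarrow> near (r + r') A C"
  unfolding near_def
proof
  fix q assume *: "q \<in> A" "\<forall>q\<in>A. \<exists>q'\<in>B. \<bar>fst (fst q) - fst (fst q')\<bar> \<le> r \<and> \<bar>snd (fst q) - snd (fst q')\<bar> \<le> r"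
    "\<forall>q\<in>B. \<exists>q'\<in>C. \<bar>fst (fst q) - fst (fst q')\<bar> \<le> r' \<and> \<bar>snd (fst q) - snd (fst q')\<bar> \<le> r'"
  then obtain q' where q': "q' \<in> B" "\<bar>fst (fst q) - fst (fst q')\<bar> \<le> r" "\<bar>snd (fst q) - snd (fst q')\<bar> \<le> r"
    by blast
  then obtain q'' where "q'' \<in> C" "\<bar>fst (fst q') - fst (fst q'')\<bar> \<le> r'" "\<bar>snd (fst q') - snd (fst q'')\<bar> \<le> r'"
    using * by blast
  with q' show "\<exists>q'\<in>C. \<bar>fst (fst q) - fst (fst q')\<bar> \<le> r + r' \<and> \<bar>snd (fst q) - snd (fst q')\<bar> \<le> r + r'"
    by (intro bexI[of _ q'']) linarith+
qed

lemma near_Un: "near r A B \<Longrightarrow> near r A' B' \<Longrightarrow> near r (A \<union> A') (B \<union> B')"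
  unfolding near_def by blast

lemma near_subset: "near r A B \<Longrightarrow> A' \<subseteq> A \<Longrightarrow> near r A' B"
  unfolding near_def by blast

lemma near_empty [simp]: "near r {} B"
  by (simp add: near_def)

lemma support_mult:
  "pauli_support (p \<otimes>\<^bsub>pauli_group Q\<^esub> p') \<subseteq> pauli_support p \<union> pauli_support p'"
  by (cases p; cases p') (auto simp: mult_pauli_group)

lemma support_subset: "p \<in> carrier (pauli_group A) \<Longrightarrow> pauli_support p \<subseteq> A"
  by (cases p) (auto simp: carrier_pauli_group)

text \<open>What the uniqueness argument retains of a circuit. That phases, in particular -1, are
  fixed is what makes commutation signs survive.\<close>

locale local_hom =
  fixes N :: nat and r :: int and \<phi> :: "plane_qubit pauli \<Rightarrow> plane_qubit pauli"
  assumes hom: "\<phi> \<in> hom (plane_paulis N) (plane_paulis N)"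
    and phase: "k \<in> phases \<Longrightarrow> \<phi> (k, {}, {}) = (k, {}, {})"
    and near: "p \<in> carrier (plane_paulis N) \<Longrightarrow> near r (pauli_support (\<phi> p)) (pauli_support p)"

lemma layer_hom: "clifford_layer N \<phi> \<Longrightarrow> \<phi> \<in> hom (plane_paulis N) (plane_paulis N)"
  unfolding clifford_layer_def by blast

text \<open>X or Z on one qubit either stays within the gate acting there or is fixed; every
  operator is a phase times a product of such factors.\<close>

lemma clifford_layer_local:
  assumes "clifford_layer N \<phi>"
  shows "\<exists>r. local_hom N r \<phi>"
proof -
  from assms obtain G r where
    G: "\<forall>(A, U)\<in>G. A \<subseteq> plane_qubits N \<and> within_range r A \<and> clifford_gate A U"
    and hom: "\<phi> \<in> hom (plane_paulis N) (plane_paulis N)"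
    and on_G: "\<forall>(A, U)\<in>G. \<forall>p\<in>carrier (pauli_group A).
      \<phi> p \<in> carrier (pauli_group A) \<and> conjugates_to A U p (\<phi> p)"
    and off_G: "\<forall>p\<in>carrier (plane_paulis N). disjnt (pauli_support p) (\<Union>(fst ` G)) \<longrightarrow> \<phi> p = p"
    unfolding clifford_layer_def by (elim exE conjE) (rule that)
  have gates: "within_range r A" if "(A, U) \<in> G" for A U using G that by blast
  have on_gate: "\<phi> p \<in> carrier (pauli_group A)"
    if "(A, U) \<in> G" "p \<in> carrier (pauli_group A)" for A U p using on_G that by blast
  have off_gates: "\<phi> p = p"
    if "p \<in> carrier (plane_paulis N)" "disjnt (pauli_support p) (\<Union>(fst ` G))" for p
    using off_G that by blast
  \<comment> \<open>The radius must also be valid for qubits outside all gates, while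
    \<open>r\<close> itself could be negative.\<close>
  define R where "R = max r 0"
  have phase: "\<phi> (k, {}, {}) = (k, {}, {})" if "k \<in> phases" for k
    using that by (intro off_gates) (auto simp: carrier_pauli_group)
  have mult: "\<phi> (p \<otimes>\<^bsub>plane_paulis N\<^esub> p') = \<phi> p \<otimes>\<^bsub>plane_paulis N\<^esub> \<phi> p'"
    if "p \<in> carrier (plane_paulis N)" "p' \<in> carrier (plane_paulis N)" for p p'
    using hom_mult[OF hom that] .
  have near_mult: "near R (pauli_support (\<phi> (p \<otimes>\<^bsub>plane_paulis N\<^esub> p'))) (A \<union> A')"
    if "p \<in> carrier (plane_paulis N)" "p' \<in> carrier (plane_paulis N)"
      "near R (pauli_support (\<phi> p)) A" "near R (pauli_support (\<phi> p')) A'" for p p' A A'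
    using near_subset[OF near_Un[OF that(3,4)] support_mult] mult[OF that(1,2)] by metis
  have single: "near R (pauli_support (\<phi> p)) {q}"
    if "p \<in> carrier (plane_paulis N)" "pauli_support p = {q}" for p q
  proof (cases "q \<in> \<Union>(fst ` G)")
    case True
    then obtain A U where A: "(A, U) \<in> G" "q \<in> A" by auto
    then have "p \<in> carrier (pauli_group A)"
      using that by (cases p) (auto simp: carrier_pauli_group)
    from support_subset[OF on_gate[OF A(1) this]] have sub: "pauli_support (\<phi> p) \<subseteq> A" .
    have "\<bar>fst (fst q') - fst (fst q)\<bar> \<le> r \<and> \<bar>snd (fst q') - snd (fst q)\<bar> \<le> r" if "q' \<in> A" for q'
      using gates[OF A(1)] A(2) that unfolding within_range_def by blast
    then show ?thesis
      using sub unfolding near_def R_def by (meson insertI1 max.coboundedI1 subsetD)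
  next
    case False
    then have "\<phi> p = p" using that by (intro off_gates) (auto simp: disjnt_def)
    then show ?thesis using that by (simp add: near_def R_def)
  qed
  have X: "near R (pauli_support (\<phi> (1, a, {}))) a" if "finite a" "a \<subseteq> plane_qubits N" for a
    using that
  proof (induction a rule: finite_induct)
    case (insert q a)
    have "near R (pauli_support (\<phi> ((1, {q}, {}) \<otimes>\<^bsub>plane_paulis N\<^esub> (1, a, {})))) ({q} \<union> a)"
      using insert by (intro near_mult single) (auto simp: carrier_pauli_group)
    then show ?case using insert by (simp add: mult_pauli_group flip: insert_eq_xor)
  qed (simp add: phase)
  have Z: "near R (pauli_support (\<phi> (1, {}, a))) a" if "finite a" "a \<subseteq> plane_qubits N" for a
    using that
  proof (induction a rule: finite_induct)
    case (insert q a)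
    have "near R (pauli_support (\<phi> ((1, {}, {q}) \<otimes>\<^bsub>plane_paulis N\<^esub> (1, {}, a)))) ({q} \<union> a)"
      using insert by (intro near_mult single) (auto simp: carrier_pauli_group)
    then show ?case using insert by (simp add: mult_pauli_group flip: insert_eq_xor)
  qed (simp add: phase)
  have "near R (pauli_support (\<phi> p)) (pauli_support p)" if p: "p \<in> carrier (plane_paulis N)" for p
  proof -
    obtain c a b where [simp]: "p = (c, a, b)" by (cases p)
    have *: "c \<in> phases" "finite a" "a \<subseteq> plane_qubits N" "finite b" "b \<subseteq> plane_qubits N"
      using p by (auto simp: carrier_pauli_group)
    have "near R (pauli_support (\<phi> ((c, {}, {}) \<otimes>\<^bsub>plane_paulis N\<^esub>
        ((1, a, {}) \<otimes>\<^bsub>plane_paulis N\<^esub> (1, {}, b))))) ({} \<union> (a \<union> b))"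
      using * by (intro near_mult X Z) (auto simp: carrier_pauli_group mult_pauli_group phase)
    then show ?thesis by (simp add: mult_pauli_group)
  qed
  then show ?thesis using hom phase by (intro exI[of _ R]) (simp add: local_hom_def)
qed

lemma clifford_circuit_local:
  "clifford_circuit N \<phi> \<Longrightarrow> \<exists>r. local_hom N r \<phi>"
proof (induction rule: clifford_circuit.induct)
  case empty_circuit
  have "local_hom N 0 id" by unfold_locales (auto simp: hom_def near_def)
  then show ?case by blast
next
  case (add_layer \<phi> \<psi>)
  from add_layer(3) obtain r where "local_hom N r \<phi>" by blast
  then interpret \<phi>: local_hom N r \<phi> .
  from clifford_layer_local[OF add_layer(2)] obtain r' where "local_hom N r' \<psi>" by blast
  then interpret \<psi>: local_hom N r' \<psi> .
  have "\<psi> \<circ> \<phi> \<in> hom (plane_paulis N) (plane_paulis N)"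
    using hom_compose[OF \<phi>.hom \<psi>.hom] .
  moreover have "near (r' + r) (pauli_support ((\<psi> \<circ> \<phi>) p)) (pauli_support p)"
    if "p \<in> carrier (plane_paulis N)" for p
    using near_trans[OF \<psi>.near[OF hom_in_carrier[OF \<phi>.hom that]] \<phi>.near[OF that]] by simp
  ultimately have "local_hom N (r' + r) (\<psi> \<circ> \<phi>)"
    by unfold_locales (auto simp: \<phi>.phase \<psi>.phase simp del: insert_iff)
  then show ?case by blast
qed

context local_hom
begin

lemma mult: "p \<in> carrier (plane_paulis N) \<Longrightarrow> p' \<in> carrier (plane_paulis N) \<Longrightarrow>
    \<phi> (p \<otimes>\<^bsub>plane_paulis N\<^esub> p') = \<phi> p \<otimes>\<^bsub>plane_paulis N\<^esub> \<phi> p'"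
  using hom_mult[OF hom] .

lemma in_carrier: "p \<in> carrier (plane_paulis N) \<Longrightarrow> \<phi> p \<in> carrier (plane_paulis N)"
  using hom_in_carrier[OF hom] .

text \<open>If \<open>q\<close> is far from the support of \<open>\<phi> p\<close>, then the images of X and Z on \<open>q\<close> commute with
  \<open>\<phi> p\<close>, hence X and Z on \<open>q\<close> commute with \<open>p\<close>. So the inverse is local as well.\<close>

lemma near_inverse:
  assumes p: "p \<in> carrier (plane_paulis N)"
  shows "near r (pauli_support p) (pauli_support (\<phi> p))"
  unfolding near_def
proof
  fix q assume q: "q \<in> pauli_support p"
  obtain c a b where [simp]: "p = (c, a, b)" by (cases p)
  let ?P = "plane_paulis N"
  \<comment> \<open>The witness is whichever of Z and X on \<open>q\<close> anticommutes with
    \<open>p\<close>: Z if \<open>p\<close> has an X factor there, otherwise X.\<close>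
  obtain x where x: "x \<in> carrier ?P" "pauli_support x = {q}"
    "x \<otimes>\<^bsub>?P\<^esub> p = (-1, {}, {}) \<otimes>\<^bsub>?P\<^esub> (p \<otimes>\<^bsub>?P\<^esub> x)"
  proof (cases "q \<in> a")
    case True
    then show ?thesis
      using p by (intro that[of "(1, {}, {q})"]) (auto simp: pauli_group_simps xor_commute)
  next
    case False
    then show ?thesis
      using p q by (intro that[of "(1, {q}, {})"]) (auto simp: pauli_group_simps xor_commute)
  qed
  have minus: "(-1, {}, {}) \<in> carrier ?P" by (simp add: carrier_pauli_group)
  interpret group ?P by (rule group_pauli_group)
  have "\<phi> x \<otimes>\<^bsub>?P\<^esub> \<phi> p = (-1, {}, {}) \<otimes>\<^bsub>?P\<^esub> (\<phi> p \<otimes>\<^bsub>?P\<^esub> \<phi> x)"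
    using arg_cong[OF x(3), of \<phi>] x(1) p minus phase[of "-1"] by (simp add: mult)
  moreover obtain c' a' b' where \<phi>p: "\<phi> p = (c', a', b')" by (cases "\<phi> p")
  moreover obtain c'' a'' b'' where \<phi>x: "\<phi> x = (c'', a'', b'')" by (cases "\<phi> x")
  moreover have "c' \<noteq> 0" "c'' \<noteq> 0"
    using in_carrier[OF p] in_carrier[OF x(1)] \<phi>p \<phi>x by (auto simp: carrier_pauli_group)
  ultimately have "parity b'' a' \<noteq> 1 \<or> parity b' a'' \<noteq> 1"
    by (auto simp: mult_pauli_group)
  then have "\<not> disjnt b'' a' \<or> \<not> disjnt b' a''" using parity_disjnt by blast
  then obtain u where "u \<in> pauli_support (\<phi> p)" "u \<in> pauli_support (\<phi> x)"
    unfolding \<phi>p \<phi>x pauli_support.simps disjnt_def by blast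
  then show "\<exists>q'\<in>pauli_support (\<phi> p). \<bar>fst (fst q) - fst (fst q')\<bar> \<le> r \<and>
      \<bar>snd (fst q) - snd (fst q')\<bar> \<le> r"
    using near[OF x(1)] x(2) by (auto simp: near_def abs_minus_commute)
qed

end

lemma pauli_vector_eq_empty_iff: "pauli_vector p = {} \<longleftrightarrow> pauli_support p = {}"
  by (cases p) auto

lemma ball_Plus: "(\<forall>x\<in>a <+> b. P x) \<longleftrightarrow> (\<forall>q\<in>a. P (Inl q)) \<and> (\<forall>q\<in>b. P (Inr q))"
  by auto

lemma far_iff_support: "far R (pauli_vector p) \<longleftrightarrow>
    (\<forall>q\<in>pauli_support p. R < \<bar>fst (fst q)\<bar> \<or> R < \<bar>snd (fst q)\<bar>)"
  by (cases p) (simp add: far_def ball_Plus ball_Un)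

lemma narrow_iff_support:
  "narrow D (pauli_vector p) \<longleftrightarrow> within_range D (pauli_support p)"
  by (cases p) (simp add: narrow_def within_range_def ball_Plus ball_Un ball_conj_distrib; blast)

lemma near_far:
  assumes "near r (pauli_support p') (pauli_support p)" "far (R + r) (pauli_vector p)"
  shows "far R (pauli_vector p')"
  unfolding far_iff_support
proof
  fix q assume "q \<in> pauli_support p'"
  then obtain q' where "q' \<in> pauli_support p" "\<bar>fst (fst q) - fst (fst q')\<bar> \<le> r"
    "\<bar>snd (fst q) - snd (fst q')\<bar> \<le> r"
    using assms(1) unfolding near_def by blast
  with assms(2) show "R < \<bar>fst (fst q)\<bar> \<or> R < \<bar>snd (fst q)\<bar>"
    unfolding far_iff_support by fastforce
qed

lemma near_narrow:
  assumes "near r (pauli_support p') (pauli_support p)" "narrow D (pauli_vector p)"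
  shows "narrow (D + 2 * r) (pauli_vector p')"
  unfolding narrow_iff_support within_range_def
proof (intro ballI)
  fix q s assume q: "q \<in> pauli_support p'" "s \<in> pauli_support p'"
  then obtain q' where q': "q' \<in> pauli_support p" "\<bar>fst (fst q) - fst (fst q')\<bar> \<le> r"
    "\<bar>snd (fst q) - snd (fst q')\<bar> \<le> r"
    using assms(1) unfolding near_def by blast
  obtain s' where s': "s' \<in> pauli_support p" "\<bar>fst (fst s) - fst (fst s')\<bar> \<le> r"
    "\<bar>snd (fst s) - snd (fst s')\<bar> \<le> r"
    using q assms(1) unfolding near_def by blast
  have "\<bar>fst (fst q') - fst (fst s')\<bar> \<le> D" "\<bar>snd (fst q') - snd (fst s')\<bar> \<le> D"
    using bspec[OF bspec[OF assms(2)[unfolded narrow_iff_support within_range_def] q'(1)] s'(1)]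
    by simp_all
  moreover have "\<bar>x - y\<bar> \<le> D + 2 * r" if "\<bar>x - x'\<bar> \<le> r" "\<bar>y - y'\<bar> \<le> r" "\<bar>x' - y'\<bar> \<le> D"
    for x x' y y' :: int using that by linarith
  ultimately show "\<bar>fst (fst q) - fst (fst s)\<bar> \<le> D + 2 * r \<and> \<bar>snd (fst q) - snd (fst s)\<bar> \<le> D + 2 * r"
    using q'(2,3) s'(2,3) by blast
qed

abbreviation stabilizer_space :: "stabilizer_model \<Rightarrow> plane_vector set" where
  "stabilizer_space M \<equiv> pauli_vector ` stabilizers M"

locale stabilizer_monoid =
  fixes M :: stabilizer_model
  assumes stabilizers_carrier: "stabilizers M \<subseteq> carrier (plane_paulis (qubits_per_site M))"
    and stabilizers_one: "(1, {}, {}) \<in> stabilizers M"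
    and stabilizers_mult: "p \<in> stabilizers M \<Longrightarrow> p' \<in> stabilizers M \<Longrightarrow>
      p \<otimes>\<^bsub>plane_paulis (qubits_per_site M)\<^esub> p' \<in> stabilizers M"
begin

lemma space_empty: "{} \<in> stabilizer_space M"
  by (rule image_eqI[OF _ stabilizers_one]) (simp add: Plus_def)

lemma space_xor:
  assumes "a \<in> stabilizer_space M" "b \<in> stabilizer_space M"
  shows "a \<triangle> b \<in> stabilizer_space M"
proof -
  from assms obtain p p' where *: "p \<in> stabilizers M" "a = pauli_vector p"
    "p' \<in> stabilizers M" "b = pauli_vector p'" by blast
  show ?thesis using image_eqI[OF _ stabilizers_mult[OF *(1,3)], of "a \<triangle> b" pauli_vector] *
    by simp
qed

end

lemma stabilizer_monoid_generate:
  assumes "stabilizers M = generate (plane_paulis (qubits_per_site M)) A"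
    "A \<subseteq> carrier (plane_paulis (qubits_per_site M))"
  shows "stabilizer_monoid M"
proof
  show "stabilizers M \<subseteq> carrier (plane_paulis (qubits_per_site M))"
    using generate_in_carrier_pauli[OF assms(2)] assms(1) by simp
  show "(1, {}, {}) \<in> stabilizers M"
    using generate.one[of "plane_paulis (qubits_per_site M)" A] assms(1)
    by (simp add: one_pauli_group)
qed (auto simp: assms(1) intro: generate.eng)

text \<open>\<open>near\<close> and \<open>near_inverse\<close> bound each support by a
  neighbourhood of the other, which gives both halves of every geometric axiom.\<close>

lemma (in stabilizer_monoid) coarse_iso_local_hom:
  assumes "local_hom (qubits_per_site M) r \<phi>"
  shows "coarse_iso (stabilizer_space M) (pauli_vector ` \<phi> ` stabilizers M)
    {(pauli_vector p, pauli_vector (\<phi> p)) |p. p \<in> stabilizers M}"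
proof -
  interpret local_hom "qubits_per_site M" r \<phi> by fact
  note carr = subsetD[OF stabilizers_carrier]
  let ?r = "{(pauli_vector p, pauli_vector (\<phi> p)) |p. p \<in> stabilizers M}"
  show ?thesis
  proof
    fix a b a' b' assume "(a, b) \<in> ?r" "(a', b') \<in> ?r"
    then obtain p p' where *: "a = pauli_vector p" "b = pauli_vector (\<phi> p)" "p \<in> stabilizers M"
      "a' = pauli_vector p'" "b' = pauli_vector (\<phi> p')" "p' \<in> stabilizers M" by blast
    then show "(a \<triangle> a', b \<triangle> b') \<in> ?r"
      by (intro CollectI exI[of _ "p \<otimes>\<^bsub>plane_paulis (qubits_per_site M)\<^esub> p'"])
        (auto simp: mult carr stabilizers_mult)
  next
    fix a b assume "(a, b) \<in> ?r"
    then obtain p where *: "a = pauli_vector p" "b = pauli_vector (\<phi> p)" "p \<in> stabilizers M" by blast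
    show "a = {} \<longleftrightarrow> b = {}"
      using near[OF carr[OF *(3)]] near_inverse[OF carr[OF *(3)]]
      unfolding * pauli_vector_eq_empty_iff near_def by blast
  next
    fix R :: int
    show "\<exists>R'. \<forall>a b. (a, b) \<in> ?r \<longrightarrow> far R' a \<longrightarrow> far R b"
      by (rule exI[of _ "R + r"]) (blast intro: near_far near carr)
    show "\<exists>R'. \<forall>a b. (a, b) \<in> ?r \<longrightarrow> far R' b \<longrightarrow> far R a"
      by (rule exI[of _ "R + r"]) (blast intro: near_far near_inverse carr)
  next
    fix D :: int
    show "\<exists>D'. \<forall>a b. (a, b) \<in> ?r \<longrightarrow> narrow D a \<longrightarrow> narrow D' b"
      by (rule exI[of _ "D + 2 * r"]) (blast intro: near_narrow near carr)
    show "\<exists>D'. \<forall>a b. (a, b) \<in> ?r \<longrightarrow> narrow D b \<longrightarrow> narrow D' a"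
      by (rule exI[of _ "D + 2 * r"]) (blast intro: near_narrow near_inverse carr)
  qed blast+
qed

lemma has_charges_lu_equivalent:
  assumes "stabilizer_monoid M" "lu_equivalent M M'"
  shows "has_charges (stabilizer_space M) k \<longleftrightarrow> has_charges (stabilizer_space M') k"
proof -
  from assms(2) obtain \<phi> where \<phi>: "clifford_circuit (qubits_per_site M) \<phi>"
    "\<phi> ` stabilizers M = stabilizers M'"
    unfolding lu_equivalent_def by blast
  from clifford_circuit_local[OF \<phi>(1)] obtain r where "local_hom (qubits_per_site M) r \<phi>" by blast
  note iso = stabilizer_monoid.coarse_iso_local_hom[OF assms(1) this, unfolded \<phi>(2)]
  show ?thesis
    using has_charges_coarse_iso[OF _ iso] has_charges_coarse_iso[OF _ coarse_iso_converse[OF iso]]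
    by blast
qed

section \<open>Invariance under coarse-graining and adding product states\<close>

text \<open>Uniqueness of mixed-radix digits, needed twice to read off the qubit and the position in
  a block from a coarse label.\<close>

lemma nat_mix_inj:
  fixes a b a' b' n :: nat
  assumes "a + n * b = a' + n * b'" "a < n" "a' < n"
  shows "a = a' \<and> b = b'"
proof -
  have "(a + n * b) mod n = a" "(a' + n * b') mod n = a'" "(a + n * b) div n = b"
    "(a' + n * b') div n = b'" using assms(2,3) by simp_all
  then show ?thesis using assms(1) by metis
qed

lemma nat_mix_less:
  fixes a b m n :: nat
  assumes "a < n" "b < m"
  shows "a + n * b < n * m"
proof -
  have "a + n * b < n * (b + 1)" using assms(1) by simp
  also have "\<dots> \<le> n * m" using assms(2) by (intro mult_left_mono) auto
  finally show ?thesis .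
qed

lemma coarse_label_in:
  assumes "kx \<ge> 1" "ky \<ge> 1" "q \<in> plane_qubits N"
  shows "coarse_label kx ky N q \<in> plane_qubits (kx * ky * N)"
proof -
  obtain x y j where q: "q = ((x, y), j)" by (metis prod.exhaust)
  have "nat (x mod int kx) < kx" "nat (y mod int ky) < ky" using assms(1,2) by (simp_all add: nat_less_iff)
  then have "j + N * (nat (x mod int kx) + kx * nat (y mod int ky)) < N * (kx * ky)"
    using assms(3) by (intro nat_mix_less) (auto simp: q plane_qubits_def)
  then show ?thesis by (simp add: q coarse_label_def plane_qubits_def ac_simps)
qed

lemma coarse_label_inj:
  assumes "kx \<ge> 1" "ky \<ge> 1"
  shows "inj_on (coarse_label kx ky N) (plane_qubits N)"
proof (rule inj_onI)
  fix q q' assume q: "q \<in> plane_qubits N" "q' \<in> plane_qubits N"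
    "coarse_label kx ky N q = coarse_label kx ky N q'"
  obtain x y j where q1: "q = ((x, y), j)" by (metis prod.exhaust)
  obtain x' y' j' where q2: "q' = ((x', y'), j')" by (metis prod.exhaust)
  have *: "x div int kx = x' div int kx" "y div int ky = y' div int ky"
    "j + N * (nat (x mod int kx) + kx * nat (y mod int ky)) =
     j' + N * (nat (x' mod int kx) + kx * nat (y' mod int ky))" "j < N" "j' < N"
    using q by (auto simp: q1 q2 coarse_label_def plane_qubits_def)
  from nat_mix_inj[OF *(3-5)] have **: "j = j'"
    "nat (x mod int kx) + kx * nat (y mod int ky) = nat (x' mod int kx) + kx * nat (y' mod int ky)"
    by auto
  from nat_mix_inj[OF **(2)] have "nat (x mod int kx) = nat (x' mod int kx)"
    "nat (y mod int ky) = nat (y' mod int ky)"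
    using assms by (auto simp: nat_less_iff)
  then have "x mod int kx = x' mod int kx" "y mod int ky = y' mod int ky"
    using assms by (auto simp: eq_nat_nat_iff)
  with *(1,2) have "x = x'" "y = y'" by (metis mult_div_mod_eq)+
  then show "q = q'" using **(1) by (simp add: q1 q2)
qed

lemma relabel_mult:
  assumes "inj_on f Q" "p \<in> carrier (pauli_group Q)" "p' \<in> carrier (pauli_group Q)"
  shows "relabel_pauli f (p \<otimes>\<^bsub>pauli_group Q\<^esub> p') =
    relabel_pauli f p \<otimes>\<^bsub>pauli_group Q'\<^esub> relabel_pauli f p'"
proof -
  obtain c a b where p: "p = (c, a, b)" by (cases p)
  obtain c' a' b' where p': "p' = (c', a', b')" by (cases p')
  have sub: "a \<subseteq> Q" "b \<subseteq> Q" "a' \<subseteq> Q" "b' \<subseteq> Q"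
    using assms(2,3) by (auto simp: p p' carrier_pauli_group)
  have "card (f ` b \<inter> f ` a') = card (f ` (b \<inter> a'))"
    using sub inj_on_image_Int[OF assms(1)] by simp
  also have "\<dots> = card (b \<inter> a')"
    using sub by (intro card_image inj_on_subset[OF assms(1)]) auto
  finally show ?thesis
    using sub assms(1) by (simp add: p p' mult_pauli_group parity_def image_xor[of f Q])
qed

section \<open>Integer division as a coarse isometry\<close>

lemma abs_le_div:
  fixes x k :: int
  assumes "k \<ge> 1"
  shows "\<bar>x\<bar> \<le> k * (\<bar>x div k\<bar> + 1)"
proof -
  have "\<bar>x\<bar> \<le> \<bar>k * (x div k)\<bar> + \<bar>x mod k\<bar>"
    using abs_triangle_ineq[of "k * (x div k)" "x mod k"] by simp
  also have "\<bar>x mod k\<bar> \<le> k" using assms pos_mod_bound[of k x] pos_mod_sign[of k x] by linarith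
  finally show ?thesis using assms by (simp add: abs_mult distrib_left)
qed

lemma abs_div_le:
  fixes x k :: int
  assumes "k \<ge> 1"
  shows "\<bar>x div k\<bar> \<le> \<bar>x\<bar>"
proof (cases "x \<ge> 0")
  case True
  then show ?thesis using assms zdiv_mono2[of x 1 k] by (simp add: pos_imp_zdiv_nonneg_iff)
next
  case False
  then show ?thesis using assms zdiv_mono2_neg[of x 1 k] div_neg_pos_less0[of x k] by simp
qed

lemma abs_div_diff_le:
  fixes x x' k D :: int
  assumes "k \<ge> 1" "\<bar>x - x'\<bar> \<le> D"
  shows "\<bar>x div k - x' div k\<bar> \<le> D"
proof -
  have *: "u div k - u' div k \<le> D" if "u - u' \<le> D" "D \<ge> 0" for u u'
  proof -
    have "u div k \<le> (u' + D * k) div k"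
    proof (rule zdiv_mono1)
      have "D * 1 \<le> D * k" using assms(1) that(2) by (intro mult_left_mono)
      then show "u \<le> u' + D * k" using that(1) by simp
    qed (use assms(1) in simp)
    also have "\<dots> = u' div k + D" using assms(1) by simp
    finally show ?thesis by simp
  qed
  show ?thesis using *[of x x'] *[of x' x] assms(2) by linarith
qed

lemma abs_diff_le_div:
  fixes x x' k D :: int
  assumes "k \<ge> 1" "\<bar>x div k - x' div k\<bar> \<le> D"
  shows "\<bar>x - x'\<bar> \<le> k * (D + 1)"
proof -
  have "\<bar>x - x'\<bar> \<le> \<bar>k * (x div k - x' div k)\<bar> + \<bar>x mod k - x' mod k\<bar>"
    using abs_triangle_ineq[of "k * (x div k - x' div k)" "x mod k - x' mod k"]
    by (simp add: right_diff_distrib minus_mult_div_eq_mod [symmetric])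
  also have "\<bar>x mod k - x' mod k\<bar> \<le> k"
    using assms(1) pos_mod_bound[of k x] pos_mod_sign[of k x] pos_mod_bound[of k x'] pos_mod_sign[of k x']
    by linarith
  also have "\<bar>k * (x div k - x' div k)\<bar> \<le> k * D"
    using assms by (simp add: abs_mult)
  finally show ?thesis by (simp add: distrib_left)
qed

context stabilizer_monoid
begin

context
  fixes kx ky :: nat
  assumes kx: "kx \<ge> 1" and ky: "ky \<ge> 1"
begin

abbreviation (input) relabel :: "plane_qubit pauli \<Rightarrow> plane_qubit pauli" where
  "relabel \<equiv> relabel_pauli (coarse_label kx ky (qubits_per_site M))"

lemma site_coarse_label:
  "fst (coarse_label kx ky N q) = (fst (fst q) div int kx, snd (fst q) div int ky)"
  by (cases q) (auto simp: coarse_label_def)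

lemma support_relabel:
  "pauli_support (relabel p) = coarse_label kx ky (qubits_per_site M) ` pauli_support p"
  by (cases p) (simp add: image_Un)

lemma relabel_in:
  assumes "p \<in> stabilizers M"
  shows "relabel p \<in> carrier (plane_paulis (kx * ky * qubits_per_site M))"
proof -
  obtain c a b where p: "p = (c, a, b)" by (cases p)
  have "(c, a, b) \<in> carrier (plane_paulis (qubits_per_site M))"
    using stabilizers_carrier assms p by blast
  then show ?thesis
    using coarse_label_in[OF kx ky] by (auto simp: p carrier_pauli_group subset_iff)
qed

lemma stabilizer_monoid_coarse_grain: "stabilizer_monoid (coarse_grain kx ky M)"
proof
  show "stabilizers (coarse_grain kx ky M) \<subseteq>
      carrier (plane_paulis (qubits_per_site (coarse_grain kx ky M)))"
    using relabel_in by (auto simp: coarse_grain_def)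
  show "(1, {}, {}) \<in> stabilizers (coarse_grain kx ky M)"
    using imageI[OF stabilizers_one, of relabel] by (simp add: coarse_grain_def)
  fix p p' assume "p \<in> stabilizers (coarse_grain kx ky M)" "p' \<in> stabilizers (coarse_grain kx ky M)"
  then obtain u u' where u: "u \<in> stabilizers M" "p = relabel u"
    "u' \<in> stabilizers M" "p' = relabel u'" by (auto simp: coarse_grain_def)
  then show "p \<otimes>\<^bsub>plane_paulis (qubits_per_site (coarse_grain kx ky M))\<^esub> p' \<in>
      stabilizers (coarse_grain kx ky M)"
    using relabel_mult[OF coarse_label_inj[OF kx ky] subsetD[OF stabilizers_carrier u(1)]
        subsetD[OF stabilizers_carrier u(3)], symmetric] imageI[OF stabilizers_mult[OF u(1,3)], of relabel]
    by (simp add: coarse_grain_def)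
qed

text \<open>Relabelling by blocks preserves products and changes distances by bounded factors only,
  in both directions.\<close>

lemma has_charges_coarse_grain:
  assumes "has_charges (stabilizer_space M) k"
  shows "has_charges (stabilizer_space (coarse_grain kx ky M)) k"
proof (rule has_charges_coarse_iso[OF assms])
  let ?r = "{(pauli_vector p, pauli_vector (relabel p)) |p. p \<in> stabilizers M}"
  note carr = subsetD[OF stabilizers_carrier]
  have kxy: "int kx \<ge> 1" "int ky \<ge> 1" using kx ky by auto
  have space: "stabilizer_space (coarse_grain kx ky M) = pauli_vector ` relabel ` stabilizers M"
    by (simp add: coarse_grain_def)
  show "coarse_iso (stabilizer_space M) (stabilizer_space (coarse_grain kx ky M)) ?r"
    unfolding space
  proof
    fix a b a' b' assume "(a, b) \<in> ?r" "(a', b') \<in> ?r"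
    then obtain p p' where *: "a = pauli_vector p" "b = pauli_vector (relabel p)" "p \<in> stabilizers M"
      "a' = pauli_vector p'" "b' = pauli_vector (relabel p')" "p' \<in> stabilizers M" by blast
    \<comment> \<open>The multiplication does not depend on the set of qubits, so any target set
      will do in \<open>relabel_mult\<close>.\<close>
    have "relabel (p \<otimes>\<^bsub>plane_paulis (qubits_per_site M)\<^esub> p') =
        relabel p \<otimes>\<^bsub>pauli_group UNIV\<^esub> relabel p'"
      by (rule relabel_mult[OF coarse_label_inj[OF kx ky] carr[OF *(3)] carr[OF *(6)]])
    with * show "(a \<triangle> a', b \<triangle> b') \<in> ?r"
      by (intro CollectI exI[of _ "p \<otimes>\<^bsub>plane_paulis (qubits_per_site M)\<^esub> p'"])
        (simp add: stabilizers_mult)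
  next
    fix a b assume "(a, b) \<in> ?r"
    then obtain p where *: "a = pauli_vector p" "b = pauli_vector (relabel p)" by blast
    show "a = {} \<longleftrightarrow> b = {}"
      unfolding * pauli_vector_eq_empty_iff support_relabel by simp
  next
    fix R :: int
    \<comment> \<open>A single factor for both coordinates; the summand 1 accounts for the offset
      inside a block.\<close>
    have "far R (pauli_vector (relabel p))" if "far ((int kx + int ky) * (\<bar>R\<bar> + 1)) (pauli_vector p)" for p
      unfolding far_iff_support support_relabel
    proof
      fix q' assume "q' \<in> coarse_label kx ky (qubits_per_site M) ` pauli_support p"
      then obtain x y j where q: "((x, y), j) \<in> pauli_support p"
        "q' = coarse_label kx ky (qubits_per_site M) ((x, y), j)" by auto
      show "R < \<bar>fst (fst q')\<bar> \<or> R < \<bar>snd (fst q')\<bar>"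
      proof (rule ccontr)
        assume "\<not> ?thesis"
        then have le: "\<bar>x div int kx\<bar> \<le> R" "\<bar>y div int ky\<bar> \<le> R"
          by (simp_all add: q(2) site_coarse_label)
        have "\<bar>x\<bar> \<le> int kx * (\<bar>x div int kx\<bar> + 1)" by (rule abs_le_div[OF kxy(1)])
        also have "\<dots> \<le> (int kx + int ky) * (\<bar>R\<bar> + 1)" using le by (intro mult_mono) auto
        finally have "\<bar>x\<bar> \<le> (int kx + int ky) * (\<bar>R\<bar> + 1)" .
        moreover have "\<bar>y\<bar> \<le> int ky * (\<bar>y div int ky\<bar> + 1)" by (rule abs_le_div[OF kxy(2)])
        then have "\<bar>y\<bar> \<le> (int kx + int ky) * (\<bar>R\<bar> + 1)"
          by (rule order_trans) (use le in \<open>intro mult_mono; simp\<close>)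
        ultimately show False using bspec[OF that[unfolded far_iff_support] q(1)] by simp
      qed
    qed
    then show "\<exists>R'. \<forall>a b. (a, b) \<in> ?r \<longrightarrow> far R' a \<longrightarrow> far R b"
      by (intro exI[of _ "(int kx + int ky) * (\<bar>R\<bar> + 1)"]) blast
    have "far R (pauli_vector p)" if "far R (pauli_vector (relabel p))" for p
      unfolding far_iff_support
    proof
      fix q assume "q \<in> pauli_support p"
      then have "R < \<bar>fst (fst q) div int kx\<bar> \<or> R < \<bar>snd (fst q) div int ky\<bar>"
        using that unfolding far_iff_support support_relabel by (simp add: site_coarse_label)
      then show "R < \<bar>fst (fst q)\<bar> \<or> R < \<bar>snd (fst q)\<bar>"
        using abs_div_le[OF kxy(1)] abs_div_le[OF kxy(2)] by (meson less_le_trans)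
    qed
    then show "\<exists>R'. \<forall>a b. (a, b) \<in> ?r \<longrightarrow> far R' b \<longrightarrow> far R a" by blast
  next
    fix D :: int
    have "narrow D (pauli_vector (relabel p))" if "narrow D (pauli_vector p)" for p
      using that abs_div_diff_le[OF kxy(1)] abs_div_diff_le[OF kxy(2)]
      unfolding narrow_iff_support within_range_def support_relabel
      by (simp add: site_coarse_label)
    then show "\<exists>D'. \<forall>a b. (a, b) \<in> ?r \<longrightarrow> narrow D a \<longrightarrow> narrow D' b" by blast
    have "narrow ((int kx + int ky) * (\<bar>D\<bar> + 1)) (pauli_vector p)"
      if "narrow D (pauli_vector (relabel p))" for p
      unfolding narrow_iff_support within_range_def
    proof (intro ballI)
      fix q q' assume "q \<in> pauli_support p" "q' \<in> pauli_support p"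
      then have *: "\<bar>fst (fst q) div int kx - fst (fst q') div int kx\<bar> \<le> \<bar>D\<bar>"
        "\<bar>snd (fst q) div int ky - snd (fst q') div int ky\<bar> \<le> \<bar>D\<bar>"
        using that unfolding narrow_iff_support within_range_def support_relabel
        by (force simp: site_coarse_label)+
      have "int kx * (\<bar>D\<bar> + 1) \<le> (int kx + int ky) * (\<bar>D\<bar> + 1)"
        "int ky * (\<bar>D\<bar> + 1) \<le> (int kx + int ky) * (\<bar>D\<bar> + 1)"
        by (intro mult_right_mono; simp)+
      with abs_diff_le_div[OF kxy(1) *(1)] abs_diff_le_div[OF kxy(2) *(2)]
      show "\<bar>fst (fst q) - fst (fst q')\<bar> \<le> (int kx + int ky) * (\<bar>D\<bar> + 1) \<and>
          \<bar>snd (fst q) - snd (fst q')\<bar> \<le> (int kx + int ky) * (\<bar>D\<bar> + 1)"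
        by linarith
    qed
    then show "\<exists>D'. \<forall>a b. (a, b) \<in> ?r \<longrightarrow> narrow D b \<longrightarrow> narrow D' a" by blast
  qed blast+
qed

end

lemma add_product_state_carrier:
  "stabilizers M \<union> {Z_op {(v, j)} |v j. qubits_per_site M \<le> j \<and> j < qubits_per_site M + m}
    \<subseteq> carrier (plane_paulis (qubits_per_site M + m))"
proof -
  have "plane_qubits (qubits_per_site M) \<subseteq> plane_qubits (qubits_per_site M + m)"
    by (auto simp: plane_qubits_def)
  then have "carrier (plane_paulis (qubits_per_site M)) \<subseteq> carrier (plane_paulis (qubits_per_site M + m))"
    by (fastforce simp: carrier_pauli_group simp del: insert_iff)
  then show ?thesis using stabilizers_carrier by (auto simp: plane_qubits_def)
qed

lemma stabilizers_add_product_state: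
  "stabilizers (add_product_state m M) = generate (plane_paulis (qubits_per_site M + m))
    (stabilizers M \<union> {Z_op {(v, j)} |v j. qubits_per_site M \<le> j \<and> j < qubits_per_site M + m})"
  by (simp add: add_product_state_def Let_def)

lemma qubits_add_product_state [simp]:
  "qubits_per_site (add_product_state m M) = qubits_per_site M + m"
  by (simp add: add_product_state_def Let_def)

lemma stabilizer_monoid_add_product_state: "stabilizer_monoid (add_product_state m M)"
  by (rule stabilizer_monoid_generate, unfold qubits_add_product_state)
    (rule stabilizers_add_product_state add_product_state_carrier)+

lemma has_charges_add_product_state:
  assumes "has_charges (stabilizer_space M) k"
  shows "has_charges (stabilizer_space (add_product_state m M)) k"
proof -
  let ?N = "qubits_per_site M"
  define C :: plane_vector where "C = Inr ` {(v, j). ?N \<le> j \<and> j < ?N + m}"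
  have "stabilizer_space (add_product_state m M) = xor_span (pauli_vector ` (stabilizers M \<union>
      {Z_op {(v, j)} |v j. ?N \<le> j \<and> j < ?N + m}))"
    unfolding stabilizers_add_product_state by (rule pauli_vector_generate[OF add_product_state_carrier])
  also have "pauli_vector ` (stabilizers M \<union> {Z_op {(v, j)} |v j. ?N \<le> j \<and> j < ?N + m}) =
      stabilizer_space M \<union> (\<lambda>p. {p}) ` C"
  proof -
    have *: "{Z_op {(v, j)} |v j. ?N \<le> j \<and> j < ?N + m} = (\<lambda>q. Z_op {q}) ` {(v, j). ?N \<le> j \<and> j < ?N + m}"
      by auto
    have **: "pauli_vector (Z_op {q}) = {Inr q}" for q :: plane_qubit
      by (simp add: Z_op_def Plus_def)
    show ?thesis by (simp only: * ** C_def image_Un image_image)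
  qed
  finally have *: "stabilizer_space (add_product_state m M) =
    xor_span (stabilizer_space M \<union> (\<lambda>p. {p}) ` C)" .
  have "a \<inter> C = {}" if a: "a \<in> stabilizer_space M" for a
  proof -
    obtain p' where "p' \<in> stabilizers M" "a = pauli_vector p'" using a by blast
    then obtain c x y where p: "(c, x, y) \<in> stabilizers M" "a = x <+> y" by (cases p') simp
    have "y \<subseteq> plane_qubits ?N" using subsetD[OF stabilizers_carrier p(1)] by (simp add: carrier_pauli_group)
    then show ?thesis unfolding p(2) by (auto simp: C_def plane_qubits_def)
  qed
  then show ?thesis
    unfolding * by (intro has_charges_add_singletons assms space_empty space_xor)
qed

end

section \<open>The number of toric codes is determined\<close>

lemma toric_carrier:
  "{X_op (toric_star c x y) |c x y. c < n} \<union> {Z_op (toric_plaquette c x y) |c x y. c < n}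
    \<subseteq> carrier (plane_paulis (2 * n))"
  by (auto simp: toric_star_def toric_plaquette_def plane_qubits_def)

lemma qubits_toric_codes [simp]: "qubits_per_site (toric_codes n) = 2 * n"
  by (simp add: toric_codes_def)

lemma stabilizers_toric_codes: "stabilizers (toric_codes n) = generate (plane_paulis (2 * n))
    ({X_op (toric_star c x y) |c x y. c < n} \<union> {Z_op (toric_plaquette c x y) |c x y. c < n})"
  by (simp add: toric_codes_def)

lemma stabilizer_monoid_toric: "stabilizer_monoid (toric_codes n)"
proof (rule stabilizer_monoid_generate, unfold qubits_toric_codes)
qed (rule stabilizers_toric_codes toric_carrier)+

lemma has_charges_toric_codes: "has_charges (stabilizer_space (toric_codes n)) (2 * n)"
proof -
  have star: "pauli_vector (X_op (toric_star c x y)) = toric_generator (2 * c, (x, y))" for c x y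
    by (auto simp: X_op_def toric_star_def toric_generator_def toric_edge_def toric_edge'_def
        toric_dir_def toric_dir'_def)
  have plaquette: "pauli_vector (Z_op (toric_plaquette c x y)) = toric_generator (2 * c + 1, (x, y))"
    for c x y
    by (auto simp: Z_op_def toric_plaquette_def toric_generator_def toric_edge_def toric_edge'_def
        toric_dir_def toric_dir'_def)
  have "pauli_vector ` ({X_op (toric_star c x y) |c x y. c < n} \<union>
      {Z_op (toric_plaquette c x y) |c x y. c < n}) = toric_generator ` ({..<2 * n} \<times> UNIV)"
    (is "?A = ?B")
  proof
    show "?A \<subseteq> ?B" by (auto simp: star plaquette)
    show "?B \<subseteq> ?A"
    proof
      fix a assume "a \<in> ?B"
      then obtain j x y where j: "j < 2 * n" "a = toric_generator (j, (x, y))" by auto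
      show "a \<in> ?A"
      proof (cases "even j")
        case True
        then have "a = pauli_vector (X_op (toric_star (j div 2) x y))" "j div 2 < n"
          using j by (auto simp: star)
        then show ?thesis by blast
      next
        case False
        then have "2 * (j div 2) + 1 = j" by simp
        then have "a = pauli_vector (Z_op (toric_plaquette (j div 2) x y))" "j div 2 < n"
          using j by (auto simp: plaquette)
        then show ?thesis by blast
      qed
    qed
  qed
  then show ?thesis
    unfolding stabilizers_toric_codes pauli_vector_generate[OF toric_carrier]
    using has_charges_toric by simp
qed

text \<open>The known circuit gives \<open>M\<close> exactly \<open>2 * n'\<close> charges. These
  are carried forward through coarse-graining, added qubits and the unknown circuit to
  \<open>n\<close> toric codes, which also have \<open>2 * n\<close>; \<open>has_charges_le\<close>
  then compares both numbers.\<close>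

lemma (in stabilizer_monoid) equivalent_to_toric_codes_unique:
  assumes "equivalent_to_toric_codes M n" "lu_equivalent M (add_product_state m (toric_codes n'))"
  shows "n = n'"
proof -
  have M: "has_charges (stabilizer_space M) (2 * n')"
    using has_charges_lu_equivalent[OF stabilizer_monoid_axioms assms(2)]
      stabilizer_monoid.has_charges_add_product_state[OF stabilizer_monoid_toric has_charges_toric_codes]
    by blast
  from assms(1) obtain kx ky m0 m' where k: "kx \<ge> 1" "ky \<ge> 1" and
    eq: "lu_equivalent (add_product_state m0 (coarse_grain kx ky M)) (add_product_state m' (toric_codes n))"
    unfolding equivalent_to_toric_codes_def by blast
  interpret C: stabilizer_monoid "coarse_grain kx ky M"
    by (rule stabilizer_monoid_coarse_grain[OF k])
  interpret T: stabilizer_monoid "add_product_state m' (toric_codes n)"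
    by (rule stabilizer_monoid.stabilizer_monoid_add_product_state[OF stabilizer_monoid_toric])
  have "has_charges (stabilizer_space (add_product_state m' (toric_codes n))) (2 * n')"
    using has_charges_lu_equivalent[OF C.stabilizer_monoid_add_product_state eq]
      C.has_charges_add_product_state[OF has_charges_coarse_grain[OF k M]] by blast
  moreover have "has_charges (stabilizer_space (add_product_state m' (toric_codes n))) (2 * n)"
    by (rule stabilizer_monoid.has_charges_add_product_state[OF stabilizer_monoid_toric
          has_charges_toric_codes])
  ultimately have "2 * n' \<le> 2 * n" "2 * n \<le> 2 * n'"
    using has_charges_le T.space_empty T.space_xor by blast+
  then show ?thesis by simp
qed

section \<open>Layers\<close>

text \<open>The action of controlled-not gates: X and Z parts transform separately and linearly, and
  the phase stays.\<close>

definition linear_pauli_map :: "('q \<Rightarrow> 'q set) \<Rightarrow> ('q \<Rightarrow> 'q set) \<Rightarrow> 'q pauli \<Rightarrow> 'q pauli" where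
  "linear_pauli_map f g = (\<lambda>(c, a, b). (c, xor_sum f a, xor_sum g b))"

lemma linear_pauli_map_simp [simp]:
  "linear_pauli_map f g (c, a, b) = (c, xor_sum f a, xor_sum g b)"
  by (simp add: linear_pauli_map_def)

text \<open>Exchanging X and Z on \<open>H\<close> leaves the factors there in the order Z before X;
  the parity is the sign of restoring the normal order.\<close>

definition hadamard :: "'q set \<Rightarrow> 'q pauli \<Rightarrow> 'q pauli" where
  "hadamard H = (\<lambda>(c, a, b).
     (c * parity (b \<inter> H) a, (a - H) \<triangle> (b \<inter> H), (b - H) \<triangle> (a \<inter> H)))"

lemma hadamard_simp [simp]: "hadamard H (c, a, b) =
    (c * parity (b \<inter> H) a, (a - H) \<triangle> (b \<inter> H), (b - H) \<triangle> (a \<inter> H))"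
  by (simp add: hadamard_def)

text \<open>Conjugation by X on all qubits of \<open>P\<close>. The set \<open>P\<close> may be
  infinite, since \<open>b\<close> is finite for the operators concerned.\<close>

definition pauli_flip :: "'q set \<Rightarrow> 'q pauli \<Rightarrow> 'q pauli" where
  "pauli_flip P = (\<lambda>(c, a, b). (c * parity b P, a, b))"

lemma pauli_flip_simp [simp]: "pauli_flip P (c, a, b) = (c * parity b P, a, b)"
  by (simp add: pauli_flip_def)

lemma parity_xor_sum_left:
  "finite b \<Longrightarrow> (\<And>q. q \<in> b \<Longrightarrow> finite (g q)) \<Longrightarrow>
    parity (xor_sum g b) a = (\<Prod>q\<in>b. parity (g q) a)"
  by (induction b rule: finite_induct) (auto simp: parity_xor_left finite_xor_sum)

lemma parity_xor_sum_right:
  "finite b \<Longrightarrow> (\<And>q. q \<in> b \<Longrightarrow> finite (g q)) \<Longrightarrow>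
    parity a (xor_sum g b) = (\<Prod>q\<in>b. parity a (g q))"
  using parity_xor_sum_left[of b g a] by (simp add: parity_commute)

text \<open>The gate on a block permutes the computational basis by the linear map \<open>xor_sum f\<close>. Conjugation by it
  turns X on \<open>q\<close> into X on \<open>f q\<close>, hence Z on \<open>q\<close> into Z on the member \<open>g q\<close> of the dual basis.\<close>

locale block_basis =
  fixes N :: nat and r :: int and B f g :: "plane_qubit \<Rightarrow> plane_qubit set"
  assumes in_block: "q \<in> plane_qubits N \<Longrightarrow> q \<in> B q"
    and block_subset: "q \<in> plane_qubits N \<Longrightarrow> B q \<subseteq> plane_qubits N"
    and finite_block: "q \<in> plane_qubits N \<Longrightarrow> finite (B q)"
    and block_range: "q \<in> plane_qubits N \<Longrightarrow> within_range r (B q)"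
    and block_eq: "q \<in> plane_qubits N \<Longrightarrow> q' \<in> B q \<Longrightarrow> B q' = B q"
    and f_block: "q \<in> plane_qubits N \<Longrightarrow> f q \<subseteq> B q"
    and g_block: "q \<in> plane_qubits N \<Longrightarrow> g q \<subseteq> B q"
    and dual: "q \<in> plane_qubits N \<Longrightarrow> q' \<in> plane_qubits N \<Longrightarrow>
      parity (g q) (f q') = (if q = q' then -1 else 1)"
begin

lemma finite_f: "q \<in> plane_qubits N \<Longrightarrow> finite (f q)"
  and finite_g: "q \<in> plane_qubits N \<Longrightarrow> finite (g q)"
  using finite_subset[OF f_block finite_block] finite_subset[OF g_block finite_block] by auto

text \<open>The bilinear extension of \<open>dual\<close>. It makes the map multiplicative and the
  gates invertible.\<close>

lemma parity_xor_sum: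
  assumes "finite a" "a \<subseteq> plane_qubits N" "finite b" "b \<subseteq> plane_qubits N"
  shows "parity (xor_sum g b) (xor_sum f a) = parity b a"
proof -
  have "parity (xor_sum g b) (xor_sum f a) = (\<Prod>q\<in>b. parity (g q) (xor_sum f a))"
    using assms by (intro parity_xor_sum_left) (auto intro: finite_g)
  also have "\<dots> = (\<Prod>q\<in>b. \<Prod>q'\<in>a. parity (g q) (f q'))"
    using assms by (intro prod.cong refl parity_xor_sum_right) (auto intro: finite_f)
  also have "\<dots> = (\<Prod>q\<in>b. \<Prod>q'\<in>a. if q = q' then -1 else 1)"
    using assms by (intro prod.cong refl dual) auto
  also have "\<dots> = (\<Prod>q\<in>b. if q \<in> a then -1 else 1)"
    using assms by (simp add: prod.delta)
  finally show ?thesis using assms by (simp add: parity_eq_prod)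
qed

lemma xor_sum_block:
  assumes "q \<in> plane_qubits N" "a \<subseteq> B q"
  shows "xor_sum f a \<subseteq> B q" "xor_sum g a \<subseteq> B q"
proof -
  have "f q' \<subseteq> B q \<and> g q' \<subseteq> B q" if "q' \<in> a" for q'
    using f_block[of q'] g_block[of q'] block_eq[OF assms(1), of q'] block_subset[OF assms(1)]
      assms(2) that by auto
  then show "xor_sum f a \<subseteq> B q" "xor_sum g a \<subseteq> B q" by (intro xor_sum_subset; blast)+
qed

text \<open>A single matrix serves all blocks, because entries outside the subsets of a block are
  ignored.\<close>

definition gate :: "plane_qubit operator" where
  "gate s t = of_bool (s = xor_sum f t)"

text \<open>Pairing \<open>xor_sum f s\<close> with \<open>g u\<close> recovers whether
  \<open>u\<close> is in \<open>s\<close>; an injective self-map of a finite set is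
  bijective.\<close>

lemma bij_block:
  assumes q: "q \<in> plane_qubits N"
  shows "bij_betw (xor_sum f) (Pow (B q)) (Pow (B q))"
proof -
  have fin: "finite a" if "a \<subseteq> B q" for a using finite_subset[OF that finite_block[OF q]] .
  have "inj_on (xor_sum f) (Pow (B q))"
  proof (rule inj_onI)
    fix s t assume *: "s \<in> Pow (B q)" "t \<in> Pow (B q)" "xor_sum f s = xor_sum f t"
    have "u \<in> s \<longleftrightarrow> u \<in> t" if "u \<in> B q" for u
    proof -
      have "s \<subseteq> plane_qubits N" "t \<subseteq> plane_qubits N" "{u} \<subseteq> plane_qubits N"
        using * that block_subset[OF q] by auto
      then have "parity {u} s = parity {u} t"
        using * fin parity_xor_sum[of s "{u}"] parity_xor_sum[of t "{u}"] by simp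
      then show ?thesis by (simp split: if_splits)
    qed
    then show "s = t" using * by blast
  qed
  moreover have "xor_sum f ` Pow (B q) \<subseteq> Pow (B q)" using xor_sum_block(1)[OF q] by blast
  ultimately show ?thesis
    using endo_inj_surj[of "Pow (B q)" "xor_sum f"] finite_block[OF q] by (simp add: bij_betw_def)
qed

lemma unitary_gate:
  assumes q: "q \<in> plane_qubits N"
  shows "unitary_on (B q) gate"
  unfolding unitary_on_def
proof (intro ballI conjI)
  note bij = bij_block[OF q]
  have fin: "finite (Pow (B q))" using finite_block[OF q] by simp
  fix s t assume st: "s \<in> Pow (B q)" "t \<in> Pow (B q)"
  obtain u0 where u0: "u0 \<in> Pow (B q)" "xor_sum f u0 = s"
    using bij st(1) unfolding bij_betw_def by (metis imageE)
  have "(\<Sum>u\<in>Pow (B q). gate s u * cnj (gate t u)) = (\<Sum>u\<in>Pow (B q). if u = u0 then of_bool (s = t) else 0)"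
    using bij u0 by (intro sum.cong refl) (auto simp: gate_def bij_betw_def inj_on_def)
  then show "(\<Sum>u\<in>Pow (B q). gate s u * cnj (gate t u)) = of_bool (s = t)"
    using u0(1) fin by simp
  have "xor_sum f s \<in> Pow (B q)" using st(1) xor_sum_block(1)[OF q] by auto
  moreover have "xor_sum f s = xor_sum f t \<longleftrightarrow> s = t"
    using bij st by (auto simp: bij_betw_def inj_on_def)
  moreover have "(\<Sum>u\<in>Pow (B q). cnj (gate u s) * gate u t) =
      (\<Sum>u\<in>Pow (B q). if u = xor_sum f s then of_bool (xor_sum f s = xor_sum f t) else 0)"
    by (intro sum.cong refl) (auto simp: gate_def)
  ultimately show "(\<Sum>u\<in>Pow (B q). cnj (gate u s) * gate u t) = of_bool (s = t)"
    using fin by simp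
qed

text \<open>Conjugation by a permutation matrix renames rows and columns: the entry at
  \<open>s\<close>, \<open>t\<close> is the entry of \<open>p\<close> at the preimages
  \<open>s0\<close>, \<open>t0\<close>.\<close>

lemma linear_pauli_map_block:
  assumes q: "q \<in> plane_qubits N" and p: "p \<in> carrier (pauli_group (B q))"
  shows "linear_pauli_map f g p \<in> carrier (pauli_group (B q))"
    and "conjugates_to (B q) gate p (linear_pauli_map f g p)"
proof -
  obtain c a b where [simp]: "p = (c, a, b)" by (cases p)
  have c: "c \<in> phases" and ab: "a \<subseteq> B q" "b \<subseteq> B q" using p by (auto simp: carrier_pauli_group)
  have fin: "finite a" if "a \<subseteq> B q" for a using finite_subset[OF that finite_block[OF q]] .
  show "linear_pauli_map f g p \<in> carrier (pauli_group (B q))"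
    using xor_sum_block[OF q ab(1)] xor_sum_block[OF q ab(2)] fin c by (simp add: carrier_pauli_group)
  note bij = bij_block[OF q]
  have finP: "finite (Pow (B q))" using finite_block[OF q] by simp
  show "conjugates_to (B q) gate p (linear_pauli_map f g p)"
    unfolding conjugates_to_def
  proof (intro ballI)
    fix s t assume st: "s \<in> Pow (B q)" "t \<in> Pow (B q)"
    obtain s0 where s0: "s0 \<in> Pow (B q)" "xor_sum f s0 = s"
      using bij st(1) unfolding bij_betw_def by (metis imageE)
    obtain t0 where t0: "t0 \<in> Pow (B q)" "xor_sum f t0 = t"
      using bij st(2) unfolding bij_betw_def by (metis imageE)
    have inj: "xor_sum f u = xor_sum f v \<longleftrightarrow> u = v" if "u \<subseteq> B q" "v \<subseteq> B q" for u v
      using bij that by (auto simp: bij_betw_def inj_on_def)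
    have "(\<Sum>u\<in>Pow (B q). \<Sum>v\<in>Pow (B q). gate s u * pauli_matrix p u v * cnj (gate t v)) =
        (\<Sum>u\<in>Pow (B q). if u = s0 then \<Sum>v\<in>Pow (B q). if v = t0 then pauli_matrix p s0 t0 else 0 else 0)"
      using s0 t0 inj
      by (intro sum.cong refl) (auto simp: gate_def intro!: sum.neutral sum.cong)
    also have "\<dots> = pauli_matrix p s0 t0" using s0(1) t0(1) finP by simp
    also have "\<dots> = (if s0 = t0 \<triangle> a then c * parity b t0 else 0)"
      by (simp add: parity_def xor_def)
    also have "s0 = t0 \<triangle> a \<longleftrightarrow> s = t \<triangle> xor_sum f a"
      using inj[of s0 "t0 \<triangle> a"] s0 t0 ab fin xor_subset[of t0 "B q" a] by (auto simp: xor_sum_xor)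
    also have "parity b t0 = parity (xor_sum g b) t"
      using parity_xor_sum[of t0 b] t0 ab fin block_subset[OF q] by auto
    finally show "(\<Sum>u\<in>Pow (B q). \<Sum>v\<in>Pow (B q). gate s u * pauli_matrix p u v * cnj (gate t v)) =
        pauli_matrix (linear_pauli_map f g p) s t"
      by (simp add: parity_def xor_def)
  qed
qed

lemma linear_pauli_map_hom: "linear_pauli_map f g \<in> hom (plane_paulis N) (plane_paulis N)"
proof (rule homI)
  fix p assume p: "p \<in> carrier (plane_paulis N)"
  obtain c a b where [simp]: "p = (c, a, b)" by (cases p)
  have ab: "a \<subseteq> plane_qubits N" "b \<subseteq> plane_qubits N" using p by (auto simp: carrier_pauli_group)
  have "xor_sum f a \<subseteq> plane_qubits N"
    using f_block block_subset ab(1) by (intro xor_sum_subset) blast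
  moreover have "xor_sum g b \<subseteq> plane_qubits N"
    using g_block block_subset ab(2) by (intro xor_sum_subset) blast
  moreover have "finite (xor_sum f a)" "finite (xor_sum g b)"
    using ab by (intro finite_xor_sum finite_f finite_g; blast)+
  ultimately show "linear_pauli_map f g p \<in> carrier (plane_paulis N)"
    using p by (simp add: carrier_pauli_group del: insert_iff)
next
  fix p p' assume "p \<in> carrier (plane_paulis N)" "p' \<in> carrier (plane_paulis N)"
  then show "linear_pauli_map f g (p \<otimes>\<^bsub>plane_paulis N\<^esub> p') =
      linear_pauli_map f g p \<otimes>\<^bsub>plane_paulis N\<^esub> linear_pauli_map f g p'"
    by (cases p; cases p')
      (simp add: carrier_pauli_group mult_pauli_group xor_sum_xor parity_xor_sum)
qed

lemma clifford_layer_linear: "clifford_layer N (linear_pauli_map f g)"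
  unfolding clifford_layer_def
proof (intro exI[of _ "(\<lambda>A. (A, gate)) ` B ` plane_qubits N"] exI[of _ r] conjI)
  show "\<forall>(A, U)\<in>(\<lambda>A. (A, gate)) ` B ` plane_qubits N.
      A \<subseteq> plane_qubits N \<and> within_range r A \<and> clifford_gate A U"
  proof
    fix x assume "x \<in> (\<lambda>A. (A, gate)) ` B ` plane_qubits N"
    then obtain q where q: "q \<in> plane_qubits N" "x = (B q, gate)" by blast
    have "clifford_gate (B q) gate"
      using finite_block[OF q(1)] unitary_gate[OF q(1)] linear_pauli_map_block[OF q(1)]
      unfolding clifford_gate_def by blast
    then show "case x of (A, U) \<Rightarrow> A \<subseteq> plane_qubits N \<and> within_range r A \<and> clifford_gate A U"
      using block_subset[OF q(1)] block_range[OF q(1)] q(2) by simp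
  qed
  show "pairwise (\<lambda>g h. disjnt (fst g) (fst h)) ((\<lambda>A. (A, gate)) ` B ` plane_qubits N)"
  proof (rule pairwiseI)
    fix x y assume "x \<in> (\<lambda>A. (A, gate)) ` B ` plane_qubits N"
      "y \<in> (\<lambda>A. (A, gate)) ` B ` plane_qubits N" "x \<noteq> y"
    then obtain q q' where *: "q \<in> plane_qubits N" "q' \<in> plane_qubits N" "x = (B q, gate)"
      "y = (B q', gate)" "B q \<noteq> B q'" by blast
    have "B q \<inter> B q' = {}"
    proof (rule ccontr)
      assume "B q \<inter> B q' \<noteq> {}"
      then obtain u where "u \<in> B q" "u \<in> B q'" by blast
      then show False using block_eq[OF *(1), of u] block_eq[OF *(2), of u] *(5) by simp
    qed
    then show "disjnt (fst x) (fst y)" by (simp add: *(3,4) disjnt_def)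
  qed
  show "linear_pauli_map f g \<in> hom (plane_paulis N) (plane_paulis N)"
    by (rule linear_pauli_map_hom)
  show "\<forall>(A, U)\<in>(\<lambda>A. (A, gate)) ` B ` plane_qubits N. \<forall>p\<in>carrier (pauli_group A).
      linear_pauli_map f g p \<in> carrier (pauli_group A) \<and> conjugates_to A U p (linear_pauli_map f g p)"
  proof
    fix x assume "x \<in> (\<lambda>A. (A, gate)) ` B ` plane_qubits N"
    then obtain q where "q \<in> plane_qubits N" "x = (B q, gate)" by blast
    then show "case x of (A, U) \<Rightarrow> \<forall>p\<in>carrier (pauli_group A).
        linear_pauli_map f g p \<in> carrier (pauli_group A) \<and> conjugates_to A U p (linear_pauli_map f g p)"
      using linear_pauli_map_block by simp
  qed
  show "\<forall>p\<in>carrier (plane_paulis N).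
      disjnt (pauli_support p) (\<Union> (fst ` (\<lambda>A. (A, gate)) ` B ` plane_qubits N)) \<longrightarrow>
      linear_pauli_map f g p = p"
  proof (intro ballI impI)
    fix p assume p: "p \<in> carrier (plane_paulis N)"
      "disjnt (pauli_support p) (\<Union> (fst ` (\<lambda>A. (A, gate)) ` B ` plane_qubits N))"
    \<comment> \<open>The blocks cover all qubits, so only pure phases avoid every gate.\<close>
    have "pauli_support p = {}"
      using p(2) support_subset[OF p(1)] in_block unfolding disjnt_def by (fastforce simp: image_image)
    then show "linear_pauli_map f g p = p" by (cases p) simp
  qed
qed

end

section \<open>Layers of single-qubit gates\<close>

lemma single_qubit_layer:
  assumes "\<phi> \<in> hom (plane_paulis N) (plane_paulis N)" "H \<subseteq> plane_qubits N"
    and "\<And>q. q \<in> H \<Longrightarrow> unitary_on {q} U"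
    and gate: "\<And>q p. q \<in> H \<Longrightarrow> p \<in> carrier (pauli_group {q}) \<Longrightarrow>
      \<phi> p \<in> carrier (pauli_group {q}) \<and> conjugates_to {q} U p (\<phi> p)"
    and "\<And>p. p \<in> carrier (plane_paulis N) \<Longrightarrow> disjnt (pauli_support p) H \<Longrightarrow> \<phi> p = p"
  shows "clifford_layer N \<phi>"
  unfolding clifford_layer_def
proof (intro exI[of _ "(\<lambda>q. ({q}, U)) ` H"] exI[of _ 0] conjI)
  show "\<forall>(A, U)\<in>(\<lambda>q. ({q}, U)) ` H. A \<subseteq> plane_qubits N \<and> within_range 0 A \<and> clifford_gate A U"
    using assms unfolding clifford_gate_def within_range_def by fastforce
  show "pairwise (\<lambda>g h. disjnt (fst g) (fst h)) ((\<lambda>q. ({q}, U)) ` H)"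
    by (auto simp: pairwise_def)
  show "\<forall>(A, U)\<in>(\<lambda>q. ({q}, U)) ` H. \<forall>p\<in>carrier (pauli_group A).
      \<phi> p \<in> carrier (pauli_group A) \<and> conjugates_to A U p (\<phi> p)"
    using gate by blast
  have "\<Union> (fst ` (\<lambda>q. ({q}, U)) ` H) = H" by auto
  then show "\<forall>p\<in>carrier (plane_paulis N).
      disjnt (pauli_support p) (\<Union> (fst ` (\<lambda>q. ({q}, U)) ` H)) \<longrightarrow> \<phi> p = p"
    using assms(5) by simp
qed fact

lemma Pow_singleton: "Pow {q} = {{}, {q}}"
  by auto

text \<open>Each pairing splits into its parts on and off \<open>H\<close>. Off \<open>H\<close>
  nothing changes; on \<open>H\<close> the reordering signs in \<open>hadamard\<close> compensate
  for the exchange of X and Z.\<close>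

lemma hadamard_hom: "hadamard H \<in> hom (plane_paulis N) (plane_paulis N)"
proof (rule homI)
  fix p assume p: "p \<in> carrier (plane_paulis N)"
  obtain c a b where [simp]: "p = (c, a, b)" by (cases p)
  have "(a - H) \<triangle> (b \<inter> H) \<subseteq> plane_qubits N" "(b - H) \<triangle> (a \<inter> H) \<subseteq> plane_qubits N"
    using p by (intro xor_subset; auto simp: carrier_pauli_group)+
  then show "hadamard H p \<in> carrier (plane_paulis N)"
    using p by (simp add: carrier_pauli_group phases_parity del: insert_iff)
next
  fix p p' assume "p \<in> carrier (plane_paulis N)" "p' \<in> carrier (plane_paulis N)"
  moreover obtain c a b where p: "p = (c, a, b)" by (cases p)
  moreover obtain c' a' b' where p': "p' = (c', a', b')" by (cases p')
  ultimately have fin: "finite a" "finite b" "finite a'" "finite b'"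
    by (auto simp: carrier_pauli_group)
  have split: "parity x y = parity (x \<inter> H) (y \<inter> H) * parity (x - H) (y - H)"
    if "finite x" "finite y" for x y :: "plane_qubit set"
  proof -
    have "x = (x \<inter> H) \<triangle> (x - H)" by auto
    then have "parity x y = parity ((x \<inter> H) \<triangle> (x - H)) y" by simp
    also have "\<dots> = parity (x \<inter> H) y * parity (x - H) y" using that by (simp add: parity_xor_left)
    also have "parity (x \<inter> H) y = parity (x \<inter> H) (y \<inter> H)"
      unfolding parity_def by (rule arg_cong[where f = "\<lambda>x. (-1) ^ card x"]) blast
    also have "parity (x - H) y = parity (x - H) (y - H)"
      unfolding parity_def by (rule arg_cong[where f = "\<lambda>x. (-1) ^ card x"]) blast
    finally show ?thesis .
  qed
  have int: "parity (x \<inter> H) y = parity (x \<inter> H) (y \<inter> H)" for x y :: "plane_qubit set"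
    unfolding parity_def by (rule arg_cong[where f = "\<lambda>x. (-1) ^ card x"]) blast
  have H: "((x - H) \<triangle> (y \<inter> H)) \<inter> H = y \<inter> H" "((x - H) \<triangle> (y \<inter> H)) - H = x - H"
    for x y :: "plane_qubit set" by auto
  have dist: "(x \<triangle> y) \<inter> H = (x \<inter> H) \<triangle> (y \<inter> H)" "(x \<triangle> y) - H = (x - H) \<triangle> (y - H)"
    for x y :: "plane_qubit set" by auto
  have cross: "parity (x \<inter> H) (y - H) = 1" "parity (x - H) (y \<inter> H) = 1" for x y :: "plane_qubit set"
    by (auto intro!: parity_disjnt simp: disjnt_def)
  have "c * c' * parity b a' * parity ((b \<triangle> b') \<inter> H) (a \<triangle> a') =
      c * parity (b \<inter> H) a * (c' * parity (b' \<inter> H) a') *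
        parity ((b - H) \<triangle> (a \<inter> H)) ((a' - H) \<triangle> (b' \<inter> H))"
    using fin
    by (simp add: split[of b a'] split[of "(b - H) \<triangle> (a \<inter> H)"] H dist parity_xor_left
        parity_xor_right cross int[of _ a] int[of _ a'] parity_commute[of "a \<inter> H" "b' \<inter> H"])
  then show "hadamard H (p \<otimes>\<^bsub>plane_paulis N\<^esub> p') =
      hadamard H p \<otimes>\<^bsub>plane_paulis N\<^esub> hadamard H p'"
    by (simp add: p p' mult_pauli_group dist xor_ac)
qed

lemma clifford_layer_hadamard:
  assumes "H \<subseteq> plane_qubits N"
  shows "clifford_layer N (hadamard H)"
proof (rule single_qubit_layer[OF hadamard_hom assms])
  define h where "h = complex_of_real (1 / sqrt 2)"
  \<comment> \<open>The Hadamard matrix, with basis vectors indexed by subsets.\<close>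
  define U :: "plane_qubit operator" where "U = (\<lambda>s t. h * (-1) ^ card (s \<inter> t))"
  have h: "h * h = 1 / 2" "cnj h = h"
    by (simp_all add: h_def flip: of_real_mult)
  have h': "h * (h * x) = x / 2" for x using h(1) by (simp flip: mult.assoc)
  show "unitary_on {q} U" for q
    by (simp add: unitary_on_def Pow_singleton U_def h h')
  fix q p assume q: "q \<in> H" and "p \<in> carrier (pauli_group {q})"
  moreover obtain c a b where p: "p = (c, a, b)" by (cases p)
  ultimately have ab: "a = {} \<or> a = {q}" "b = {} \<or> b = {q}" "c \<in> phases"
    by (auto simp: carrier_pauli_group)
  then show "hadamard H p \<in> carrier (pauli_group {q}) \<and> conjugates_to {q} U p (hadamard H p)"
    using q by (elim disjE)
      (auto simp: p carrier_pauli_group conjugates_to_def Pow_singleton U_def h h' xor_def)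
next
  fix p assume "disjnt (pauli_support p) H"
  moreover obtain c a b where p: "p = (c, a, b)" by (cases p)
  ultimately have "a \<inter> H = {}" "b \<inter> H = {}" by (auto simp: disjnt_def)
  then show "hadamard H p = p" by (auto simp: p)
qed

lemma clifford_layer_pauli_flip:
  assumes "P \<subseteq> plane_qubits N"
  shows "clifford_layer N (pauli_flip P)"
proof (rule single_qubit_layer[OF _ assms])
  show "pauli_flip P \<in> hom (plane_paulis N) (plane_paulis N)"
  proof (rule homI)
    fix p assume "p \<in> carrier (plane_paulis N)"
    then show "pauli_flip P p \<in> carrier (plane_paulis N)"
      by (cases p) (simp add: carrier_pauli_group phases_parity del: insert_iff)
  next
    fix p p' assume "p \<in> carrier (plane_paulis N)" "p' \<in> carrier (plane_paulis N)"
    then show "pauli_flip P (p \<otimes>\<^bsub>plane_paulis N\<^esub> p') =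
        pauli_flip P p \<otimes>\<^bsub>plane_paulis N\<^esub> pauli_flip P p'"
      by (cases p; cases p') (simp add: carrier_pauli_group mult_pauli_group parity_xor_left)
  qed
  \<comment> \<open>The matrix of X.\<close>
  define U :: "plane_qubit operator" where "U = (\<lambda>s t. of_bool (s \<noteq> t))"
  show "unitary_on {q} U" for q
    by (simp add: unitary_on_def Pow_singleton U_def)
  fix q p assume q: "q \<in> P" and "p \<in> carrier (pauli_group {q})"
  moreover obtain c a b where p: "p = (c, a, b)" by (cases p)
  ultimately have ab: "a = {} \<or> a = {q}" "b = {} \<or> b = {q}" "c \<in> phases"
    by (auto simp: carrier_pauli_group)
  then show "pauli_flip P p \<in> carrier (pauli_group {q}) \<and> conjugates_to {q} U p (pauli_flip P p)"
    using q by (elim disjE)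
      (auto simp: p carrier_pauli_group conjugates_to_def Pow_singleton U_def)
next
  fix p assume "disjnt (pauli_support p) P"
  moreover obtain c a b where "p = (c, a, b)" by (cases p)
  ultimately show "pauli_flip P p = p" using parity_disjnt[of b P] by (simp add: disjnt_Un1)
qed

section \<open>The circuit\<close>

text \<open>Elements with the same vector differ by a phase, which lies in the group generated by
  \<open>A\<close> and therefore is 1. So the relations among the signs never have to be
  computed.\<close>

lemma generate_eqI:
  assumes A: "A \<subseteq> carrier (pauli_group Q)" and B: "B \<subseteq> generate (pauli_group Q) A"
    and "pauli_vector ` A \<subseteq> xor_span (pauli_vector ` B)"
    and minus: "(-1, {}, {}) \<notin> generate (pauli_group Q) A"
  shows "generate (pauli_group Q) A = generate (pauli_group Q) B"
proof
  interpret group "pauli_group Q" by (rule group_pauli_group)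
  have B': "B \<subseteq> carrier (pauli_group Q)" using B generate_in_carrier_pauli[OF A] by blast
  show BA: "generate (pauli_group Q) B \<subseteq> generate (pauli_group Q) A"
    using generate_subgroup_incl[OF B generate_is_subgroup[OF A]] .
  show "generate (pauli_group Q) A \<subseteq> generate (pauli_group Q) B"
  proof
    fix p assume p: "p \<in> generate (pauli_group Q) A"
    have "pauli_vector p \<in> xor_span (pauli_vector ` B)"
      using xor_span_subset[OF assms(3)] p pauli_vector_generate[OF A] by blast
    then obtain p' where p': "p' \<in> generate (pauli_group Q) B" "pauli_vector p' = pauli_vector p"
      using pauli_vector_generate[OF B'] by (metis imageE)
    let ?u = "p \<otimes>\<^bsub>pauli_group Q\<^esub> inv\<^bsub>pauli_group Q\<^esub> p'"
    have carr: "p \<in> carrier (pauli_group Q)" "p' \<in> carrier (pauli_group Q)"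
      using p p'(1) generate_in_carrier_pauli A B' by blast+
    have u: "?u \<in> generate (pauli_group Q) A"
      by (rule generate.eng[OF p generate_m_inv_closed[OF A subsetD[OF BA p'(1)]]])
    have "pauli_vector ?u = {}" using carr p'(2) by simp
    then obtain k where k: "?u = (k, {}, {})" by (cases ?u) (auto simp: Plus_def)
    have "k \<in> phases" using u k generate_in_carrier_pauli[OF A] by (auto simp: carrier_pauli_group)
    \<comment> \<open>The phases \<i> and -\<i> are excluded because they square to -1.\<close>
    moreover have "k * k \<noteq> -1 \<and> k \<noteq> -1"
      using minus u k generate.eng[OF u u] by (auto simp: mult_pauli_group)
    ultimately have "k = 1" by auto
    then have "?u = \<one>\<^bsub>pauli_group Q\<^esub>" using k by (simp add: one_pauli_group)
    then have "p = p'" using carr by (metis inv_closed inv_equality inv_inv)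
    then show "p \<in> generate (pauli_group Q) B" using p'(1) by simp
  qed
qed

text \<open>The first layer acts on each site. With \<open>n + 1\<close> the length of the compact direction, the qubits
  of a site are rearranged as follows: \<open>2 * c\<close> and \<open>2 * c + 1\<close> for \<open>c < n\<close> are the two qubits of the
  toric code \<open>c\<close>, \<open>2 * n + c\<close> is a third qubit that later layers decouple from them, and \<open>3 * n + i\<close> is
  the qubit on which the wrapping string of kind \<open>i\<close> acts. The operator X on the edge of direction \<open>i\<close> at
  height \<open>z\<close> becomes X on \<open>column_X n i z\<close>, the operator Z becomes Z on the dual set \<open>column_Z n i z\<close>.\<close>

definition column_X :: "nat \<Rightarrow> nat \<Rightarrow> nat \<Rightarrow> nat set" where
  "column_X n i z = (if i < 2 then insert (3 * n + i) ((\<lambda>c. 2 * c + i) ` {z..<n})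
     else if z < n then {2 * n + z} else insert (3 * n + 2) ((\<lambda>c. 2 * n + c) ` {..<n}))"

text \<open>Chosen so that wrapping strings collapse: for \<open>i < 2\<close> the sum of these sets
  over all heights telescopes to \<open>{3 * n + i}\<close>, and for \<open>i = 2\<close> the sum of
  the sets \<open>column_X\<close> is \<open>{3 * n + 2}\<close>.\<close>

definition column_Z :: "nat \<Rightarrow> nat \<Rightarrow> nat \<Rightarrow> nat set" where
  "column_Z n i z = (if i < 2
     then (if z < n then {2 * z + i} else {3 * n + i}) \<union> (if z = 0 then {} else {2 * (z - 1) + i})
     else if z < n then {2 * n + z, 3 * n + 2} else {3 * n + 2})"

definition site_basis_X :: "nat \<Rightarrow> nat \<Rightarrow> nat set" where
  "site_basis_X n j = column_X n (j mod 3) (j div 3)"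

definition site_basis_Z :: "nat \<Rightarrow> nat \<Rightarrow> nat set" where
  "site_basis_Z n j = column_Z n (j mod 3) (j div 3)"

section \<open>Duality of the column bases\<close>

lemma parity_pair:
  assumes "a \<noteq> b"
  shows "parity {a, b} x = (if a \<in> x then -1 else 1) * (if b \<in> x then -1 else 1)"
proof -
  have "parity (insert a {b}) x = (if a \<in> x then -1 else 1) * parity {b} x"
    by (rule parity_insert) (use assms in auto)
  also have "parity {b} x = (if b \<in> x then -1 else 1)" by (rule parity_singleton)
  finally show ?thesis .
qed

lemma parity_column_Z:
  assumes "i < 2" "z \<le> n"
  shows "parity (column_Z n i z) x = (if (if z < n then 2 * z + i else 3 * n + i) \<in> x then -1 else 1) *
    (if z \<noteq> 0 \<and> 2 * (z - 1) + i \<in> x then -1 else 1)"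
proof (cases "z = 0")
  case True
  then show ?thesis using assms by (simp add: column_Z_def)
next
  case False
  define a where "a = (if z < n then 2 * z + i else 3 * n + i)"
  have "column_Z n i z = {a, 2 * (z - 1) + i}"
    using False assms by (auto simp: column_Z_def a_def)
  moreover have "a \<noteq> 2 * (z - 1) + i" using False assms by (auto simp: a_def)
  ultimately show ?thesis using parity_pair[of a "2 * (z - 1) + i" x] False by (simp add: a_def)
qed

lemma in_column_X:
  assumes "i < 2" "i' < 3" "z' \<le> n"
  shows "z < n \<Longrightarrow> 2 * z + i \<in> column_X n i' z' \<longleftrightarrow> i = i' \<and> z' \<le> z"
    and "3 * n + i \<in> column_X n i' z' \<longleftrightarrow> i = i'"
proof -
  have "2 * z + i = 2 * c + i' \<longleftrightarrow> z = c \<and> i = i'" if "i' < 2" for c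
    using assms(1) that by presburger
  then show "z < n \<Longrightarrow> 2 * z + i \<in> column_X n i' z' \<longleftrightarrow> i = i' \<and> z' \<le> z"
    using assms by (auto simp: column_X_def image_iff)
  show "3 * n + i \<in> column_X n i' z' \<longleftrightarrow> i = i'"
    using assms by (auto simp: column_X_def image_iff)
qed

text \<open>For \<open>i < 2\<close> the X sets are cumulative in the height and the Z sets are
  differences: of the conditions \<open>z' \<le> z\<close> and \<open>z' < z\<close> exactly one
  holds iff \<open>z = z'\<close>. For \<open>i = 2\<close> the shared qubit
  \<open>3 * n + 2\<close> corrects the top X set.\<close>

lemma column_dual:
  assumes "i < 3" "i' < 3" "z \<le> n" "z' \<le> n"
  shows "parity (column_Z n i z) (column_X n i' z') = (if i = i' \<and> z = z' then -1 else 1)"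
proof (cases "i < 2")
  case True
  have "(if z < n then 2 * z + i else 3 * n + i) \<in> column_X n i' z' \<longleftrightarrow> i = i' \<and> z' \<le> z"
    using in_column_X[OF True assms(2,4)] assms by auto
  moreover have "z \<noteq> 0 \<and> 2 * (z - 1) + i \<in> column_X n i' z' \<longleftrightarrow> i = i' \<and> z' < z"
    using in_column_X(1)[OF True assms(2,4), of "z - 1"] assms by (cases "z = 0") auto
  ultimately show ?thesis by (auto simp: parity_column_Z[OF True assms(3)])
next
  case False
  then have i: "i = 2" using assms by simp
  show ?thesis
  proof (cases "i' < 2")
    case True
    then have "disjnt (column_Z n i z) (column_X n i' z')"
      using assms(3) by (auto simp: i disjnt_def column_Z_def column_X_def)
    then show ?thesis using True by (simp add: i parity_disjnt)
  next
    case False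
    then have "i' = 2" using assms by simp
    moreover have "parity {2 * n + z, 3 * n + 2} x =
        (if 2 * n + z \<in> x then -1 else 1) * (if 3 * n + 2 \<in> x then -1 else 1)" for x
      using assms by (intro parity_pair) auto
    ultimately show ?thesis
      using assms by (cases "z < n") (auto simp: i column_Z_def column_X_def)
  qed
qed

lemma site_basis_dual:
  assumes "j < 3 * n + 3" "j' < 3 * n + 3"
  shows "parity (site_basis_Z n j) (site_basis_X n j') = (if j = j' then -1 else 1)"
proof -
  have "j = j' \<longleftrightarrow> j mod 3 = j' mod 3 \<and> j div 3 = j' div 3" by (metis div_mult_mod_eq)
  moreover have "j div 3 \<le> n" "j' div 3 \<le> n" using assms by auto
  ultimately show ?thesis unfolding site_basis_X_def site_basis_Z_def by (simp add: column_dual)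
qed

lemma site_basis_subset:
  assumes "j < 3 * n + 3"
  shows "site_basis_X n j \<subseteq> {..<3 * n + 3}" "site_basis_Z n j \<subseteq> {..<3 * n + 3}"
proof -
  have "j div 3 \<le> n" using assms by auto
  then show "site_basis_X n j \<subseteq> {..<3 * n + 3}" "site_basis_Z n j \<subseteq> {..<3 * n + 3}"
    by (auto simp: site_basis_X_def site_basis_Z_def column_X_def column_Z_def split: if_splits)
qed

lemma site_basis_column:
  "i < 3 \<Longrightarrow> site_basis_X n (3 * z + i) = column_X n i z"
  "i < 3 \<Longrightarrow> site_basis_Z n (3 * z + i) = column_Z n i z"
  by (simp_all add: site_basis_X_def site_basis_Z_def)

abbreviation lift :: "(nat \<Rightarrow> nat set) \<Rightarrow> plane_qubit \<Rightarrow> plane_qubit set" where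
  "lift f q \<equiv> Pair (fst q) ` f (snd q)"

lemma block_basis_site:
  "block_basis (3 * n + 3) 0 (\<lambda>q. {fst q} \<times> {..<3 * n + 3})
    (lift (site_basis_X n)) (lift (site_basis_Z n))"
proof
  fix q q' assume q: "q \<in> plane_qubits (3 * n + 3)" "q' \<in> plane_qubits (3 * n + 3)"
  show "parity (lift (site_basis_Z n) q) (lift (site_basis_X n) q') = (if q = q' then -1 else 1)"
  proof (cases "fst q = fst q'")
    case True
    have "lift (site_basis_Z n) q \<inter> lift (site_basis_X n) q' =
        Pair (fst q) ` (site_basis_Z n (snd q) \<inter> site_basis_X n (snd q'))"
      using True by auto
    then have "parity (lift (site_basis_Z n) q) (lift (site_basis_X n) q') =
        parity (site_basis_Z n (snd q)) (site_basis_X n (snd q'))"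
      by (simp add: parity_def card_image inj_on_def)
    then show ?thesis
      using site_basis_dual[of "snd q" n "snd q'"] q True by (auto simp: plane_qubits_def prod_eq_iff)
  next
    case False
    then have "disjnt (lift (site_basis_Z n) q) (lift (site_basis_X n) q')" by (auto simp: disjnt_def)
    then show ?thesis using False by (auto simp: parity_disjnt)
  qed
next
  fix q assume q: "q \<in> plane_qubits (3 * n + 3)"
  show "lift (site_basis_X n) q \<subseteq> {fst q} \<times> {..<3 * n + 3}"
    "lift (site_basis_Z n) q \<subseteq> {fst q} \<times> {..<3 * n + 3}"
    using site_basis_subset[of "snd q" n] q by (auto simp: plane_qubits_def)
qed (auto simp: plane_qubits_def within_range_def)

text \<open>Controlled-not gates from the qubit \<open>2 * c\<close> of \<open>v\<close> to the qubit \<open>2 * n + c\<close> of \<open>v + u\<close>.\<close>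

definition cnot_X :: "nat \<Rightarrow> int \<times> int \<Rightarrow> plane_qubit \<Rightarrow> plane_qubit set" where
  "cnot_X n u q = (if even (snd q) \<and> snd q < 2 * n
     then {q, (fst q + u, 2 * n + snd q div 2)} else {q})"

definition cnot_Z :: "nat \<Rightarrow> int \<times> int \<Rightarrow> plane_qubit \<Rightarrow> plane_qubit set" where
  "cnot_Z n u q = (if 2 * n \<le> snd q \<and> snd q < 3 * n
     then {q, (fst q - u, 2 * (snd q - 2 * n))} else {q})"

text \<open>The blocks are the pairs of control and target and otherwise singletons: a control sees
  its partner through \<open>cnot_X\<close>, a target through \<open>cnot_Z\<close>.\<close>

lemma block_basis_cnot:
  "block_basis (3 * n + 3) (max \<bar>fst u\<bar> \<bar>snd u\<bar>) (\<lambda>q. cnot_X n u q \<union> cnot_Z n u q)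
    (cnot_X n u) (cnot_Z n u)"
proof
  fix q q' assume "q \<in> plane_qubits (3 * n + 3)" "q' \<in> plane_qubits (3 * n + 3)"
  obtain v j where q: "q = (v, j)" by (cases q)
  obtain v' j' where q': "q' = (v', j')" by (cases q')
  show "parity (cnot_Z n u q) (cnot_X n u q') = (if q = q' then -1 else 1)"
  proof (cases "2 * n \<le> j \<and> j < 3 * n")
    case True
    have ne: "(v - u, 2 * (j - 2 * n)) \<noteq> (v, j)" using True by auto
    have "parity (cnot_Z n u q) (cnot_X n u q') = (if q \<in> cnot_X n u q' then -1 else 1) *
        (if (v - u, 2 * (j - 2 * n)) \<in> cnot_X n u q' then -1 else 1)"
      using True parity_pair[OF ne[symmetric], of "cnot_X n u q'"] by (simp only: cnot_Z_def q) simp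
    also have "q \<in> cnot_X n u q' \<longleftrightarrow> q = q' \<or> q' = (v - u, 2 * (j - 2 * n))"
      using True by (auto simp: cnot_X_def q q')
    also have "(v - u, 2 * (j - 2 * n)) \<in> cnot_X n u q' \<longleftrightarrow> q' = (v - u, 2 * (j - 2 * n))"
      using True by (auto simp: cnot_X_def q q')
    finally show ?thesis using ne by (auto simp: q q')
  next
    case False
    then show ?thesis by (auto simp: cnot_Z_def cnot_X_def q q')
  qed
next
  fix q q' assume q': "q' \<in> cnot_X n u q \<union> cnot_Z n u q"
  obtain v j where q: "q = (v, j)" by (cases q)
  consider "even j" "j < 2 * n" | "2 * n \<le> j" "j < 3 * n" | "\<not> (even j \<and> j < 2 * n)" "\<not> (2 * n \<le> j \<and> j < 3 * n)"
    by blast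
  then show "cnot_X n u q' \<union> cnot_Z n u q' = cnot_X n u q \<union> cnot_Z n u q"
  proof cases
    case 1
    then obtain c where j: "j = 2 * c" "c < n" by auto
    then have "cnot_X n u q = {(v, 2 * c), (v + u, 2 * n + c)}" "cnot_Z n u q = {(v, 2 * c)}"
      "cnot_X n u (v + u, 2 * n + c) = {(v + u, 2 * n + c)}"
      "cnot_Z n u (v + u, 2 * n + c) = {(v + u, 2 * n + c), (v, 2 * c)}"
      by (simp_all add: q cnot_X_def cnot_Z_def)
    then show ?thesis using q' j q by auto
  next
    case 2
    then obtain c where j: "j = 2 * n + c" "c < n" using le_Suc_ex by fastforce
    then have "cnot_Z n u q = {(v, 2 * n + c), (v - u, 2 * c)}" "cnot_X n u q = {(v, 2 * n + c)}"
      "cnot_Z n u (v - u, 2 * c) = {(v - u, 2 * c)}"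
      "cnot_X n u (v - u, 2 * c) = {(v - u, 2 * c), (v, 2 * n + c)}"
      by (simp_all add: q cnot_X_def cnot_Z_def)
    then show ?thesis using q' j q by auto
  next
    case 3
    then have "cnot_Z n u q = {q}" "cnot_X n u q = {q}" by (simp_all only: cnot_X_def cnot_Z_def q fst_conv snd_conv if_False)
    then show ?thesis using q' by simp
  qed
qed (auto simp: cnot_X_def cnot_Z_def plane_qubits_def within_range_def split: if_splits)

definition basis_image_X :: "nat \<Rightarrow> plane_qubit \<Rightarrow> plane_qubit set" where
  "basis_image_X n q =
     xor_sum (cnot_X n (1, 0)) (xor_sum (cnot_X n (0, 0)) (lift (site_basis_X n) q))"

definition basis_image_Z :: "nat \<Rightarrow> plane_qubit \<Rightarrow> plane_qubit set" where
  "basis_image_Z n q =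
     xor_sum (cnot_Z n (1, 0)) (xor_sum (cnot_Z n (0, 0)) (lift (site_basis_Z n) q))"

text \<open>The factor 1 + X of the decoupling takes two layers, one for each target of a control:
  gates of one layer must be disjoint, and joining all gates that share a qubit would give infinite
  chains.\<close>

definition decoupling_map :: "nat \<Rightarrow> plane_qubit pauli \<Rightarrow> plane_qubit pauli" where
  "decoupling_map n = linear_pauli_map (cnot_X n (1, 0)) (cnot_Z n (1, 0)) \<circ>
     (linear_pauli_map (cnot_X n (0, 0)) (cnot_Z n (0, 0)) \<circ>
     (linear_pauli_map (lift (site_basis_X n)) (lift (site_basis_Z n)) \<circ> id))"

lemma clifford_circuit_decoupling: "clifford_circuit (3 * n + 3) (decoupling_map n)"
  unfolding decoupling_map_def
  by (intro clifford_circuit.intros block_basis.clifford_layer_linear[OF block_basis_cnot]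
      block_basis.clifford_layer_linear[OF block_basis_site])

lemma finite_site_basis: "finite (site_basis_X n j)" "finite (site_basis_Z n j)"
  by (auto simp: site_basis_X_def site_basis_Z_def column_X_def column_Z_def)

lemma finite_cnot: "finite (cnot_X n u q)" "finite (cnot_Z n u q)"
  by (auto simp: cnot_X_def cnot_Z_def)

lemma decoupling_map_simp:
  "decoupling_map n (c, a, b) = (c, xor_sum (basis_image_X n) a, xor_sum (basis_image_Z n) b)"
  by (simp add: decoupling_map_def basis_image_X_def basis_image_Z_def xor_sum_xor_sum
      finite_site_basis finite_cnot finite_xor_sum cong: xor_sum.cong)

lemma image_eq_xor_sum: "inj_on h A \<Longrightarrow> finite A \<Longrightarrow> h ` A = xor_sum (\<lambda>c. {h c}) A"
proof -
  assume "inj_on h A" "finite A"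
  then have "xor_sum (\<lambda>q. {q}) (h ` A) = xor_sum (\<lambda>c. {h c}) A"
    by (subst xor_sum.reindex) (simp_all add: comp_def)
  then show ?thesis using \<open>finite A\<close> by (simp add: xor_sum_singletons)
qed

lemma xor_sum_cnot_insert:
  assumes "\<And>c. c \<in> A \<Longrightarrow> finite (h c)"
  shows "xor_sum f ({q} \<triangle> xor_sum h A) = f q \<triangle> xor_sum (\<lambda>c. xor_sum f (h c)) A"
  using assms by (simp add: xor_sum_xor finite_xor_sum xor_sum_xor_sum)

lemma lift_column:
  assumes "i < 3"
  shows "lift (site_basis_X n) (v, 3 * z + i) = Pair v ` column_X n i z"
    "lift (site_basis_Z n) (v, 3 * z + i) = Pair v ` column_Z n i z"
  by (simp_all only: fst_conv snd_conv site_basis_column[OF assms])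

lemma pair_eq_xor: "a \<noteq> b \<Longrightarrow> {a, b} = {a} \<triangle> {b}"
  by auto

lemma image_column_X:
  assumes "i < 2"
  shows "Pair v ` column_X n i z = {(v, 3 * n + i)} \<triangle> xor_sum (\<lambda>c. {(v, 2 * c + i)}) {z..<n}"
proof -
  have "Pair v ` column_X n i z = insert (v, 3 * n + i) ((\<lambda>c. (v, 2 * c + i)) ` {z..<n})"
    using assms by (simp add: column_X_def image_image)
  also have "\<dots> = {(v, 3 * n + i)} \<triangle> (\<lambda>c. (v, 2 * c + i)) ` {z..<n}"
    by (rule insert_eq_xor) auto
  also have "(\<lambda>c. (v, 2 * c + i)) ` {z..<n} = xor_sum (\<lambda>c. {(v, 2 * c + i)}) {z..<n}"
    by (rule image_eq_xor_sum) (auto simp: inj_on_def)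
  finally show ?thesis .
qed

lemma image_column_X_2:
  "Pair v ` column_X n 2 z = (if z < n then {(v, 2 * n + z)} else
    {(v, 3 * n + 2)} \<triangle> xor_sum (\<lambda>c. {(v, 2 * n + c)}) {..<n})"
proof (cases "z < n")
  case False
  then have "Pair v ` column_X n 2 z = insert (v, 3 * n + 2) ((\<lambda>c. (v, 2 * n + c)) ` {..<n})"
    by (simp add: column_X_def image_image)
  also have "\<dots> = {(v, 3 * n + 2)} \<triangle> (\<lambda>c. (v, 2 * n + c)) ` {..<n}"
    by (rule insert_eq_xor) auto
  also have "(\<lambda>c. (v, 2 * n + c)) ` {..<n} = xor_sum (\<lambda>c. {(v, 2 * n + c)}) {..<n}"
    by (rule image_eq_xor_sum) (auto simp: inj_on_def)
  finally show ?thesis using False by simp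
qed (simp add: column_X_def)

text \<open>The summand 0 is kept so that the equation matches the form of
  \<open>column_label_Suc\<close>.\<close>

lemma basis_image_X_0:
  "basis_image_X n ((x, y), 3 * z + 0) = {((x, y), 3 * n)} \<triangle>
    xor_sum (\<lambda>c. {((x, y), 2 * c)} \<triangle> {((x, y), 2 * n + c)} \<triangle> {((x + 1, y), 2 * n + c)}) {z..<n}"
proof -
  have *: "lift (site_basis_X n) ((x, y), 3 * z + 0) =
      {((x, y), 3 * n)} \<triangle> xor_sum (\<lambda>c. {((x, y), 2 * c)}) {z..<n}"
    using lift_column(1)[where i = 0 and v = "(x, y)"] image_column_X[where i = 0 and v = "(x, y)"] by simp
  have c: "cnot_X n (0, 0) ((x, y), 2 * c) = {((x, y), 2 * c)} \<triangle> {((x, y), 2 * n + c)}"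
    "xor_sum (cnot_X n (1, 0)) ({((x, y), 2 * c)} \<triangle> {((x, y), 2 * n + c)}) =
      {((x, y), 2 * c)} \<triangle> {((x, y), 2 * n + c)} \<triangle> {((x + 1, y), 2 * n + c)}"
    if "c \<in> {z..<n}" for c
    using that by (simp_all add: xor_sum_xor cnot_X_def pair_eq_xor xor_ac)
  have e: "cnot_X n u ((x, y), 3 * n) = {((x, y), 3 * n)}" for u by (simp add: cnot_X_def)
  have "xor_sum (cnot_X n (0, 0)) (lift (site_basis_X n) ((x, y), 3 * z + 0)) = {((x, y), 3 * n)} \<triangle>
      xor_sum (\<lambda>c. {((x, y), 2 * c)} \<triangle> {((x, y), 2 * n + c)}) {z..<n}"
    unfolding * by (subst xor_sum_cnot_insert) (auto simp: e c intro: xor_sum.cong)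
  also have "xor_sum (cnot_X n (1, 0)) \<dots> = {((x, y), 3 * n)} \<triangle>
      xor_sum (\<lambda>c. {((x, y), 2 * c)} \<triangle> {((x, y), 2 * n + c)} \<triangle> {((x + 1, y), 2 * n + c)}) {z..<n}"
    by (subst xor_sum_cnot_insert) (simp_all only: e c cong: xor_sum.cong, simp)
  finally show ?thesis unfolding basis_image_X_def .
qed

lemma basis_image_X_1:
  "basis_image_X n ((x, y), 3 * z + 1) = {((x, y), 3 * n + 1)} \<triangle>
    xor_sum (\<lambda>c. {((x, y), 2 * c + 1)}) {z..<n}"
proof -
  have "cnot_X n u ((x, y), 3 * n + 1) = {((x, y), 3 * n + 1)}"
    "cnot_X n u ((x, y), 2 * c + 1) = {((x, y), 2 * c + 1)}" for u c by (simp_all add: cnot_X_def)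
  moreover have "lift (site_basis_X n) ((x, y), 3 * z + 1) =
      {((x, y), 3 * n + 1)} \<triangle> xor_sum (\<lambda>c. {((x, y), 2 * c + 1)}) {z..<n}"
    by (simp only: lift_column image_column_X)
  ultimately show ?thesis
    unfolding basis_image_X_def by (simp add: xor_sum_cnot_insert cong: xor_sum.cong)
qed

lemma basis_image_X_2:
  "basis_image_X n ((x, y), 3 * z + 2) = (if z < n then {((x, y), 2 * n + z)} else
    {((x, y), 3 * n + 2)} \<triangle> xor_sum (\<lambda>c. {((x, y), 2 * n + c)}) {..<n})"
proof -
  have "cnot_X n u ((x, y), 3 * n + 2) = {((x, y), 3 * n + 2)}"
    "cnot_X n u ((x, y), 2 * n + c) = {((x, y), 2 * n + c)}" for u c by (simp_all add: cnot_X_def)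
  moreover have "lift (site_basis_X n) ((x, y), 3 * z + 2) = (if z < n then {((x, y), 2 * n + z)} else
      {((x, y), 3 * n + 2)} \<triangle> xor_sum (\<lambda>c. {((x, y), 2 * n + c)}) {..<n})"
    by (simp only: lift_column image_column_X_2)
  ultimately show ?thesis
    unfolding basis_image_X_def by (simp add: xor_sum_cnot_insert cong: xor_sum.cong)
qed

text \<open>Empty at the top height \<open>n\<close>, which has no code of its own. The stride
  \<open>k\<close> is 2 for the toric qubits and 1 for the third qubits.\<close>

definition qubit_below :: "nat \<Rightarrow> nat \<Rightarrow> nat \<Rightarrow> int \<times> int \<Rightarrow> nat \<Rightarrow> plane_qubit set" where
  "qubit_below n k i v w = (if w < n then {(v, k * w + i)} else {})"

definition qubit_top :: "nat \<Rightarrow> nat \<Rightarrow> int \<times> int \<Rightarrow> nat \<Rightarrow> plane_qubit set" where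
  "qubit_top n i v w = (if w = n then {(v, 3 * n + i)} else {})"

text \<open>The cyclic predecessor of a height.\<close>

definition below :: "nat \<Rightarrow> nat \<Rightarrow> nat" where
  "below n w = (if w = 0 then n else w - 1)"

text \<open>Only the first layer acts: a controlled-not fixes Z on its control, and the qubits
  \<open>3 * n + i\<close> meet no gate.\<close>

lemma basis_image_Z_01:
  assumes "w \<le> n" "i < 2"
  shows "basis_image_Z n (v, 3 * w + i) =
    qubit_below n 2 i v w \<triangle> qubit_below n 2 i v (below n w) \<triangle> qubit_top n i v w"
proof -
  let ?r = "qubit_below n 2 i v w \<triangle> qubit_below n 2 i v (below n w) \<triangle> qubit_top n i v w"
  have "Pair v ` column_Z n i w = ?r"
    using assms by (auto simp: column_Z_def qubit_below_def qubit_top_def below_def)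
  then have *: "lift (site_basis_Z n) (v, 3 * w + i) = ?r"
    using assms by (simp only: lift_column)
  have "xor_sum (cnot_Z n u) ?r = ?r" for u
  proof -
    have "?r \<subseteq> {(v, 2 * c + i) |c. c < n} \<union> {(v, 3 * n + i)}"
      by (intro xor_subset) (auto simp: qubit_below_def qubit_top_def)
    moreover have "cnot_Z n u (v, 2 * c + i) = {(v, 2 * c + i)}" if "c < n" for c
      using that assms by (auto simp: cnot_Z_def)
    moreover have "cnot_Z n u (v, 3 * n + i) = {(v, 3 * n + i)}" by (simp add: cnot_Z_def)
    ultimately have "cnot_Z n u q = {q}" if "q \<in> ?r" for q
      using that by blast
    then have "xor_sum (cnot_Z n u) ?r = xor_sum (\<lambda>q. {q}) ?r" by (rule xor_sum.cong[OF refl])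
    also have "\<dots> = ?r" by (rule xor_sum_singletons) (simp add: qubit_below_def qubit_top_def)
    finally show ?thesis .
  qed
  then show ?thesis unfolding basis_image_Z_def * by simp
qed

text \<open>Z on a target acquires Z on its two controls, at \<open>x\<close> and at
  \<open>x - 1\<close>.\<close>

lemma basis_image_Z_2:
  assumes "w \<le> n"
  shows "basis_image_Z n ((x, y), 3 * w + 2) = qubit_below n 1 (2 * n) (x, y) w \<triangle>
    qubit_below n 2 0 (x, y) w \<triangle> qubit_below n 2 0 (x - 1, y) w \<triangle> {((x, y), 3 * n + 2)}"
proof -
  have "Pair (x, y) ` column_Z n 2 w = qubit_below n 1 (2 * n) (x, y) w \<triangle> {((x, y), 3 * n + 2)}"
    by (auto simp: column_Z_def qubit_below_def)
  then have *: "lift (site_basis_Z n) ((x, y), 3 * w + 2) =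
      qubit_below n 1 (2 * n) (x, y) w \<triangle> {((x, y), 3 * n + 2)}"
    by (simp only: lift_column)
  have e: "cnot_Z n u (v, 3 * n + 2) = {(v, 3 * n + 2)}" for u v by (simp add: cnot_Z_def)
  show ?thesis
  proof (cases "w < n")
    case True
    then have "cnot_Z n (0, 0) ((x, y), w + 2 * n) = {((x, y), w + 2 * n)} \<triangle> {((x, y), 2 * w)}"
      "cnot_Z n (1, 0) ((x, y), w + 2 * n) = {((x, y), w + 2 * n)} \<triangle> {((x - 1, y), 2 * w)}"
      "cnot_Z n (1, 0) ((x, y), 2 * w) = {((x, y), 2 * w)}"
      by (simp_all add: cnot_Z_def pair_eq_xor)
    then show ?thesis
      unfolding basis_image_Z_def * using True
      by (simp add: qubit_below_def xor_sum_xor e e[simplified] xor_ac)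
  next
    case False
    then show ?thesis
      unfolding basis_image_Z_def * by (simp add: qubit_below_def e[simplified])
  qed
qed

section \<open>Folding the compact direction\<close>

lemma fold_qubits_eq: "finite A \<Longrightarrow> fold_qubits L A = xor_sum (\<lambda>q. {column_label L q}) A"
  by (auto simp: fold_qubits_def in_xor_sum eq_commute)

lemma xor_sum_fold_qubits:
  "finite A \<Longrightarrow> xor_sum f (fold_qubits L A) = xor_sum (\<lambda>q. f (column_label L q)) A"
  by (simp add: fold_qubits_eq xor_sum_xor_sum)

definition height :: "nat \<Rightarrow> int \<Rightarrow> nat" where
  "height n z = nat (z mod int (Suc n))"

lemma column_label_Suc: "column_label (Suc n) ((x, y, z), i) = ((x, y), 3 * height n z + i)"
  by (simp add: column_label_def height_def)

lemma height_le: "height n z \<le> n"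
proof -
  have "z mod int (Suc n) \<le> int n" using pos_mod_bound[of "int (Suc n)" z] by linarith
  then show ?thesis by (simp only: height_def nat_le_iff)
qed

lemma height_int: "w \<le> n \<Longrightarrow> height n (int w) = w"
  by (simp add: height_def)

lemma int_height: "int (height n z) = z mod int (Suc n)"
  unfolding height_def by (simp del: of_nat_Suc)

lemma height_succ: "height n (z + 1) = (if height n z = n then 0 else Suc (height n z))"
proof -
  have "int (height n (z + 1)) = (int (height n z) + 1) mod int (Suc n)"
    unfolding int_height by (rule mod_add_left_eq[symmetric])
  also have "\<dots> = int (if height n z = n then 0 else Suc (height n z))"
    using height_le[of n z] by (auto simp: mod_pos_pos_trivial add.commute)
  finally show ?thesis by (simp only: of_nat_eq_iff)
qed

lemma height_pred: "height n (z - 1) = below n (height n z)"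
  using height_succ[of n "z - 1"] height_le[of n "z - 1"] by (auto simp: below_def)

section \<open>The generators of a symmetry breaking sector\<close>

abbreviation edge_image_X :: "nat \<Rightarrow> cubic_qubit \<Rightarrow> plane_qubit set" where
  "edge_image_X n q \<equiv> basis_image_X n (column_label (Suc n) q)"

abbreviation edge_image_Z :: "nat \<Rightarrow> cubic_qubit \<Rightarrow> plane_qubit set" where
  "edge_image_Z n q \<equiv> basis_image_Z n (column_label (Suc n) q)"

text \<open>The codes met by a cube between heights \<open>w\<close> and \<open>w + 1\<close>: code
  \<open>w\<close> alone, except that the cube across the identification, \<open>w = n\<close>,
  meets all of them.\<close>

definition codes_below :: "nat \<Rightarrow> nat \<Rightarrow> nat set" where
  "codes_below n w = (if w < n then {w} else {..<n})"

lemma interval_xor: "{height n z..<n} \<triangle> {height n (z + 1)..<n} = codes_below n (height n z)"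
  using height_le[of n z] by (auto simp: height_succ codes_below_def)

lemma edge_pair_image_X_0:
  "edge_image_X n ((x, y, z), 0) \<triangle> edge_image_X n ((x, y, z + 1), 0) =
    xor_sum (\<lambda>c. {((x, y), 2 * c)} \<triangle> {((x, y), 2 * n + c)} \<triangle> {((x + 1, y), 2 * n + c)})
      (codes_below n (height n z))"
  unfolding column_label_Suc basis_image_X_0 interval_xor[symmetric]
  by (simp add: xor_sum_xor xor_ac)

lemma edge_pair_image_X_1:
  "edge_image_X n ((x, y, z), 1) \<triangle> edge_image_X n ((x, y, z + 1), 1) =
    xor_sum (\<lambda>c. {((x, y), 2 * c + 1)}) (codes_below n (height n z))"
  unfolding column_label_Suc basis_image_X_1 interval_xor[symmetric]
  by (simp add: xor_sum_xor xor_ac)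

lemma edge_image_X_2:
  "edge_image_X n ((x, y, z), 2) =
    xor_sum (\<lambda>c. {((x, y), 2 * n + c)}) (codes_below n (height n z)) \<triangle>
      qubit_top n 2 (x, y) (height n z)"
  using height_le[of n z]
  by (simp only: column_label_Suc basis_image_X_2) (auto simp: codes_below_def qubit_top_def xor_ac)

lemma cube_edges_eq: "cube_edges (x, y, z) =
    {((x, y, z), 0), ((x, y, z + 1), 0), ((x, y + 1, z), 0), ((x, y + 1, z + 1), 0),
     ((x, y, z), 1), ((x, y, z + 1), 1), ((x + 1, y, z), 1), ((x + 1, y, z + 1), 1),
     ((x, y, z), 2), ((x + 1, y, z), 2), ((x, y + 1, z), 2), ((x + 1, y + 1, z), 2)}"
proof -
  have pairs: "{f d d' |d d'. d \<in> {0, 1} \<and> d' \<in> {0, 1}} = {f 0 0, f 0 1, f 1 0, f 1 1}"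
    for f :: "int \<Rightarrow> int \<Rightarrow> cubic_qubit" by blast
  show ?thesis unfolding cube_edges_def prod.case pairs by auto
qed

text \<open>The third qubits that the controlled-not gates attach to the x-edges cancel those of the
  z-edges, leaving plaquettes and, for the topmost cube, four string qubits.\<close>

lemma cube_image:
  "xor_sum (edge_image_X n) (cube_edges (x, y, z)) =
    xor_sum (\<lambda>c. toric_plaquette c x y) (codes_below n (height n z)) \<triangle>
      (qubit_top n 2 (x, y) (height n z) \<triangle> qubit_top n 2 (x + 1, y) (height n z) \<triangle>
       (qubit_top n 2 (x, y + 1) (height n z) \<triangle> qubit_top n 2 (x + 1, y + 1) (height n z)))"
proof -
  let ?h = "edge_image_X n"
  have "xor_sum ?h (cube_edges (x, y, z)) =
      (?h ((x, y, z), 0) \<triangle> ?h ((x, y, z + 1), 0)) \<triangle> (?h ((x, y + 1, z), 0) \<triangle> ?h ((x, y + 1, z + 1), 0)) \<triangle>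
      ((?h ((x, y, z), 1) \<triangle> ?h ((x, y, z + 1), 1)) \<triangle> (?h ((x + 1, y, z), 1) \<triangle> ?h ((x + 1, y, z + 1), 1))) \<triangle>
      (?h ((x, y, z), 2) \<triangle> ?h ((x + 1, y, z), 2) \<triangle> (?h ((x, y + 1, z), 2) \<triangle> ?h ((x + 1, y + 1, z), 2)))"
    unfolding cube_edges_eq by (simp add: xor_assoc del: One_nat_def)
  moreover have "toric_plaquette c x y =
      ({((x, y), 2 * c)} \<triangle> {((x, y), 2 * n + c)} \<triangle> {((x + 1, y), 2 * n + c)}) \<triangle>
      ({((x, y + 1), 2 * c)} \<triangle> {((x, y + 1), 2 * n + c)} \<triangle> {((x + 1, y + 1), 2 * n + c)}) \<triangle>
      ({((x, y), 2 * c + 1)} \<triangle> {((x + 1, y), 2 * c + 1)}) \<triangle>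
      ({((x, y), 2 * n + c)} \<triangle> {((x + 1, y), 2 * n + c)} \<triangle>
        ({((x, y + 1), 2 * n + c)} \<triangle> {((x + 1, y + 1), 2 * n + c)}))" for c
  proof -
    have "toric_plaquette c x y =
        {((x, y), 2 * c)} \<triangle> {((x, y + 1), 2 * c)} \<triangle> ({((x, y), 2 * c + 1)} \<triangle> {((x + 1, y), 2 * c + 1)})"
      by (auto simp: toric_plaquette_def)
    then show ?thesis by (simp add: xor_ac)
  qed
  ultimately show ?thesis
    unfolding edge_pair_image_X_0 edge_pair_image_X_1 edge_image_X_2
    by (simp only: xor_sum.distrib) (simp only: xor_ac)
qed

lemma edge_image_Z_01:
  "i < 2 \<Longrightarrow> edge_image_Z n ((x, y, z), i) = qubit_below n 2 i (x, y) (height n z) \<triangle>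
    qubit_below n 2 i (x, y) (below n (height n z)) \<triangle> qubit_top n i (x, y) (height n z)"
  unfolding column_label_Suc by (rule basis_image_Z_01[OF height_le])

lemma edge_image_Z_2:
  "edge_image_Z n ((x, y, z), 2) = qubit_below n 1 (2 * n) (x, y) (height n z) \<triangle>
    qubit_below n 2 0 (x, y) (height n z) \<triangle> qubit_below n 2 0 (x - 1, y) (height n z) \<triangle>
    {((x, y), 3 * n + 2)}"
  unfolding column_label_Suc by (rule basis_image_Z_2[OF height_le])

definition star_below :: "nat \<Rightarrow> int \<Rightarrow> int \<Rightarrow> nat \<Rightarrow> plane_qubit set" where
  "star_below n x y w = (if w < n then toric_star w x y else {})"

lemma star_below_eq: "star_below n x y w =
    qubit_below n 2 0 (x, y) w \<triangle> qubit_below n 2 0 (x - 1, y) w \<triangle>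
    (qubit_below n 2 1 (x, y) w \<triangle> qubit_below n 2 1 (x, y - 1) w)"
  by (auto simp: star_below_def toric_star_def qubit_below_def)

text \<open>Controls attached to the z-edges cancel the x-edges of the zx star, which isolates the
  third qubits; in the yz star they complete the y-edges to toric stars.\<close>

lemma star_images:
  fixes n z
  defines "w \<equiv> height n z"
  shows "xor_sum (edge_image_Z n) (planar_star 0 1 (x, y, z)) =
      star_below n x y w \<triangle> star_below n x y (below n w) \<triangle>
      (qubit_top n 0 (x, y) w \<triangle> qubit_top n 0 (x - 1, y) w) \<triangle>
      (qubit_top n 1 (x, y) w \<triangle> qubit_top n 1 (x, y - 1) w)"
    and "xor_sum (edge_image_Z n) (planar_star 1 2 (x, y, z)) =
      qubit_below n 1 (2 * n) (x, y) w \<triangle> qubit_below n 1 (2 * n) (x, y) (below n w) \<triangle>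
      (star_below n x y w \<triangle> star_below n x y (below n w)) \<triangle>
      (qubit_top n 1 (x, y) w \<triangle> qubit_top n 1 (x, y - 1) w)"
    and "xor_sum (edge_image_Z n) (planar_star 2 0 (x, y, z)) =
      qubit_below n 1 (2 * n) (x, y) w \<triangle> qubit_below n 1 (2 * n) (x, y) (below n w) \<triangle>
      (qubit_top n 0 (x, y) w \<triangle> qubit_top n 0 (x - 1, y) w)"
proof -
  let ?h = "edge_image_Z n"
  have "xor_sum ?h (planar_star 0 1 (x, y, z)) =
      ?h ((x, y, z), 0) \<triangle> ?h ((x - 1, y, z), 0) \<triangle> (?h ((x, y, z), 1) \<triangle> ?h ((x, y - 1, z), 1))"
    by (simp add: planar_star_def unit_vector_def xor_assoc del: One_nat_def)
  then show "xor_sum ?h (planar_star 0 1 (x, y, z)) =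
      star_below n x y w \<triangle> star_below n x y (below n w) \<triangle>
      (qubit_top n 0 (x, y) w \<triangle> qubit_top n 0 (x - 1, y) w) \<triangle>
      (qubit_top n 1 (x, y) w \<triangle> qubit_top n 1 (x, y - 1) w)"
    by (simp add: edge_image_Z_01 star_below_eq w_def xor_ac del: One_nat_def)
  have "xor_sum ?h (planar_star 1 2 (x, y, z)) =
      ?h ((x, y, z), 1) \<triangle> ?h ((x, y - 1, z), 1) \<triangle> (?h ((x, y, z), 2) \<triangle> ?h ((x, y, z - 1), 2))"
    by (simp add: planar_star_def unit_vector_def xor_assoc del: One_nat_def)
  then show "xor_sum ?h (planar_star 1 2 (x, y, z)) =
      qubit_below n 1 (2 * n) (x, y) w \<triangle> qubit_below n 1 (2 * n) (x, y) (below n w) \<triangle>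
      (star_below n x y w \<triangle> star_below n x y (below n w)) \<triangle>
      (qubit_top n 1 (x, y) w \<triangle> qubit_top n 1 (x, y - 1) w)"
    by (simp add: edge_image_Z_01 edge_image_Z_2 height_pred star_below_eq w_def xor_ac del: One_nat_def)
  have "xor_sum ?h (planar_star 2 0 (x, y, z)) =
      ?h ((x, y, z), 2) \<triangle> ?h ((x, y, z - 1), 2) \<triangle> (?h ((x, y, z), 0) \<triangle> ?h ((x - 1, y, z), 0))"
    by (simp add: planar_star_def unit_vector_def xor_assoc del: One_nat_def)
  then show "xor_sum ?h (planar_star 2 0 (x, y, z)) =
      qubit_below n 1 (2 * n) (x, y) w \<triangle> qubit_below n 1 (2 * n) (x, y) (below n w) \<triangle>
      (qubit_top n 0 (x, y) w \<triangle> qubit_top n 0 (x - 1, y) w)"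
    by (simp add: edge_image_Z_01 edge_image_Z_2 height_pred w_def xor_ac del: One_nat_def)
qed

section \<open>Images of the wrapping strings\<close>

definition column :: "nat \<Rightarrow> nat \<Rightarrow> int \<times> int \<Rightarrow> cubic_qubit set" where
  "column L i = (\<lambda>(a, b). {((a, b, z), i) |z. 0 \<le> z \<and> z < int L})"

lemma column_eq: "column L i (a, b) = (\<lambda>w. ((a, b, int w), i)) ` {..<L}"
proof -
  have "{z. 0 \<le> z \<and> z < int L} = int ` {..<L}"
    by (auto simp: image_iff) (metis lessThan_iff of_nat_less_iff zero_le_imp_eq_int)
  moreover have "column L i (a, b) = (\<lambda>z. ((a, b, z), i)) ` {z. 0 \<le> z \<and> z < int L}"
    by (auto simp: column_def)
  ultimately show ?thesis by (simp add: image_image)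
qed

lemma finite_column: "finite (column L i v)"
  by (cases v) (simp add: column_eq)

lemma wrapping_string_eq:
  "wrapping_string L i v = fold_pauli L (if i = 2 then X_op (column L i v) else Z_op (column L i v))"
  by (cases v) (simp add: wrapping_string_def column_def Let_def)

lemma xor_sum_column: "xor_sum (\<lambda>q. f (column_label (Suc n) q)) (column (Suc n) i v) =
    xor_sum (\<lambda>w. f (v, 3 * w + i)) {..n}"
proof -
  obtain a b where v: "v = (a, b)" by (cases v)
  have "xor_sum (\<lambda>q. f (column_label (Suc n) q)) (column (Suc n) i v) =
      xor_sum (\<lambda>w. f (column_label (Suc n) ((a, b, int w), i))) {..<Suc n}"
    unfolding v column_eq by (subst xor_sum.reindex) (auto simp: inj_on_def comp_def)
  also have "\<dots> = xor_sum (\<lambda>w. f (v, 3 * w + i)) {..n}"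
    unfolding lessThan_Suc_atMost by (intro xor_sum.cong refl) (simp add: column_label_Suc height_int v)
  finally show ?thesis .
qed

text \<open>The image at the top height contains every third qubit, and the lower heights cancel
  them one by one.\<close>

lemma column_image_X: "xor_sum (edge_image_X n) (column (Suc n) 2 v) = {(v, 3 * n + 2)}"
proof -
  obtain x y where v: "v = (x, y)" by (cases v)
  have "xor_sum (edge_image_X n) (column (Suc n) 2 v) =
      xor_sum (\<lambda>w. basis_image_X n (v, 3 * w + 2)) {..<Suc n}"
    unfolding xor_sum_column lessThan_Suc_atMost ..
  also have "\<dots> = basis_image_X n (v, 3 * n + 2) \<triangle> xor_sum (\<lambda>w. basis_image_X n (v, 3 * w + 2)) {..<n}"
    unfolding lessThan_Suc by simp
  also have "xor_sum (\<lambda>w. basis_image_X n (v, 3 * w + 2)) {..<n} = xor_sum (\<lambda>w. {(v, 2 * n + w)}) {..<n}"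
    by (rule xor_sum.cong[OF refl]) (simp only: v basis_image_X_2 lessThan_iff if_True)
  also have "basis_image_X n (v, 3 * n + 2) = {(v, 3 * n + 2)} \<triangle> xor_sum (\<lambda>c. {(v, 2 * n + c)}) {..<n}"
    by (simp only: v basis_image_X_2 if_False less_irrefl)
  finally show ?thesis by (simp add: xor_ac)
qed

lemma column_image_Z:
  assumes "i < 2"
  shows "xor_sum (edge_image_Z n) (column (Suc n) i v) = {(v, 3 * n + i)}"
proof -
  let ?a = "qubit_below n 2 i v"
  have "xor_sum (edge_image_Z n) (column (Suc n) i v) =
      xor_sum (\<lambda>w. basis_image_Z n (v, 3 * w + i)) {..<Suc n}"
    unfolding xor_sum_column lessThan_Suc_atMost ..
  also have "\<dots> = xor_sum (\<lambda>w. ?a w \<triangle> ?a (below n w) \<triangle> qubit_top n i v w) {..<Suc n}"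
    using assms by (intro xor_sum.cong refl basis_image_Z_01) auto
  also have "\<dots> = ?a n \<triangle> {(v, 3 * n + i)}"
  proof -
    \<comment> \<open>Telescoping; the predecessor of height 0 is \<open>n\<close>, where
      \<open>?a\<close> is empty, so no initial term remains.\<close>
    have "xor_sum (\<lambda>w. ?a w \<triangle> ?a (below n w) \<triangle> qubit_top n i v w) {..<m} =
        (if m = 0 then {} else ?a (m - 1))" if "m \<le> n" for m
      using that
      by (induction m) (auto simp: lessThan_Suc qubit_top_def below_def qubit_below_def xor_ac)
    then show ?thesis
      by (simp add: lessThan_Suc) (auto simp: qubit_top_def below_def qubit_below_def)
  qed
  finally show ?thesis by (simp add: qubit_below_def)
qed

section \<open>The sector and the copies of the toric code\<close>

lemma fold_qubits_empty [simp]: "fold_qubits L {} = {}"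
  by (simp add: fold_qubits_def)

lemma fold_pauli_X: "fold_pauli L (X_op a) = X_op (fold_qubits L a)"
  and fold_pauli_Z: "fold_pauli L (Z_op a) = Z_op (fold_qubits L a)"
  by (simp_all add: X_op_def Z_op_def)

lemma decoupling_map_fold:
  "finite a \<Longrightarrow> decoupling_map n (fold_pauli (Suc n) (X_op a)) = X_op (xor_sum (edge_image_X n) a)"
  "finite a \<Longrightarrow> decoupling_map n (fold_pauli (Suc n) (Z_op a)) = Z_op (xor_sum (edge_image_Z n) a)"
  by (simp_all add: X_op_def Z_op_def decoupling_map_simp xor_sum_fold_qubits)

lemma decoupling_map_scale: "decoupling_map n (scale_pauli k p) = scale_pauli k (decoupling_map n p)"
  by (cases p) (simp add: decoupling_map_simp)

lemma finite_cube_edges: "finite (cube_edges v)"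
  by (cases v rule: prod_cases3) (simp add: cube_edges_eq)

lemma finite_planar_star: "finite (planar_star i j v)"
  by (simp add: planar_star_def)

lemma fold_qubits_subset:
  assumes "finite a" "snd ` a \<subseteq> {..<3}"
  shows "finite (fold_qubits (Suc n) a) \<and> fold_qubits (Suc n) a \<subseteq> plane_qubits (3 * n + 3)"
proof
  show "finite (fold_qubits (Suc n) a)" using assms by (simp add: fold_qubits_eq finite_xor_sum)
  show "fold_qubits (Suc n) a \<subseteq> plane_qubits (3 * n + 3)"
    unfolding fold_qubits_eq[OF assms(1)]
  proof (rule xor_sum_subset)
    fix q assume "q \<in> a"
    moreover obtain x y z i where q: "q = ((x, y, z), i)" by (metis prod.exhaust)
    ultimately have "i < 3" using assms(2) by auto
    then show "{column_label (Suc n) q} \<subseteq> plane_qubits (3 * n + 3)"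
      using height_le[of n z] by (simp add: q column_label_Suc plane_qubits_def)
  qed
qed

definition sector_generators ::
    "nat \<Rightarrow> (nat \<Rightarrow> int \<times> int \<Rightarrow> complex) \<Rightarrow> plane_qubit pauli set" where
  "sector_generators n s = fold_pauli (Suc n) ` xcube_generators \<union>
     {scale_pauli (s i v) (wrapping_string (Suc n) i v) |i v. i < 3}"

lemma fold_xcube_carrier:
  "fold_pauli (Suc n) ` xcube_generators \<subseteq> carrier (plane_paulis (3 * n + 3))"
proof
  fix p assume "p \<in> fold_pauli (Suc n) ` xcube_generators"
  then consider v where "p = fold_pauli (Suc n) (X_op (cube_edges v))"
    | i j v where "p = fold_pauli (Suc n) (Z_op (planar_star i j v))" "i < 3" "j < 3"
    unfolding xcube_generators_def by fastforce
  then show "p \<in> carrier (plane_paulis (3 * n + 3))"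
  proof cases
    case (1 v)
    have "snd ` cube_edges v \<subseteq> {..<3}" by (cases v rule: prod_cases3) (auto simp: cube_edges_eq)
    then show ?thesis
      using 1 fold_qubits_subset[OF finite_cube_edges] by (simp add: fold_pauli_X)
  next
    case (2 i j v)
    then have "snd ` planar_star i j v \<subseteq> {..<3}" by (auto simp: planar_star_def)
    then show ?thesis
      using 2 fold_qubits_subset[OF finite_planar_star] by (simp add: fold_pauli_Z)
  qed
qed

lemma sector_generators_carrier:
  assumes "\<And>i v. i < 3 \<Longrightarrow> s i v \<in> {1, -1}"
  shows "sector_generators n s \<subseteq> carrier (plane_paulis (3 * n + 3))"
proof -
  have "scale_pauli (s i v) (wrapping_string (Suc n) i v) \<in> carrier (plane_paulis (3 * n + 3))"
    if "i < 3" for i v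
  proof (rule scale_pauli_carrier[OF assms[OF that]])
    have "snd ` column (Suc n) i v \<subseteq> {..<3}" using that by (cases v) (auto simp: column_eq)
    from fold_qubits_subset[OF finite_column this]
    show "wrapping_string (Suc n) i v \<in> carrier (plane_paulis (3 * n + 3))"
      by (cases "i = 2") (simp_all add: wrapping_string_eq fold_pauli_X fold_pauli_Z)
  qed
  then show ?thesis unfolding sector_generators_def using fold_xcube_carrier by blast
qed

lemma stabilizers_sector:
  assumes "\<And>i v. i < 3 \<Longrightarrow> s i v \<in> {1, -1}"
  shows "stabilizers (symmetry_breaking_sector (Suc n) s) =
    generate (plane_paulis (3 * n + 3)) (sector_generators n s)"
proof -
  have N: "3 * Suc n = 3 * n + 3" by simp
  have "{scale_pauli (s i v) (wrapping_string (Suc n) i v) |i v. i < 3} \<subseteq>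
      carrier (plane_paulis (3 * n + 3))"
    using sector_generators_carrier[where s = s, OF assms] unfolding sector_generators_def by blast
  then show ?thesis
    unfolding symmetry_breaking_sector_def compactified_xcube_def stabilizer_model.simps N
      sector_generators_def
    by (rule group.generate_Un_generate[OF group_pauli_group fold_xcube_carrier])
qed

text \<open>The sign of the stabilizer Z on the qubit \<open>(v, j)\<close> after the decoupling.\<close>

definition top_sign :: "nat \<Rightarrow> (nat \<Rightarrow> int \<times> int \<Rightarrow> complex) \<Rightarrow> int \<times> int \<Rightarrow> nat \<Rightarrow> complex" where
  "top_sign n s v j = (if 3 * n \<le> j then s (j - 3 * n) v else 1)"

definition decoupled_generators ::
    "nat \<Rightarrow> (nat \<Rightarrow> int \<times> int \<Rightarrow> complex) \<Rightarrow> plane_qubit pauli set" where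
  "decoupled_generators n s =
     {X_op (toric_plaquette c x y) |c x y. c < n} \<union> {Z_op (toric_star c x y) |c x y. c < n} \<union>
     {scale_pauli (s 2 v) (X_op {(v, 3 * n + 2)}) |v. True} \<union>
     {scale_pauli (top_sign n s v j) (Z_op {(v, j)}) |v j. 2 * n \<le> j \<and> j < 3 * n + 2}"

lemma Z_op_xor_generate:
  "Z_op a \<in> generate (pauli_group Q) A \<Longrightarrow> Z_op b \<in> generate (pauli_group Q) A \<Longrightarrow>
    Z_op (a \<triangle> b) \<in> generate (pauli_group Q) A"
  using generate.eng[of "Z_op a" "pauli_group Q" A "Z_op b"] by (simp add: Z_op_def mult_pauli_group)

text \<open>This inclusion respects signs: the cubes below the top give the plaquettes, products of
  Z operators produce no phase, and each wrapping string carries its own sign.\<close>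

lemma decoupled_subset:
  "decoupled_generators n s \<subseteq> generate (pauli_group Q) (decoupling_map n ` sector_generators n s)"
    (is "_ \<subseteq> ?S")
proof -
  have gen: "decoupling_map n p \<in> ?S" if "p \<in> sector_generators n s" for p
    using that by (auto intro: generate.incl)
  have cube: "X_op (xor_sum (edge_image_X n) (cube_edges v)) \<in> ?S" for v
    using gen[of "fold_pauli (Suc n) (X_op (cube_edges v))"]
    unfolding decoupling_map_fold(1)[OF finite_cube_edges] sector_generators_def xcube_generators_def
    by blast
  have star: "Z_op (xor_sum (edge_image_Z n) (planar_star i j v)) \<in> ?S"
    if "(i, j) \<in> {(0, 1), (1, 2), (2, 0)}" for i j v
    using gen[of "fold_pauli (Suc n) (Z_op (planar_star i j v))"] that
    unfolding decoupling_map_fold(2)[OF finite_planar_star] sector_generators_def xcube_generators_def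
    by blast
  have plaquette: "X_op (toric_plaquette c x y) \<in> ?S" if "c < n" for c x y
    using cube[of "(x, y, int c)"] that
    by (simp add: cube_image height_int codes_below_def qubit_top_def)
  \<comment> \<open>The vertex generators give differences of neighbouring heights only. At height 0
    the neighbour is the empty top height, so the induction starts with a single star and
    climbs.\<close>
  have "Z_op (qubit_below n 1 (2 * n) (x, y) w) \<in> ?S \<and> Z_op (star_below n x y w) \<in> ?S" if "w < n" for x y w
    using that
  proof (induction w)
    case (0)
    have *: "below n 0 = n" "qubit_below n k i v n = {}" "star_below n x y n = {}" for k i v
      by (simp_all add: below_def qubit_below_def star_below_def)
    show ?case
      using star[of 2 0 "(x, y, 0)"] star[of 0 1 "(x, y, 0)"] 0 height_int[of 0 n]
      by (simp add: star_images * qubit_top_def del: One_nat_def)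
  next
    case (Suc w)
    have b: "below n (Suc w) = w" by (simp add: below_def)
    have h: "height n (int (Suc w)) = Suc w" using Suc.prems by (intro height_int) simp
    have "Z_op (qubit_below n 1 (2 * n) (x, y) (Suc w) \<triangle> qubit_below n 1 (2 * n) (x, y) w) \<in> ?S"
      "Z_op (star_below n x y (Suc w) \<triangle> star_below n x y w) \<in> ?S"
      using star[of 2 0 "(x, y, int (Suc w))"] star[of 0 1 "(x, y, int (Suc w))"] Suc.prems
      unfolding star_images h b by (simp_all add: qubit_top_def)
    from Z_op_xor_generate[OF this(1)] Z_op_xor_generate[OF this(2)] Suc show ?case
      by (fastforce simp: xor_assoc)
  qed
  then have below: "Z_op {(v, 2 * n + w)} \<in> ?S" and star': "Z_op (toric_star w x y) \<in> ?S"
    if "w < n" for v w x y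
    using that by (cases v; force simp: qubit_below_def star_below_def add.commute)+
  have string: "scale_pauli (s i v) (decoupling_map n (wrapping_string (Suc n) i v)) \<in> ?S" if "i < 3" for i v
  proof -
    have "scale_pauli (s i v) (wrapping_string (Suc n) i v) \<in> sector_generators n s"
      using that unfolding sector_generators_def by blast
    from gen[OF this] show ?thesis by (simp add: decoupling_map_scale)
  qed
  have string_2: "scale_pauli (s 2 v) (X_op {(v, 3 * n + 2)}) \<in> ?S" for v
    using string[of 2 v]
    by (simp add: wrapping_string_eq decoupling_map_fold(1)[OF finite_column] column_image_X)
  have string_01: "scale_pauli (s i v) (Z_op {(v, 3 * n + i)}) \<in> ?S" if "i < 2" for i v
    using string[of i v] that
    by (simp add: wrapping_string_eq decoupling_map_fold finite_column column_image_Z)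
  have anc: "scale_pauli (top_sign n s v j) (Z_op {(v, j)}) \<in> ?S" if "2 * n \<le> j" "j < 3 * n + 2" for v j
  proof (cases "3 * n \<le> j")
    case True
    then show ?thesis using string_01[of "j - 3 * n" v] that by (simp add: top_sign_def)
  next
    case False
    moreover have "scale_pauli 1 p = p" for p :: "plane_qubit pauli" by (cases p) simp
    ultimately show ?thesis using below[of "j - 2 * n" v] that by (simp add: top_sign_def)
  qed
  show ?thesis
    unfolding decoupled_generators_def using plaquette star' string_2 anc by blast
qed

text \<open>Working modulo phases ignores the sign relations that, for instance, the topmost cubes
  impose on the strings; consistency of the signs takes care of them in
  \<open>generate_eqI\<close>.\<close>

lemma sector_vectors_subset:
  "pauli_vector ` decoupling_map n ` sector_generators n s \<subseteq>
    xor_span (pauli_vector ` decoupled_generators n s)" (is "_ \<subseteq> ?V")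
proof -
  define X where "X = {a. pauli_vector (X_op a) \<in> ?V}"
  define Z where "Z = {a. pauli_vector (Z_op a) \<in> ?V}"
  have X_xor: "a \<triangle> b \<in> X" if "a \<in> X" "b \<in> X" for a b
    using xor_span_xor[of "pauli_vector (X_op a)" _ "pauli_vector (X_op b)"] that
    by (simp add: X_def X_op_def xor_Plus)
  have Z_xor: "a \<triangle> b \<in> Z" if "a \<in> Z" "b \<in> Z" for a b
    using xor_span_xor[of "pauli_vector (Z_op a)" _ "pauli_vector (Z_op b)"] that
    by (simp add: Z_def Z_op_def xor_Plus)
  have empty: "{} \<in> X" "{} \<in> Z"
    using xor_span.empty[of "pauli_vector ` decoupled_generators n s"]
    by (simp_all add: X_def Z_def X_op_def Z_op_def Plus_def)
  have sum: "xor_sum f K \<in> X" if "\<And>c. c \<in> K \<Longrightarrow> f c \<in> X" for f :: "nat \<Rightarrow> plane_qubit set" and K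
    using that by (induction K rule: infinite_finite_induct) (auto intro: empty X_xor)
  have gen: "pauli_vector p \<in> ?V" if "p \<in> decoupled_generators n s" for p
    using that by (auto intro: xor_span_base)
  have "toric_plaquette c x y \<in> X" if "c < n" for c x y
    unfolding X_def mem_Collect_eq by (rule gen) (use that in \<open>unfold decoupled_generators_def, blast\<close>)
  moreover have top_X: "{(v, 3 * n + 2)} \<in> X" for v
    unfolding X_def mem_Collect_eq
    using gen[of "scale_pauli (s 2 v) (X_op {(v, 3 * n + 2)})"]
    unfolding decoupled_generators_def pauli_vector_scale by blast
  ultimately have cube: "xor_sum (edge_image_X n) (cube_edges v) \<in> X" for v
    by (cases v rule: prod_cases3)
      (auto simp: cube_image qubit_top_def codes_below_def intro!: X_xor sum empty)
  have star: "star_below n x y w \<in> Z" for x y w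
  proof (cases "w < n")
    case True
    then have "toric_star w x y \<in> Z"
      unfolding Z_def mem_Collect_eq by (intro gen) (unfold decoupled_generators_def, blast)
    then show ?thesis using True by (simp add: star_below_def)
  qed (simp add: star_below_def empty)
  have anc: "{(v, j)} \<in> Z" if "2 * n \<le> j" "j < 3 * n + 2" for v j
    unfolding Z_def mem_Collect_eq
    using gen[of "scale_pauli (top_sign n s v j) (Z_op {(v, j)})"] that
    unfolding decoupled_generators_def pauli_vector_scale by blast
  have below: "qubit_below n 1 (2 * n) v w \<in> Z" for v w
    using anc[of "w + 2 * n" v] empty by (simp add: qubit_below_def)
  have top: "qubit_top n i v w \<in> Z" if "i < 2" for i v w
    using anc[of "3 * n + i" v] empty that by (simp add: qubit_top_def)
  have stars: "xor_sum (edge_image_Z n) (planar_star i j v) \<in> Z"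
    if "(i, j) \<in> {(0, 1), (1, 2), (2, 0)}" for i j v
    using that
    by (cases v rule: prod_cases3)
      (auto simp: star_images simp del: One_nat_def intro!: Z_xor star below top)
  have string: "pauli_vector (decoupling_map n (wrapping_string (Suc n) i v)) \<in> ?V" if "i < 3" for i v
  proof (cases "i = 2")
    case True
    then show ?thesis
      using top_X[of v]
      by (simp add: wrapping_string_eq decoupling_map_fold(1) finite_column column_image_X X_def
          del: pauli_vector.simps)
  next
    case False
    then have "i < 2" using that by simp
    then show ?thesis
      using anc[of "3 * n + i" v] False
      by (simp add: wrapping_string_eq decoupling_map_fold(2) finite_column column_image_Z Z_def)
  qed
  show ?thesis
  proof
    fix a assume "a \<in> pauli_vector ` decoupling_map n ` sector_generators n s"
    then obtain p where p: "p \<in> sector_generators n s" "a = pauli_vector (decoupling_map n p)" by blast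
    then consider v where "p = fold_pauli (Suc n) (X_op (cube_edges v))"
      | i j v where "p = fold_pauli (Suc n) (Z_op (planar_star i j v))" "(i, j) \<in> {(0, 1), (1, 2), (2, 0)}"
      | i v where "p = scale_pauli (s i v) (wrapping_string (Suc n) i v)" "i < 3"
      unfolding sector_generators_def xcube_generators_def by blast
    then show "a \<in> ?V"
    proof cases
      case (1 v)
      then show ?thesis using cube[of v] p(2) by (simp add: decoupling_map_fold finite_cube_edges X_def)
    next
      case (2 i j v)
      then show ?thesis
        using stars[of i j v] p(2) by (simp add: decoupling_map_fold finite_planar_star Z_def)
    next
      case (3 i v)
      then show ?thesis using string[of i v] p(2) by (simp add: decoupling_map_scale)
    qed
  qed
qed

text \<open>The toric qubits, where X and Z are exchanged, and the string qubit stabilized by X,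
  which must become a Z stabilizer.\<close>

definition final_hadamards :: "nat \<Rightarrow> plane_qubit set" where
  "final_hadamards n = {(v, j). j < 2 * n \<or> j = 3 * n + 2}"

text \<open>The flips follow the Hadamard gates, when all three kinds of string are Z
  operators.\<close>

definition final_flips :: "nat \<Rightarrow> (nat \<Rightarrow> int \<times> int \<Rightarrow> complex) \<Rightarrow> plane_qubit set" where
  "final_flips n s = {(v, j). 3 * n \<le> j \<and> j < 3 * n + 3 \<and> s (j - 3 * n) v = -1}"

definition final_map ::
    "nat \<Rightarrow> (nat \<Rightarrow> int \<times> int \<Rightarrow> complex) \<Rightarrow> plane_qubit pauli \<Rightarrow> plane_qubit pauli" where
  "final_map n s = pauli_flip (final_flips n s) \<circ> hadamard (final_hadamards n)"

lemma final_map_decoupled: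
  assumes signs: "\<And>i v. i < 3 \<Longrightarrow> s i v \<in> {1, -1}"
  shows "final_map n s ` decoupled_generators n s =
    {X_op (toric_star c x y) |c x y. c < n} \<union> {Z_op (toric_plaquette c x y) |c x y. c < n} \<union>
    {Z_op {(v, j)} |v j. 2 * n \<le> j \<and> j < 2 * n + (n + 3)}" (is "_ = ?T")
proof -
  let ?H = "final_hadamards n" and ?P = "final_flips n s"
  have X: "final_map n s (X_op a) = Z_op a" if "a \<subseteq> ?H" "disjnt a ?P" for a
  proof -
    have *: "a - ?H = {}" "a \<inter> ?H = a" using that by auto
    show ?thesis using that(2) by (simp add: * final_map_def X_op_def Z_op_def parity_disjnt)
  qed
  have Z: "final_map n s (Z_op a) = X_op a" if "a \<subseteq> ?H" for a
  proof -
    have *: "a - ?H = {}" "a \<inter> ?H = a" using that by auto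
    show ?thesis by (simp add: * final_map_def X_op_def Z_op_def)
  qed
  have plaquette: "final_map n s (X_op (toric_plaquette c x y)) = Z_op (toric_plaquette c x y)"
    if "c < n" for c x y
    by (rule X) (use that in \<open>auto simp: toric_plaquette_def final_hadamards_def final_flips_def disjnt_def\<close>)
  have star: "final_map n s (Z_op (toric_star c x y)) = X_op (toric_star c x y)" if "c < n" for c x y
    by (rule Z) (use that in \<open>auto simp: toric_star_def final_hadamards_def\<close>)
  have top_X: "final_map n s (scale_pauli (s 2 v) (X_op {(v, 3 * n + 2)})) = Z_op {(v, 3 * n + 2)}" for v
    using signs[of 2 v]
    by (auto simp: final_map_def X_op_def Z_op_def final_hadamards_def final_flips_def)
  have anc: "final_map n s (scale_pauli (top_sign n s v j) (Z_op {(v, j)})) = Z_op {(v, j)}"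
    if "2 * n \<le> j" "j < 3 * n + 2" for v j
  proof -
    have j: "(v, j) \<notin> ?H" using that by (simp add: final_hadamards_def)
    then have "{(v, j)} \<inter> ?H = {}" "{(v, j)} - ?H = {(v, j)}" by auto
    moreover have "top_sign n s v j * parity {(v, j)} ?P = 1"
      using signs[of "j - 3 * n" v] that by (auto simp: top_sign_def final_flips_def)
    ultimately show ?thesis by (simp add: final_map_def Z_op_def)
  qed
  show ?thesis
  proof
    show "final_map n s ` decoupled_generators n s \<subseteq> ?T"
    proof
      fix p assume "p \<in> final_map n s ` decoupled_generators n s"
      then obtain p' where "p' \<in> decoupled_generators n s" "p = final_map n s p'" by blast
      then consider c x y where "p = final_map n s (X_op (toric_plaquette c x y))" "c < n"
        | c x y where "p = final_map n s (Z_op (toric_star c x y))" "c < n"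
        | v where "p = final_map n s (scale_pauli (s 2 v) (X_op {(v, 3 * n + 2)}))"
        | v j where "p = final_map n s (scale_pauli (top_sign n s v j) (Z_op {(v, j)}))"
            "2 * n \<le> j" "j < 3 * n + 2"
        unfolding decoupled_generators_def by blast
      then show "p \<in> ?T"
      proof cases
        case (3 v)
        have "2 * n \<le> 3 * n + 2 \<and> 3 * n + 2 < 2 * n + (n + 3)" by simp
        then show ?thesis using 3 unfolding top_X by blast
      next
        case (4 v j)
        then have "2 * n \<le> j \<and> j < 2 * n + (n + 3)" by simp
        then show ?thesis using 4 unfolding 4(1) anc[OF 4(2,3)] by blast
      qed (use plaquette star in fastforce)+
    qed
    show "?T \<subseteq> final_map n s ` decoupled_generators n s"
    proof
      fix p assume "p \<in> ?T"
      then consider c x y where "p = X_op (toric_star c x y)" "c < n"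
        | c x y where "p = Z_op (toric_plaquette c x y)" "c < n"
        | v j where "p = Z_op {(v, j)}" "2 * n \<le> j" "j < 2 * n + (n + 3)"
        by blast
      then show "p \<in> final_map n s ` decoupled_generators n s"
      proof cases
        case (1 c x y)
        have "Z_op (toric_star c x y) \<in> decoupled_generators n s"
          using 1 unfolding decoupled_generators_def by blast
        then show ?thesis using star[OF 1(2)] 1(1) by (metis imageI)
      next
        case (2 c x y)
        have "X_op (toric_plaquette c x y) \<in> decoupled_generators n s"
          using 2 unfolding decoupled_generators_def by blast
        then show ?thesis using plaquette[OF 2(2)] 2(1) by (metis imageI)
      next
        case (3 v j)
        show ?thesis
        proof (cases "j = 3 * n + 2")
          case True
          have "scale_pauli (s 2 v) (X_op {(v, 3 * n + 2)}) \<in> decoupled_generators n s"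
            unfolding decoupled_generators_def by blast
          then show ?thesis using top_X[of v] 3(1) True by (metis imageI)
        next
          case False
          then have j: "j < 3 * n + 2" using 3(3) by simp
          have "scale_pauli (top_sign n s v j) (Z_op {(v, j)}) \<in> decoupled_generators n s"
            using 3(2) j unfolding decoupled_generators_def by blast
          then show ?thesis using anc[OF 3(2) j] 3(1) by (metis imageI)
        qed
      qed
    qed
  qed
qed

text \<open>Multiplication and unit do not mention the set of qubits, so the inclusion is a
  homomorphism.\<close>

lemma generate_pauli_mono:
  assumes "Q \<subseteq> Q'" "A \<subseteq> carrier (pauli_group Q)"
  shows "generate (pauli_group Q') A = generate (pauli_group Q) A"
proof -
  have "id \<in> hom (pauli_group Q) (pauli_group Q')"
  proof (rule homI)
    fix p assume "p \<in> carrier (pauli_group Q)"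
    then show "id p \<in> carrier (pauli_group Q')"
      using assms(1) by (cases p) (auto simp: carrier_pauli_group simp del: insert_iff)
  next
    fix p p' :: "'a pauli"
    show "id (p \<otimes>\<^bsub>pauli_group Q\<^esub> p') = id p \<otimes>\<^bsub>pauli_group Q'\<^esub> id p'"
      by (cases p; cases p') (simp add: mult_pauli_group)
  qed
  from pauli_hom_generate[OF this assms(2)] show ?thesis by simp
qed

lemma stabilizers_toric_product:
  "stabilizers (add_product_state (n + 3) (toric_codes n)) = generate (plane_paulis (3 * n + 3))
    ({X_op (toric_star c x y) |c x y. c < n} \<union> {Z_op (toric_plaquette c x y) |c x y. c < n} \<union>
     {Z_op {(v, j)} |v j. 2 * n \<le> j \<and> j < 2 * n + (n + 3)})"
proof -
  have N: "2 * n + (n + 3) = 3 * n + 3" by simp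
  have sub: "plane_qubits (2 * n) \<subseteq> plane_qubits (3 * n + 3)" by (auto simp: plane_qubits_def)
  have toric: "{X_op (toric_star c x y) |c x y. c < n} \<union> {Z_op (toric_plaquette c x y) |c x y. c < n}
      \<subseteq> carrier (plane_paulis (3 * n + 3))"
    by (auto simp: toric_star_def toric_plaquette_def plane_qubits_def)
  have anc: "{Z_op {(v, j)} |v j. 2 * n \<le> j \<and> j < 2 * n + (n + 3)} \<subseteq> carrier (plane_paulis (3 * n + 3))"
    by (auto simp: plane_qubits_def)
  show ?thesis
    unfolding stabilizer_monoid.stabilizers_add_product_state[OF stabilizer_monoid_toric]
      qubits_toric_codes stabilizers_toric_codes generate_pauli_mono[OF sub toric_carrier, symmetric] N
    using group.generate_Un_generate[OF group_pauli_group toric anc] unfolding N .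
qed

text \<open>With \<open>L = n + 1\<close> there are \<open>3 * n + 3\<close> qubits per site:
  \<open>2 * n\<close> toric ones, and \<open>n\<close> third qubits and three string qubits as the
  \<open>n + 3\<close> product qubits.\<close>

lemma sector_lu_equivalent:
  assumes "consistent_signs (Suc n) s"
  shows "lu_equivalent (symmetry_breaking_sector (Suc n) s)
    (add_product_state (n + 3) (toric_codes n))"
proof -
  let ?P = "plane_paulis (3 * n + 3)"
  let ?A = "sector_generators n s" and ?B = "decoupled_generators n s"
  have signs: "s i v \<in> {1, -1}" if "i < 3" for i v
    using assms that unfolding consistent_signs_def by blast
  have A: "?A \<subseteq> carrier ?P" by (rule sector_generators_carrier[where s = s, OF signs])
  have sector: "stabilizers (symmetry_breaking_sector (Suc n) s) = generate ?P ?A"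
    by (rule stabilizers_sector[where s = s, OF signs])
  obtain r where "local_hom (3 * n + 3) r (decoupling_map n)"
    using clifford_circuit_local[OF clifford_circuit_decoupling] by blast
  then interpret D: local_hom "3 * n + 3" r "decoupling_map n" .
  have image: "decoupling_map n ` generate ?P ?A = generate ?P (decoupling_map n ` ?A)"
    by (rule pauli_hom_generate[OF D.hom A])
  have DA: "decoupling_map n ` ?A \<subseteq> carrier ?P" using A D.in_carrier by blast
  have "generate ?P (decoupling_map n ` ?A) = generate ?P ?B"
  proof (rule generate_eqI[OF DA decoupled_subset sector_vectors_subset])
    show "(-1, {}, {}) \<notin> generate ?P (decoupling_map n ` ?A)"
    proof
      assume "(-1, {}, {}) \<in> generate ?P (decoupling_map n ` ?A)"
      then have "(-1, {}, {}) \<in> decoupling_map n ` generate ?P ?A" by (simp only: image)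
      then obtain p where p: "p \<in> generate ?P ?A" "decoupling_map n p = (-1, {}, {})"
        by (elim imageE) (rule that, simp_all)
      have "p \<in> carrier ?P" using p(1) generate_in_carrier_pauli[OF A] by blast
      \<comment> \<open>The inverse bound shows that only a pure phase can be mapped to -1, and
        phases are fixed.\<close>
      from D.near_inverse[OF this] have "pauli_support p = {}" using p(2) by (auto simp: near_def)
      then have "p = (-1, {}, {})" using p(2) by (cases p) (simp add: decoupling_map_simp)
      then show False using p(1) assms sector unfolding consistent_signs_def by simp
    qed
  qed
  moreover have "final_map n s ` generate ?P ?B = generate ?P (final_map n s ` ?B)"
  proof (rule pauli_hom_generate)
    show "final_map n s \<in> hom ?P ?P"
      unfolding final_map_def
      by (rule hom_compose[OF hadamard_hom layer_hom[OF clifford_layer_pauli_flip]])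
        (auto simp: final_flips_def plane_qubits_def)
    show "?B \<subseteq> carrier ?P" by (rule subset_trans[OF decoupled_subset generate_in_carrier_pauli[OF DA]])
  qed
  ultimately have "(final_map n s \<circ> decoupling_map n) ` stabilizers (symmetry_breaking_sector (Suc n) s) =
      stabilizers (add_product_state (n + 3) (toric_codes n))"
    by (simp only: sector image image_comp[symmetric] final_map_decoupled[where s = s, OF signs] stabilizers_toric_product)
  moreover have "clifford_circuit (3 * n + 3) (final_map n s \<circ> decoupling_map n)"
    unfolding final_map_def comp_assoc
    by (intro clifford_circuit.add_layer clifford_circuit_decoupling clifford_layer_hadamard
        clifford_layer_pauli_flip)
      (auto simp: final_hadamards_def final_flips_def plane_qubits_def)
  moreover have "qubits_per_site (symmetry_breaking_sector (Suc n) s) = 3 * n + 3"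
    "qubits_per_site (add_product_state (n + 3) (toric_codes n)) = 3 * n + 3"
    by (simp_all add: symmetry_breaking_sector_def add_product_state_def Let_def)
  ultimately show ?thesis unfolding lu_equivalent_def by metis
qed

lemma coarse_grain_1: "coarse_grain 1 1 M = M"
proof -
  have "coarse_label 1 1 N = id" for N by (auto simp: coarse_label_def fun_eq_iff)
  moreover have "relabel_pauli (id :: plane_qubit \<Rightarrow> plane_qubit) = id" by (auto simp: fun_eq_iff)
  ultimately show ?thesis by (cases M) (simp add: coarse_grain_def)
qed

theorem mainTheorem2:
  fixes L :: nat and s :: "nat \<Rightarrow> int \<times> int \<Rightarrow> complex"
  assumes "L \<ge> 1" and "consistent_signs L s"
  shows "equivalent_to_toric_codes (symmetry_breaking_sector L s) (L - 1) \<and>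
         toric_code_number (symmetry_breaking_sector L s) = L - 1"
proof -
  obtain n where L: "L = Suc n" using assms(1) by (cases L) auto
  let ?M = "symmetry_breaking_sector L s"
  have signs: "s i v \<in> {1, -1}" if "i < 3" for i v
    using assms(2) that unfolding consistent_signs_def by blast
  have stab: "stabilizers ?M = generate (plane_paulis (qubits_per_site ?M)) (sector_generators n s)"
    and carr: "sector_generators n s \<subseteq> carrier (plane_paulis (qubits_per_site ?M))"
    using stabilizers_sector[where s = s and n = n, OF signs] sector_generators_carrier[where s = s and n = n, OF signs]
    by (simp_all add: L symmetry_breaking_sector_def ac_simps)
  interpret stabilizer_monoid ?M by (rule stabilizer_monoid_generate[OF stab carr])
  \<comment> \<open>\<open>add_product_state 0\<close> generates anew although it adds no qubit; a
    subgroup is unchanged by this.\<close>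
  have generate: "generate (plane_paulis (qubits_per_site ?M)) (stabilizers ?M) = stabilizers ?M"
    unfolding stab
    by (intro group.generate_subgroup group_pauli_group group.generate_is_subgroup carr)
  have "{Z_op {(v, j)} |v j. qubits_per_site ?M \<le> j \<and> j < qubits_per_site ?M + 0} = {}"
    by auto
  then have "stabilizers (add_product_state 0 ?M) = stabilizers ?M"
    unfolding stabilizers_add_product_state by (metis Un_empty_right add_0_right generate)
  then have "add_product_state 0 (coarse_grain 1 1 ?M) = ?M"
    unfolding coarse_grain_1 by (intro stabilizer_model.equality) simp_all
  moreover have lu: "lu_equivalent ?M (add_product_state (n + 3) (toric_codes n))"
    using sector_lu_equivalent assms(2) unfolding L .
  ultimately have eq: "equivalent_to_toric_codes ?M n"
    unfolding equivalent_to_toric_codes_def by (metis order_refl)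
  moreover have "toric_code_number ?M = n"
    unfolding toric_code_number_def
    using eq equivalent_to_toric_codes_unique[OF _ lu] by (rule the_equality)
  ultimately show ?thesis by (simp add: L)
qed

end
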